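(* Any solution $(\eta^k,\varrho^k,\mathbf u^k)_{k=1}^{N_T}$ of the semi-discrete scheme (S1)--(S2) described in the context preserves non-negativity of the density: if $\varrho^0\ge0$ then $\varrho^k\ge0$ for all $k=1,\dots,N_T$.
   Context: Geometry and time grid. $d\in\{2,3\}$, $H>0$, $\Sigma=[0,L_1]\times\cdots\times[0,L_{d-1}]$, $\widehat\Omega=\Sigma\times[0,H]$, points $x=(r,x_d)$ with $r\in\Sigma$. $T>0$, $N_T\in\mathbb N$, $\tau=T/N_T$, $t^k=k\tau$, $I^k=[t^k,t^{k+1})$. For displacements $\eta^k:\Sigma\to(-H,\infty)$ put $\mathcal A^k(\hat r,\hat x_d)=\big(\hat r,\hat x_d\frac{H+\eta^k(\hat r)}{H}\big)$, $\Omega^k=\mathcal A^k(\widehat\Omega)$, $X_k^{k-1}=\mathcal A^{k-1}\circ(\mathcal A^k)^{-1}$, $\mathcal F_k^{k-1}(x)=\frac{H+\eta^{k-1}(r)}{H+\eta^k(r)}$. $\Gamma_S=\{x_d=H+\eta^k(r)\}$ is the top boundary of $\Omega^k$ and $\Gamma_D$ the rest of $\partial\Omega^k$. $\delta_tr^k=(r^k-r^{k-1})/\tau$; $D_tr^k=\frac{r^k-(r^{k-1}\circ X_k^{k-1})\mathcal F_k^{k-1}}{\tau}$; $z^k=\delta_t\eta^k$, $\mathbf w^k=\big(\mathbf0_{d-1},z^k(r)\frac{x_d}{H+\eta^k(r)}\big)^T$, $\mathbf v^k=\mathbf u^k-\mathbf w^k$. $a>0,\gamma>1,\mu>0,\mu+\lambda\ge0,\alpha>0,\beta\ge0$;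 $p(\varrho)=a\varrho^\gamma$, $\mathbf S(\nabla\mathbf u)=2\mu\mathbf D(\mathbf u)+\lambda\,\mathrm{div}\,\mathbf u\,\mathbf I$, $\mathbf D(\mathbf u)$ the symmetric gradient; $\mathbf f^k=\frac1\tau\int_{I^k}\mathbf f\,dt$, $g^k=\frac1\tau\int_{I^k}g\,dt$. Semi-discrete scheme. Spaces $W(\Sigma)\subset W^{2,2}_0(\Sigma)$, $Q(\Omega^k)\subset L^\gamma(\Omega^k)$, $V(\Omega^k)\subset W^{1,s}(\Omega^k)$ for all $s<2$. For $k=1,\dots,N_T$, $(\eta^k,\varrho^k,\mathbf u^k)\in W(\Sigma)\times Q(\Omega^k)\times V(\Omega^k)$ satisfies, for all admissible $(\psi,\varphi,\boldsymbol\Psi)\in W(\Sigma)\times Q(\Omega^k)\times V(\Omega^k)$ with $\boldsymbol\Psi|_{\Gamma_S}\circ\mathcal A^k=\psi\mathbf e_d$ and $\boldsymbol\Psi=0$ on $\Gamma_D$: (S1) $\int_{\Omega^k}D_t\varrho^k\varphi\,dx+\int_{\Omega^k}\mathrm{div}(\varrho^k\mathbf v^k)\varphi\,dx=0$; (S2) $\int_{\Omega^k}\big(D_t(\varrho^k\mathbf u^k)+\mathrm{div}(\varrho^k\mathbf u^k\otimes\mathbf v^k)\big)\cdot\boldsymbol\Psi\,dx+\int_{\Omega^k}\mathbf S(\nabla\mathbf u^k):\nabla\boldsymbol\Psi\,dx-\int_{\Omega^k}p(\varrho^k)\mathrm{div}\boldsymbol\Psi\,dx+\int_\Sigma\delta_tz^k\psi\,dr+\alpha\int_\Sigma\Delta\eta^k\Delta\psi\,dr+\beta\int_\Sigma\nabla\eta^k\cdot\nabla\psi\,dr=\int_{\Omega^k}\varrho^k\mathbf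 f^k\cdot\boldsymbol\Psi\,dx+\int_\Sigma g^k\psi\,dr$, with $\varrho^0=\varrho_0$, $\mathbf u^0=\mathbf u_0$, $\eta^0=0$, $z^0=0$, $\mathbf u^k=\mathbf w^k$ on $\partial\Omega^k$. Standing assumption: solutions are assumed to exist with $\eta^k>-H$ and enough regularity that all integrals are well defined, and all needed test functions and integrations by parts are admissible. (In (S2), $p$ is meant to be extended in some fixed way to negative arguments so that the scheme is meaningful for a density of a priori unknown sign.) *)

theory Defs
  imports "HOL-Analysis.Analysis"
begin

definition dir_deriv :: "'a::euclidean_space \<Rightarrow> ('a \<Rightarrow> real) \<Rightarrow> 'a \<Rightarrow> real"
  where "dir_deriv j f x = frechet_derivative f (at x) j"

primrec C_diff :: "nat \<Rightarrow> ('a::euclidean_space \<Rightarrow> real) \<Rightarrow> bool"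
  where
    "C_diff 0 f \<longleftrightarrow> continuous_on UNIV f"
  | "C_diff (Suc m) f \<longleftrightarrow>
       (\<forall>x. f differentiable (at x)) \<and> (\<forall>j\<in>Basis. C_diff m (dir_deriv j f))"

definition C_compact :: "nat \<Rightarrow> 'a::euclidean_space set \<Rightarrow> ('a \<Rightarrow> real) set"
  where "C_compact m U =
    {\<phi>. C_diff m \<phi> \<and> (\<exists>K. compact K \<and> K \<subseteq> U \<and> (\<forall>x. x \<notin> K \<longrightarrow> \<phi> x = 0))}"

definition loc_integrable ::
    "'a::euclidean_space set \<Rightarrow> ('a \<Rightarrow> 'b::euclidean_space) \<Rightarrow> bool"
  where "loc_integrable U f \<longleftrightarrow>
    (\<forall>K. compact K \<and> K \<subseteq> U \<longrightarrow> integrable (lebesgue_on K) f)"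

text \<open>As in Gilbarg--Trudinger, an m-th order weak derivative is tested with compactly supported
  functions of class C^m, and the space W^{m,s} with zero traces is the closure of these functions.
  By mollification, smooth test functions give the same notions.\<close>

definition has_weak_deriv ::
    "'a::euclidean_space set \<Rightarrow> 'a \<Rightarrow> ('a \<Rightarrow> real) \<Rightarrow> ('a \<Rightarrow> real) \<Rightarrow> bool"
  where "has_weak_deriv U j f h \<longleftrightarrow>
    loc_integrable U f \<and> loc_integrable U h \<and>
    (\<forall>\<phi>\<in>C_compact 1 U.
       (LINT x|lebesgue_on U. f x * dir_deriv j \<phi> x) = - (LINT x|lebesgue_on U. h x * \<phi> x))"

text \<open>Weak derivatives are unique up to null sets only; the operators below pick one
  representative, and they are only ever used under an integral or an almost-everywhere
  quantifier.\<close>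

definition weak_deriv :: "'a::euclidean_space set \<Rightarrow> 'a \<Rightarrow> ('a \<Rightarrow> real) \<Rightarrow> 'a \<Rightarrow> real"
  where "weak_deriv U j f = (SOME h. has_weak_deriv U j f h)"

definition weakly_differentiable :: "'a::euclidean_space set \<Rightarrow> ('a \<Rightarrow> real) \<Rightarrow> bool"
  where "weakly_differentiable U f \<longleftrightarrow> (\<forall>j\<in>Basis. \<exists>h. has_weak_deriv U j f h)"

definition weak_grad :: "'a::euclidean_space set \<Rightarrow> ('a \<Rightarrow> real) \<Rightarrow> 'a \<Rightarrow> 'a"
  where "weak_grad U f x = (\<Sum>j\<in>Basis. weak_deriv U j f x *\<^sub>R j)"

definition weak_laplacian :: "'a::euclidean_space set \<Rightarrow> ('a \<Rightarrow> real) \<Rightarrow> 'a \<Rightarrow> real"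
  where "weak_laplacian U f x = (\<Sum>j\<in>Basis. weak_deriv U j (weak_deriv U j f) x)"

text \<open>The integrand F x . grad phi x is written as the derivative of phi at x in
  direction F x.\<close>

definition has_weak_div ::
    "'a::euclidean_space set \<Rightarrow> ('a \<Rightarrow> 'a) \<Rightarrow> ('a \<Rightarrow> real) \<Rightarrow> bool"
  where "has_weak_div U F h \<longleftrightarrow>
    loc_integrable U F \<and> loc_integrable U h \<and>
    (\<forall>\<phi>\<in>C_compact 1 U.
       (LINT x|lebesgue_on U. dir_deriv (F x) \<phi> x) = - (LINT x|lebesgue_on U. h x * \<phi> x))"

definition weak_div :: "'a::euclidean_space set \<Rightarrow> ('a \<Rightarrow> 'a) \<Rightarrow> 'a \<Rightarrow> real"
  where "weak_div U F = (SOME h. has_weak_div U F h)"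

definition Lp_space ::
    "'a::euclidean_space set \<Rightarrow> real \<Rightarrow> ('a \<Rightarrow> 'b::euclidean_space) set"
  where "Lp_space U s =
    {f. f \<in> borel_measurable (lebesgue_on U) \<and>
        integrable (lebesgue_on U) (\<lambda>x. norm (f x) powr s)}"

primrec sobolev :: "nat \<Rightarrow> 'a::euclidean_space set \<Rightarrow> real \<Rightarrow> ('a \<Rightarrow> real) \<Rightarrow> bool"
  where
    "sobolev 0 U s f \<longleftrightarrow> f \<in> Lp_space U s"
  | "sobolev (Suc m) U s f \<longleftrightarrow>
       f \<in> Lp_space U s \<and> weakly_differentiable U f \<and>
       (\<forall>j\<in>Basis. sobolev m U s (weak_deriv U j f))"

primrec sobolev_conv ::
    "nat \<Rightarrow> 'a::euclidean_space set \<Rightarrow> real \<Rightarrow> (nat \<Rightarrow> 'a \<Rightarrow> real) \<Rightarrow> ('a \<Rightarrow> real) \<Rightarrow> bool"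
  where
    "sobolev_conv 0 U s \<phi> f \<longleftrightarrow>
       (\<lambda>n. LINT x|lebesgue_on U. \<bar>\<phi> n x - f x\<bar> powr s) \<longlonglongrightarrow> 0"
  | "sobolev_conv (Suc m) U s \<phi> f \<longleftrightarrow>
       (\<lambda>n. LINT x|lebesgue_on U. \<bar>\<phi> n x - f x\<bar> powr s) \<longlonglongrightarrow> 0 \<and>
       (\<forall>j\<in>Basis. sobolev_conv m U s (\<lambda>n. dir_deriv j (\<phi> n)) (weak_deriv U j f))"

definition sobolev0 :: "nat \<Rightarrow> 'a::euclidean_space set \<Rightarrow> real \<Rightarrow> ('a \<Rightarrow> real) \<Rightarrow> bool"
  where "sobolev0 m U s f \<longleftrightarrow>
    sobolev m U s f \<and>
    (\<exists>\<phi>. (\<forall>n. \<phi> n \<in> C_compact m U) \<and> sobolev_conv m U s \<phi> f)"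

definition sobolev_field :: "'a::euclidean_space set \<Rightarrow> ('a \<Rightarrow> 'a) \<Rightarrow> bool"
  where "sobolev_field U F \<longleftrightarrow>
    (\<forall>s. 1 \<le> s \<and> s < 2 \<longrightarrow> (\<forall>i\<in>Basis. sobolev 1 U s (\<lambda>x. F x \<bullet> i)))"

definition sobolev0_field :: "'a::euclidean_space set \<Rightarrow> ('a \<Rightarrow> 'a) \<Rightarrow> bool"
  where "sobolev0_field U F \<longleftrightarrow>
    (\<forall>s. 1 \<le> s \<and> s < 2 \<longrightarrow> (\<forall>i\<in>Basis. sobolev0 1 U s (\<lambda>x. F x \<bullet> i)))"

text \<open>Equality of traces: the difference lies in W^{1,s} with zero traces for all s < 2.\<close>

definition eq_on_boundary :: "'a::euclidean_space set \<Rightarrow> ('a \<Rightarrow> 'a) \<Rightarrow> ('a \<Rightarrow> 'a) \<Rightarrow> bool"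
  where "eq_on_boundary U F G \<longleftrightarrow> sobolev0_field U (\<lambda>x. F x - G x)"

definition linear_function_space :: "('a \<Rightarrow> 'b::real_vector) set \<Rightarrow> bool"
  where "linear_function_space Q \<longleftrightarrow>
    (\<lambda>x. 0) \<in> Q \<and> (\<forall>f\<in>Q. \<forall>h\<in>Q. (\<lambda>x. f x + h x) \<in> Q) \<and>
    (\<forall>c. \<forall>f\<in>Q. (\<lambda>x. c *\<^sub>R f x) \<in> Q)"

text \<open>A point of d-space is a pair (r, y) with r in the horizontal cross-section;
  thus d = CARD('n) + 1.\<close>

type_synonym 'n point = "(real ^ 'n) \<times> real"

definition ref_domain :: "real ^ 'n \<Rightarrow> real \<Rightarrow> 'n::finite point set"
  where "ref_domain L H = cbox 0 L \<times> {0..H}"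

definition ale_map :: "real \<Rightarrow> (real ^ 'n \<Rightarrow> real) \<Rightarrow> 'n::finite point \<Rightarrow> 'n point"
  where "ale_map H e = (\<lambda>(r, y). (r, y * ((H + e r) / H)))"

definition domain_of :: "real ^ 'n \<Rightarrow> real \<Rightarrow> (real ^ 'n \<Rightarrow> real) \<Rightarrow> 'n::finite point set"
  where "domain_of L H e = ale_map H e ` ref_domain L H"

definition top_boundary :: "real ^ 'n \<Rightarrow> real \<Rightarrow> (real ^ 'n \<Rightarrow> real) \<Rightarrow> 'n::finite point set"
  where "top_boundary L H e = {(r, H + e r) | r. r \<in> cbox 0 L}"

definition dirichlet_boundary ::
    "real ^ 'n \<Rightarrow> real \<Rightarrow> (real ^ 'n \<Rightarrow> real) \<Rightarrow> 'n::finite point set"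
  where "dirichlet_boundary L H e = frontier (domain_of L H e) - top_boundary L H e"

text \<open>In the next three definitions \<open>e\<close> is the current displacement and \<open>e'\<close> the previous one.\<close>

definition back_map ::
    "real ^ 'n \<Rightarrow> real \<Rightarrow> (real ^ 'n \<Rightarrow> real) \<Rightarrow> (real ^ 'n \<Rightarrow> real) \<Rightarrow> 'n::finite point \<Rightarrow> 'n point"
  where "back_map L H e e' = ale_map H e' \<circ> inv_into (ref_domain L H) (ale_map H e)"

definition back_factor ::
    "real \<Rightarrow> (real ^ 'n \<Rightarrow> real) \<Rightarrow> (real ^ 'n \<Rightarrow> real) \<Rightarrow> 'n::finite point \<Rightarrow> real"
  where "back_factor H e e' = (\<lambda>(r, y). (H + e' r) / (H + e r))"

definition ale_diff ::
    "real \<Rightarrow> real ^ 'n \<Rightarrow> real \<Rightarrow> (real ^ 'n \<Rightarrow> real) \<Rightarrow> (real ^ 'n \<Rightarrow> real) \<Rightarrow>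
     ('n::finite point \<Rightarrow> 'b::real_vector) \<Rightarrow> ('n point \<Rightarrow> 'b) \<Rightarrow> 'n point \<Rightarrow> 'b"
  where "ale_diff \<tau> L H e e' h h' x =
    (1 / \<tau>) *\<^sub>R (h x - back_factor H e e' x *\<^sub>R h' (back_map L H e e' x))"

definition wall_velocity ::
    "real \<Rightarrow> (real ^ 'n \<Rightarrow> real) \<Rightarrow> (real ^ 'n \<Rightarrow> real) \<Rightarrow> 'n::finite point \<Rightarrow> 'n point"
  where "wall_velocity H e z = (\<lambda>(r, y). (0, z r * (y / (H + e r))))"

definition structure_velocity ::
    "real \<Rightarrow> (nat \<Rightarrow> real ^ 'n \<Rightarrow> real) \<Rightarrow> nat \<Rightarrow> real ^ 'n::finite \<Rightarrow> real"
  where "structure_velocity \<tau> \<eta> k r = (if k = 0 then 0 else (\<eta> k r - \<eta> (k - 1) r) / \<tau>)"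

definition time_avg :: "real \<Rightarrow> nat \<Rightarrow> (real \<Rightarrow> 'a \<Rightarrow> 'b::euclidean_space) \<Rightarrow> 'a \<Rightarrow> 'b"
  where "time_avg \<tau> k F x =
    (1 / \<tau>) *\<^sub>R (LINT t|lebesgue_on {real k * \<tau>..<real (k + 1) * \<tau>}. F t x)"

definition sym_grad ::
    "'a::euclidean_space set \<Rightarrow> ('a \<Rightarrow> 'a) \<Rightarrow> 'a \<Rightarrow> 'a \<Rightarrow> 'a \<Rightarrow> real"
  where "sym_grad U u x i j =
    (weak_deriv U j (\<lambda>y. u y \<bullet> i) x + weak_deriv U i (\<lambda>y. u y \<bullet> j) x) / 2"

definition stress ::
    "real \<Rightarrow> real \<Rightarrow> 'a::euclidean_space set \<Rightarrow> ('a \<Rightarrow> 'a) \<Rightarrow> 'a \<Rightarrow> 'a \<Rightarrow> 'a \<Rightarrow> real"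
  where "stress \<mu> lam U u x i j =
    2 * \<mu> * sym_grad U u x i j + (if i = j then lam * weak_div U u x else 0)"

definition stress_power ::
    "real \<Rightarrow> real \<Rightarrow> 'a::euclidean_space set \<Rightarrow> ('a \<Rightarrow> 'a) \<Rightarrow> ('a \<Rightarrow> 'a) \<Rightarrow> 'a \<Rightarrow> real"
  where "stress_power \<mu> lam U u \<Psi> x =
    (\<Sum>i\<in>Basis. \<Sum>j\<in>Basis. stress \<mu> lam U u x i j * weak_deriv U j (\<lambda>y. \<Psi> y \<bullet> i) x)"

text \<open>div (rho u (x) v), row by row.\<close>

definition convection ::
    "'a::euclidean_space set \<Rightarrow> ('a \<Rightarrow> real) \<Rightarrow> ('a \<Rightarrow> 'a) \<Rightarrow> ('a \<Rightarrow> 'a) \<Rightarrow> 'a \<Rightarrow> 'a"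
  where "convection U \<rho> u v x =
    (\<Sum>i\<in>Basis. weak_div U (\<lambda>y. (\<rho> y * (u y \<bullet> i)) *\<^sub>R v y) x *\<^sub>R i)"

text \<open>In both equations \<open>has_bochner_integral\<close> also records that the integrals are well defined.
  Primed arguments belong to the previous time level.\<close>

definition continuity_eq ::
    "real \<Rightarrow> real ^ 'n \<Rightarrow> real \<Rightarrow> ('n::finite point \<Rightarrow> real) set \<Rightarrow>
     (real ^ 'n \<Rightarrow> real) \<Rightarrow> (real ^ 'n \<Rightarrow> real) \<Rightarrow>
     ('n point \<Rightarrow> real) \<Rightarrow> ('n point \<Rightarrow> real) \<Rightarrow> ('n point \<Rightarrow> 'n point) \<Rightarrow> bool"
  where "continuity_eq \<tau> L H Q e e' \<rho> \<rho>' v \<longleftrightarrow>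
    (let \<Omega> = domain_of L H e; U = interior \<Omega> in
     \<forall>\<phi>\<in>Q. \<exists>I1 I2.
       has_bochner_integral (lebesgue_on \<Omega>) (\<lambda>x. ale_diff \<tau> L H e e' \<rho> \<rho>' x * \<phi> x) I1 \<and>
       has_bochner_integral (lebesgue_on \<Omega>) (\<lambda>x. weak_div U (\<lambda>y. \<rho> y *\<^sub>R v y) x * \<phi> x) I2 \<and>
       I1 + I2 = 0)"

text \<open>The boundary conditions on a test field are imposed by comparison, in the trace sense, with a
  continuous field that takes the prescribed boundary values pointwise; (0, c) is c times the
  last unit vector.\<close>

definition coupled_test ::
    "real ^ 'n \<Rightarrow> real \<Rightarrow> (real ^ 'n \<Rightarrow> real) \<Rightarrow> (real ^ 'n \<Rightarrow> real) \<Rightarrow>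
     ('n::finite point \<Rightarrow> 'n point) \<Rightarrow> bool"
  where "coupled_test L H e \<psi> \<Psi> \<longleftrightarrow>
    (\<exists>G. continuous_on (domain_of L H e) G \<and>
         (\<forall>r\<in>cbox 0 L. G (ale_map H e (r, H)) = (0, \<psi> r)) \<and>
         (\<forall>x\<in>dirichlet_boundary L H e. G x = 0) \<and>
         eq_on_boundary (interior (domain_of L H e)) \<Psi> G)"

definition momentum_eq ::
    "real \<Rightarrow> real ^ 'n \<Rightarrow> real \<Rightarrow> real \<Rightarrow> real \<Rightarrow> real \<Rightarrow> real \<Rightarrow> (real \<Rightarrow> real) \<Rightarrow>
     (real ^ 'n \<Rightarrow> real) set \<Rightarrow> ('n::finite point \<Rightarrow> 'n point) set \<Rightarrow>
     (real ^ 'n \<Rightarrow> real) \<Rightarrow> (real ^ 'n \<Rightarrow> real) \<Rightarrow>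
     (real ^ 'n \<Rightarrow> real) \<Rightarrow> (real ^ 'n \<Rightarrow> real) \<Rightarrow>
     ('n point \<Rightarrow> real) \<Rightarrow> ('n point \<Rightarrow> real) \<Rightarrow>
     ('n point \<Rightarrow> 'n point) \<Rightarrow> ('n point \<Rightarrow> 'n point) \<Rightarrow> ('n point \<Rightarrow> 'n point) \<Rightarrow>
     ('n point \<Rightarrow> 'n point) \<Rightarrow> (real ^ 'n \<Rightarrow> real) \<Rightarrow> bool"
  where "momentum_eq \<tau> L H \<mu> lam \<alpha> \<beta> p W V e e' z z' \<rho> \<rho>' u u' v fk gk \<longleftrightarrow>
    (let \<Omega> = domain_of L H e; U = interior \<Omega>; \<Sigma> = cbox 0 L; S = interior \<Sigma> in
     \<forall>\<psi>\<in>W. \<forall>\<Psi>\<in>V. coupled_test L H e \<psi> \<Psi> \<longrightarrow>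
      (\<exists>I1 I2 I3 I4 I5 I6 I7 I8.
        has_bochner_integral (lebesgue_on \<Omega>)
          (\<lambda>x. (ale_diff \<tau> L H e e' (\<lambda>y. \<rho> y *\<^sub>R u y) (\<lambda>y. \<rho>' y *\<^sub>R u' y) x
                 + convection U \<rho> u v x) \<bullet> \<Psi> x) I1 \<and>
        has_bochner_integral (lebesgue_on \<Omega>) (stress_power \<mu> lam U u \<Psi>) I2 \<and>
        has_bochner_integral (lebesgue_on \<Omega>) (\<lambda>x. p (\<rho> x) * weak_div U \<Psi> x) I3 \<and>
        has_bochner_integral (lebesgue_on \<Sigma>) (\<lambda>r. (z r - z' r) / \<tau> * \<psi> r) I4 \<and>
        has_bochner_integral (lebesgue_on \<Sigma>)
          (\<lambda>r. weak_laplacian S e r * weak_laplacian S \<psi> r) I5 \<and>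
        has_bochner_integral (lebesgue_on \<Sigma>) (\<lambda>r. weak_grad S e r \<bullet> weak_grad S \<psi> r) I6 \<and>
        has_bochner_integral (lebesgue_on \<Omega>) (\<lambda>x. (\<rho> x *\<^sub>R fk x) \<bullet> \<Psi> x) I7 \<and>
        has_bochner_integral (lebesgue_on \<Sigma>) (\<lambda>r. gk r * \<psi> r) I8 \<and>
        I1 + I2 - I3 + I4 + \<alpha> * I5 + \<beta> * I6 = I7 + I8))"

definition regular_state ::
    "'a::euclidean_space set \<Rightarrow> ('a \<Rightarrow> real) \<Rightarrow> ('a \<Rightarrow> 'a) \<Rightarrow> ('a \<Rightarrow> 'a) \<Rightarrow> bool"
  where "regular_state U \<rho> u v \<longleftrightarrow>
    weakly_differentiable U \<rho> \<and>
    (\<exists>h. has_weak_div U (\<lambda>x. \<rho> x *\<^sub>R v x) h) \<and>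
    (\<forall>i\<in>Basis. \<exists>h. has_weak_div U (\<lambda>x. (\<rho> x * (u x \<bullet> i)) *\<^sub>R v x) h) \<and>
    integrable (lebesgue_on U) (\<lambda>x. weak_grad U \<rho> x \<bullet> v x) \<and>
    integrable (lebesgue_on U) (\<lambda>x. \<rho> x * weak_div U v x)"

text \<open>Green's formula for \<open>f\<close> against every field with zero boundary values (so that there is no
  boundary term) for which both integrals make sense.\<close>

definition integration_by_parts :: "'a::euclidean_space set \<Rightarrow> ('a \<Rightarrow> real) \<Rightarrow> bool"
  where "integration_by_parts U f \<longleftrightarrow>
    (\<forall>F. sobolev0_field U F \<and>
         integrable (lebesgue_on U) (\<lambda>x. f x * weak_div U F x) \<and>
         integrable (lebesgue_on U) (\<lambda>x. weak_grad U f x \<bullet> F x) \<longrightarrow>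
       (LINT x|lebesgue_on U. f x * weak_div U F x)
         = - (LINT x|lebesgue_on U. weak_grad U f x \<bullet> F x))"

text \<open>Admissibility is required only for functions of the density: \<open>b (\<rho> x)\<close> as a test function in the
  continuity equation, and \<open>B (\<rho> x)\<close>, where \<open>B\<close> is an antiderivative of the bounded Lipschitz function \<open>b\<close>,
  in Green's formula. Both hold, for instance, if \<open>\<rho>\<close> is in W^{1,q} for some q > 2 and the test
  functions are all of L^\<open>\<gamma>\<close>.\<close>

definition renormalization :: "(real \<Rightarrow> real) \<Rightarrow> (real \<Rightarrow> real) \<Rightarrow> bool"
  where "renormalization B b \<longleftrightarrow>
    (\<forall>s. (B has_real_derivative b s) (at s)) \<and> bounded (range b) \<and>
    (\<exists>C. C-lipschitz_on UNIV b)"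

definition admissible_density ::
    "'a::euclidean_space set \<Rightarrow> ('a \<Rightarrow> real) set \<Rightarrow> ('a \<Rightarrow> real) \<Rightarrow> bool"
  where "admissible_density U Q \<rho> \<longleftrightarrow>
    (\<forall>B b. renormalization B b \<longrightarrow>
       (\<lambda>x. b (\<rho> x)) \<in> Q \<and> integration_by_parts U (\<lambda>x. B (\<rho> x)))"

end

theory Submission
  imports Defs
begin

text \<open>The continuity equation at time level \<open>k\<close> is tested with \<open>b (\<rho>)\<close>, where \<open>b\<close> is a Lipschitz ramp that vanishes
on the non-negative reals and equals \<open>1\<close> below \<open>- \<epsilon>\<close>; this sees only the negative part of the density. Let
\<open>B\<close> be the antiderivative of \<open>b\<close> with \<open>B 0 = 0\<close>. The relative velocity \<open>v = u - w\<close> has zero boundary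
values, so no boundary term appears in the renormalized identity

\<open>\<integral> div (\<rho> v) b (\<rho>) = \<integral> (\<rho> b (\<rho>) - B (\<rho>)) div v\<close>,

and \<open>\<bar>s b s - B s\<bar> \<le> \<epsilon> / 2\<close> for every \<open>s\<close>, so that this term is at most \<open>\<epsilon> / 2\<close> times the \<open>L\<^sup>1\<close> norm of
\<open>div v\<close>. In the discrete time derivative, the transported old density is non-negative and can be dropped:
\<open>\<tau> D\<^sub>t \<rho> b (\<rho>) \<le> \<rho> b (\<rho>) \<le> 0\<close>. As \<open>\<epsilon>\<close> tends to zero the ramps increase, and the integral of
\<open>\<rho> b (\<rho>)\<close> for the ramp of width \<open>1\<close> is squeezed to zero; hence \<open>\<rho> \<ge> 0\<close> almost everywhere. This is
\<open>density_nonneg_step\<close>, and induction over the time levels gives the theorem.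

The renormalized identity (\<open>renormalized_flux_integral\<close>) has to be justified for weak derivatives. It rests
on three facts.

\<^item> Weak derivatives are unique almost everywhere (\<open>fundamental_lemma_of_variations\<close>). Since every
  measurable function is an almost everywhere limit of continuous ones, the Weierstrass theorem and a
  cutoff make every measurable function with values in \<open>[-1, 1]\<close> a bounded almost everywhere limit of
  test functions (\<open>C_compact_approximation\<close>). Testing a function with approximations of its own sign
  then gives its \<open>L\<^sup>1\<close> norm.

\<^item> The chain rule \<open>\<nabla> B (\<rho>) = b (\<rho>) \<nabla> \<rho>\<close> (\<open>has_weak_deriv_chain\<close>). After localization to an integrable
  function on the whole space, the difference quotients in a fixed direction converge in \<open>L\<^sup>1\<close> to the
  weak derivative, by duality and continuity of translations. The chain rule can then be read off from
  difference quotients of \<open>B (\<rho>)\<close>, without mollification.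

\<^item> The product rule \<open>div (\<rho> v) = \<nabla> \<rho> \<bullet> v + \<rho> div v\<close> (\<open>weak_div_density_flux\<close>). Only the sum
  \<open>\<nabla> \<rho> \<bullet> v\<close> is known to be integrable, not its individual terms, so the rule is obtained from Green's
  formula for \<open>\<rho>\<close> against the fields \<open>\<phi> v\<close>, where \<open>\<phi>\<close> is a test function.

On the geometric side, the map from the new domain to the old one stretches each vertical fibre by a
positive factor. By Fubini it therefore respects null sets, although the displacement is merely continuous
(\<open>AE_compose_back_map\<close>). The boundary of the domain is null for the same reason.\<close>

text \<open>The order \<open>1\<close> is kept as written: otherwise the simplifier would turn it into \<open>Suc 0\<close> and unfold \<open>C_diff 1\<close>
into statements about single directions.\<close>

declare One_nat_def [simp del] C_diff.simps [simp del]

section \<open>Functions of class C^1 and test functions\<close>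

lemma C_diff_1_iff:
  "C_diff 1 f \<longleftrightarrow> (\<forall>x. f differentiable (at x)) \<and> (\<forall>j\<in>Basis. continuous_on UNIV (dir_deriv j f))"
  unfolding One_nat_def by (simp add: C_diff.simps)

lemma dir_deriv_eq:
  assumes "(f has_derivative D) (at x)"
  shows "dir_deriv j f x = D j"
  using frechet_derivative_at[OF assms] by (simp add: dir_deriv_def)

lemma C_diff_1I:
  assumes "\<And>x. (f has_derivative D x) (at x)" "\<And>j. j \<in> Basis \<Longrightarrow> continuous_on UNIV (\<lambda>x. D x j)"
  shows "C_diff 1 f"
proof -
  have "dir_deriv j f = (\<lambda>x. D x j)" for j
    using dir_deriv_eq[OF assms(1)] by blast
  then show ?thesis
    using assms by (auto simp: C_diff_1_iff differentiable_def)
qed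

lemma C_diff_1_has_derivative:
  assumes "C_diff 1 f"
  shows "(f has_derivative (\<lambda>j. dir_deriv j f x)) (at x)"
  using assms unfolding C_diff_1_iff dir_deriv_def
  by (simp add: frechet_derivative_works[symmetric])

lemma C_diff_1_continuous: "C_diff 1 f \<Longrightarrow> continuous_on UNIV f"
  by (meson C_diff_1_iff continuous_at_imp_continuous_on differentiable_imp_continuous_within)

text \<open>Linearity of the derivative in the direction. It extends the defining conditions of \<open>C_diff 1\<close>, which
concern basis directions only, to all directions.\<close>

lemma dir_deriv_basis_expansion:
  assumes "C_diff 1 f"
  shows "dir_deriv v f x = (\<Sum>j\<in>Basis. (v \<bullet> j) * dir_deriv j f x)"
proof -
  interpret bounded_linear "\<lambda>j. dir_deriv j f x"
    using C_diff_1_has_derivative[OF assms] by (rule has_derivative_bounded_linear)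
  have "dir_deriv v f x = dir_deriv (\<Sum>j\<in>Basis. (v \<bullet> j) *\<^sub>R j) f x"
    by (simp add: euclidean_representation)
  also have "\<dots> = (\<Sum>j\<in>Basis. (v \<bullet> j) * dir_deriv j f x)"
    by (simp add: sum scale)
  finally show ?thesis .
qed

lemma C_diff_1_continuous_dir_deriv:
  assumes "C_diff 1 f"
  shows "continuous_on UNIV (dir_deriv v f)"
proof -
  have "dir_deriv v f = (\<lambda>x. \<Sum>j\<in>Basis. (v \<bullet> j) * dir_deriv j f x)"
    using dir_deriv_basis_expansion[OF assms] by blast
  moreover have "continuous_on UNIV (\<lambda>x. \<Sum>j\<in>Basis. (v \<bullet> j) * dir_deriv j f x)"
    using assms by (intro continuous_intros) (auto simp: C_diff_1_iff)
  ultimately show ?thesis by simp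
qed

lemma C_diff_1_mult:
  assumes "C_diff 1 f" "C_diff 1 g"
  shows "C_diff 1 (\<lambda>x. f x * g x)"
    and "dir_deriv j (\<lambda>x. f x * g x) x = f x * dir_deriv j g x + dir_deriv j f x * g x"
proof -
  have D: "((\<lambda>x. f x * g x) has_derivative (\<lambda>j. f x * dir_deriv j g x + dir_deriv j f x * g x)) (at x)" for x
    by (intro has_derivative_mult C_diff_1_has_derivative assms)
  show "dir_deriv j (\<lambda>x. f x * g x) x = f x * dir_deriv j g x + dir_deriv j f x * g x"
    using dir_deriv_eq[OF D] .
  show "C_diff 1 (\<lambda>x. f x * g x)"
    by (rule C_diff_1I[OF D]) (intro continuous_intros C_diff_1_continuous C_diff_1_continuous_dir_deriv assms)
qed

lemma C_diff_1_add:
  assumes "C_diff 1 f" "C_diff 1 g"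
  shows "C_diff 1 (\<lambda>x. f x + g x)"
  by (rule C_diff_1I[OF has_derivative_add[OF C_diff_1_has_derivative[OF assms(1)] C_diff_1_has_derivative[OF assms(2)]]])
     (intro continuous_intros C_diff_1_continuous_dir_deriv assms)

lemma C_diff_1_const: "C_diff 1 (\<lambda>x. c)"
  by (rule C_diff_1I[OF has_derivative_const]) simp

lemma C_diff_1_bounded_linear:
  assumes "bounded_linear f"
  shows "C_diff 1 f"
  by (rule C_diff_1I[OF bounded_linear_imp_has_derivative[OF assms]]) simp

lemma C_diff_1_sum:
  assumes "\<And>i. i \<in> I \<Longrightarrow> C_diff 1 (f i)"
  shows "C_diff 1 (\<lambda>x. \<Sum>i\<in>I. f i x)"
  using assms by (induction I rule: infinite_finite_induct) (auto intro: C_diff_1_add C_diff_1_const)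

lemma C_diff_1_compose:
  assumes "C_diff 1 f" "\<And>t. (g has_real_derivative g' t) (at t)" "continuous_on UNIV g'"
  shows "C_diff 1 (\<lambda>x. g (f x))"
proof (rule C_diff_1I)
  fix x
  show "((\<lambda>x. g (f x)) has_derivative (\<lambda>j. g' (f x) * dir_deriv j f x)) (at x)"
    using has_derivative_compose[OF C_diff_1_has_derivative[OF assms(1)]
        assms(2)[unfolded has_field_derivative_def]] .
  show "continuous_on UNIV (\<lambda>x. g' (f x) * dir_deriv j f x)" for j
    by (intro continuous_intros C_diff_1_continuous_dir_deriv assms(1)
        continuous_on_compose2[OF assms(3) C_diff_1_continuous[OF assms(1)]]) auto
qed

lemma C_diff_1_real_polynomial_function:
  assumes "real_polynomial_function f"
  shows "C_diff 1 f"
  using assms by induction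
    (auto intro: C_diff_1_const C_diff_1_add C_diff_1_mult C_diff_1_bounded_linear)

lemma C_diff_1_translate:
  assumes "C_diff 1 f"
  shows "C_diff 1 (\<lambda>x. f (x + a))" "dir_deriv j (\<lambda>x. f (x + a)) x = dir_deriv j f (x + a)"
proof -
  have D: "((\<lambda>x. f (x + a)) has_derivative (\<lambda>j. dir_deriv j f (x + a))) (at x)" for x
    by (rule has_derivative_compose[OF _ C_diff_1_has_derivative[OF assms], of "\<lambda>x. x + a" "\<lambda>x. x"])
       (auto intro!: derivative_eq_intros)
  show "dir_deriv j (\<lambda>x. f (x + a)) x = dir_deriv j f (x + a)"
    using dir_deriv_eq[OF D] .
  show "C_diff 1 (\<lambda>x. f (x + a))"
    by (rule C_diff_1I[OF D])
       (auto intro!: continuous_on_compose2[OF C_diff_1_continuous_dir_deriv[OF assms]] continuous_intros)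
qed

text \<open>The derivative vanishes off the support as well, because the complement of a compact set is open.\<close>

lemma C_compactE:
  assumes "\<phi> \<in> C_compact 1 U"
  obtains K where "C_diff 1 \<phi>" "compact K" "K \<subseteq> U" "\<And>x. x \<notin> K \<Longrightarrow> \<phi> x = 0"
    "\<And>x j. x \<notin> K \<Longrightarrow> dir_deriv j \<phi> x = 0"
proof -
  obtain K where K: "C_diff 1 \<phi>" "compact K" "K \<subseteq> U" "\<And>x. x \<notin> K \<Longrightarrow> \<phi> x = 0"
    using assms by (auto simp: C_compact_def)
  have "dir_deriv j \<phi> x = 0" if "x \<notin> K" for x j
  proof -
    have "(\<phi> has_derivative (\<lambda>_. 0)) (at x)"
      by (rule has_derivative_transform_within_open[of "\<lambda>_. 0" _ _ _ "- K"])
         (use K that compact_imp_closed in auto)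
    then show ?thesis using dir_deriv_eq by metis
  qed
  with K that show thesis by blast
qed

lemma C_compactI:
  "C_diff 1 \<phi> \<Longrightarrow> compact K \<Longrightarrow> K \<subseteq> U \<Longrightarrow> (\<And>x. x \<notin> K \<Longrightarrow> \<phi> x = 0) \<Longrightarrow> \<phi> \<in> C_compact 1 U"
  by (auto simp: C_compact_def)

lemma C_compact_C_diff: "\<phi> \<in> C_compact 1 U \<Longrightarrow> C_diff 1 \<phi>"
  by (auto simp: C_compact_def)

lemma C_compact_mult_left:
  assumes "\<phi> \<in> C_compact 1 U" "C_diff 1 f"
  shows "(\<lambda>x. f x * \<phi> x) \<in> C_compact 1 U"
  using assms by (auto simp: C_compact_def intro: C_diff_1_mult)

lemma C_compact_mult_right:
  assumes "\<phi> \<in> C_compact 1 U" "C_diff 1 f"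
  shows "(\<lambda>x. \<phi> x * f x) \<in> C_compact 1 U"
  using assms by (auto simp: C_compact_def intro: C_diff_1_mult)

lemma C_compact_mono: "U \<subseteq> V \<Longrightarrow> C_compact m U \<subseteq> C_compact m V"
  by (auto simp: C_compact_def)

lemma bounded_range_if_compact_support:
  fixes f :: "'a::euclidean_space \<Rightarrow> real"
  assumes "continuous_on UNIV f" "compact K" "\<And>x. x \<notin> K \<Longrightarrow> f x = 0"
  obtains C where "C > 0" "\<And>x. \<bar>f x\<bar> \<le> C"
proof -
  have "bounded (f ` K)"
    using assms by (meson compact_continuous_image compact_imp_bounded continuous_on_subset subset_UNIV)
  then obtain C where C: "C > 0" "\<And>x. x \<in> K \<Longrightarrow> \<bar>f x\<bar> \<le> C"
    by (auto simp: bounded_pos)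
  have "\<bar>f x\<bar> \<le> C" for x
    using C assms(3)[of x] by (cases "x \<in> K") auto
  with C that show thesis by blast
qed

lemma C_compact_bounded:
  assumes "\<phi> \<in> C_compact 1 U"
  obtains C where "C > 0" "\<And>x. \<bar>\<phi> x\<bar> \<le> C"
proof -
  obtain K where "C_diff 1 \<phi>" "compact K" "\<And>x. x \<notin> K \<Longrightarrow> \<phi> x = 0"
    using C_compactE[OF assms] by metis
  then show thesis
    using bounded_range_if_compact_support[of \<phi> K] C_diff_1_continuous that by blast
qed

lemma C_compact_bounded_dir_deriv:
  assumes "\<phi> \<in> C_compact 1 U"
  obtains C where "C > 0" "\<And>x. \<bar>dir_deriv j \<phi> x\<bar> \<le> C"
proof -
  obtain K where "C_diff 1 \<phi>" "compact K" "\<And>x j. x \<notin> K \<Longrightarrow> dir_deriv j \<phi> x = 0"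
    using C_compactE[OF assms] by metis
  then show thesis
    using bounded_range_if_compact_support[of "dir_deriv j \<phi>" K] C_diff_1_continuous_dir_deriv that by blast
qed

lemma C_compact_measurable [measurable_dest]:
  assumes "\<phi> \<in> C_compact 1 U"
  shows "\<phi> \<in> borel_measurable borel"
  using assms C_compact_C_diff C_diff_1_continuous borel_measurable_continuous_onI by blast

lemma C_compact_measurable_dir_deriv [measurable_dest]:
  assumes "\<phi> \<in> C_compact 1 U"
  shows "dir_deriv j \<phi> \<in> borel_measurable borel"
  using assms C_compact_C_diff C_diff_1_continuous_dir_deriv borel_measurable_continuous_onI by blast

text \<open>Squares of positive parts are the building block for everything that has to be of class C^1 and
flat on one side: bumps, cutoffs and the primitives of the ramps below.\<close>

lemma DERIV_positive_part_squared:
  "((\<lambda>t. (max 0 t)\<^sup>2) has_real_derivative 2 * max 0 t) (at (t::real))"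
proof -
  consider "t < 0" | "t > 0" | "t = 0" by linarith
  then show ?thesis
  proof cases
    case 1
    have "((\<lambda>t. 0) has_real_derivative 2 * max 0 t) (at t)"
      using 1 by auto
    then show ?thesis
      by (rule has_field_derivative_transform_within_open[where S="{..<0}"]) (use 1 in auto)
  next
    case 2
    have "((\<lambda>t. t\<^sup>2) has_real_derivative 2 * max 0 t) (at t)"
      using 2 by (auto intro!: derivative_eq_intros)
    then show ?thesis
      by (rule has_field_derivative_transform_within_open[where S="{0<..}"]) (use 2 in auto)
  next
    case 3
    have "((\<lambda>h. (max 0 h)\<^sup>2 / h) \<longlongrightarrow> 0) (at (0::real))"
    proof (rule Lim_null_comparison[where g="\<lambda>h. \<bar>h\<bar>"])
      show "\<forall>\<^sub>F h in at (0::real). norm ((max 0 h)\<^sup>2 / h) \<le> \<bar>h\<bar>"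
        by (rule always_eventually) (auto simp: max_def power2_eq_square)
      show "((\<lambda>h::real. \<bar>h\<bar>) \<longlongrightarrow> 0) (at 0)"
        by (auto intro!: tendsto_eq_intros)
    qed
    then show ?thesis
      using 3 by (simp add: has_field_derivative_iff)
  qed
qed

lemma C_compact_bump:
  fixes a :: "'a::euclidean_space"
  assumes "r > 0" "cball a r \<subseteq> U"
  obtains \<theta> where "\<theta> \<in> C_compact 1 U" "\<And>x. 0 \<le> \<theta> x" "\<And>x. x \<in> ball a r \<Longrightarrow> 0 < \<theta> x"
proof -
  define \<theta> where "\<theta> = (\<lambda>x. (max 0 (r\<^sup>2 - (x - a) \<bullet> (x - a)))\<^sup>2)"
  have "C_diff 1 (\<lambda>x. r\<^sup>2 - (x - a) \<bullet> (x - a))"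
  proof (rule C_diff_1I)
    show "((\<lambda>x. r\<^sup>2 - (x - a) \<bullet> (x - a)) has_derivative (\<lambda>j. - 2 * (j \<bullet> (x - a)))) (at x)" for x
      by (auto intro!: derivative_eq_intros simp: inner_commute)
  qed (intro continuous_intros)
  then have "C_diff 1 \<theta>"
    unfolding \<theta>_def
    by (rule C_diff_1_compose[OF _ DERIV_positive_part_squared]) (intro continuous_intros)
  moreover have "\<theta> x = 0" if "x \<notin> cball a r" for x
  proof -
    have "r\<^sup>2 \<le> (norm (x - a))\<^sup>2"
      using that assms(1) by (intro power_mono) (auto simp: dist_norm norm_minus_commute)
    then show ?thesis by (simp add: \<theta>_def power2_norm_eq_inner[symmetric])
  qed
  moreover have "0 < \<theta> x" if "x \<in> ball a r" for x
  proof -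
    have "(norm (x - a))\<^sup>2 < r\<^sup>2"
      using that assms(1) by (intro power_strict_mono) (auto simp: dist_norm norm_minus_commute)
    then show ?thesis by (simp add: \<theta>_def power2_norm_eq_inner[symmetric])
  qed
  moreover have "0 \<le> \<theta> x" for x
    by (simp add: \<theta>_def)
  ultimately show thesis
    using that[of \<theta>] C_compactI[of \<theta> "cball a r" U] assms(2) compact_cball by blast
qed

text \<open>Finitely many bumps cover \<open>K\<close>, so their sum \<open>S\<close> is at least some \<open>m > 0\<close> on \<open>K\<close>; composing with a
C^1 step that is \<open>0\<close> at \<open>0\<close> and \<open>1\<close> from \<open>m\<close> on gives the cutoff.\<close>

lemma C_compact_cutoff:
  fixes K :: "'a::euclidean_space set"
  assumes "compact K" "K \<subseteq> U" "open U"
  obtains \<theta> where "\<theta> \<in> C_compact 1 U" "\<And>x. 0 \<le> \<theta> x" "\<And>x. \<theta> x \<le> 1" "\<And>x. x \<in> K \<Longrightarrow> \<theta> x = 1"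
proof -
  have "\<exists>r \<theta>. r > 0 \<and> \<theta> \<in> C_compact 1 U \<and> (\<forall>x. 0 \<le> \<theta> x) \<and> (\<forall>x\<in>ball a r. 0 < \<theta> x)"
    if "a \<in> K" for a
  proof -
    have "a \<in> U" using that assms(2) by (rule subsetD[rotated])
    then obtain r where r: "r > 0" "cball a r \<subseteq> U"
      using bspec[OF assms(3)[unfolded open_contains_cball]] by blast
    obtain \<theta> where "\<theta> \<in> C_compact 1 U" "\<And>x. 0 \<le> \<theta> x" "\<And>x. x \<in> ball a r \<Longrightarrow> 0 < \<theta> x"
      by (rule C_compact_bump[OF r]) (rule that)
    with r(1) show ?thesis by blast
  qed
  then have "\<forall>a\<in>K. \<exists>r \<theta>. r > 0 \<and> \<theta> \<in> C_compact 1 U \<and> (\<forall>x. 0 \<le> \<theta> x) \<and> (\<forall>x\<in>ball a r. 0 < \<theta> x)"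
    by blast
  from this[unfolded bchoice_iff] obtain r \<theta> where r\<theta>: "\<And>a. a \<in> K \<Longrightarrow> r a > 0 \<and> \<theta> a \<in> C_compact 1 U \<and>
      (\<forall>x. 0 \<le> \<theta> a x) \<and> (\<forall>x\<in>ball a (r a). 0 < \<theta> a x)"
    by blast
  obtain F where F: "F \<subseteq> K" "finite F" "K \<subseteq> (\<Union>a\<in>F. ball a (r a))"
  proof (rule compactE_image[OF assms(1), of K "\<lambda>a. ball a (r a)"])
    show "K \<subseteq> (\<Union>a\<in>K. ball a (r a))" using r\<theta> centre_in_ball by blast
  qed auto
  define S where "S = (\<lambda>x. \<Sum>a\<in>F. \<theta> a x)"
  have S_diff: "C_diff 1 S"
    unfolding S_def using r\<theta> F by (intro C_diff_1_sum) (auto dest: C_compact_C_diff)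
  have "\<exists>K'. compact K' \<and> K' \<subseteq> U \<and> (\<forall>x. x \<notin> K' \<longrightarrow> \<theta> a x = 0)" if "a \<in> F" for a
    using r\<theta>[of a] F that by (auto simp: C_compact_def)
  then obtain K' where K': "\<And>a. a \<in> F \<Longrightarrow> compact (K' a) \<and> K' a \<subseteq> U \<and> (\<forall>x. x \<notin> K' a \<longrightarrow> \<theta> a x = 0)"
    by metis
  have S_supp: "S x = 0" if "x \<notin> \<Union>(K' ` F)" for x
    unfolding S_def using K' that by (intro sum.neutral) auto
  have S_nonneg: "S x \<ge> 0" for x
    unfolding S_def using r\<theta> F by (intro sum_nonneg) auto
  have S_pos: "S x > 0" if x: "x \<in> K" for x
  proof -
    obtain a where "a \<in> F" "x \<in> ball a (r a)" using F x by blast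
    then show ?thesis
      unfolding S_def using r\<theta> F by (intro sum_pos2[of _ a]) auto
  qed
  obtain m where m: "m > 0" "\<And>x. x \<in> K \<Longrightarrow> m \<le> S x"
  proof (cases "K = {}")
    case False
    then obtain x0 where "x0 \<in> K" "\<And>x. x \<in> K \<Longrightarrow> S x0 \<le> S x"
      using continuous_attains_inf[OF assms(1) False, of S]
        continuous_on_subset[OF C_diff_1_continuous[OF S_diff]] by blast
    then show ?thesis using that S_pos by blast
  qed (use that[of 1] in auto)
  define c where "c = (\<lambda>x. 1 - (max 0 (1 - S x / m))\<^sup>2)"
  have "C_diff 1 (\<lambda>x. 1 + (- 1 / m) * S x)"
    by (intro C_diff_1_add C_diff_1_mult C_diff_1_const S_diff)
  then have "C_diff 1 (\<lambda>x. 1 - S x / m)"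
    by simp
  then have "C_diff 1 (\<lambda>x. (max 0 (1 - S x / m))\<^sup>2)"
    by (rule C_diff_1_compose[OF _ DERIV_positive_part_squared]) (intro continuous_intros)
  then have "C_diff 1 (\<lambda>x. 1 + (- 1) * (max 0 (1 - S x / m))\<^sup>2)"
    by (intro C_diff_1_add C_diff_1_mult C_diff_1_const)
  then have "C_diff 1 c"
    by (simp add: c_def)
  moreover have "compact (\<Union>(K' ` F))" "\<Union>(K' ` F) \<subseteq> U"
    using K' F by (auto intro!: compact_UN)
  moreover have "c x = 0" if "x \<notin> \<Union>(K' ` F)" for x
    using S_supp[OF that] by (simp add: c_def)
  ultimately have "c \<in> C_compact 1 U" by (intro C_compactI)
  moreover have "0 \<le> c x" "c x \<le> 1" for x
    using S_nonneg[of x] m by (auto simp: c_def intro!: power_le_one)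
  moreover have "c x = 1" if "x \<in> K" for x
    using m(2)[OF that] m(1) by (simp add: c_def)
  ultimately show thesis using that by blast
qed

section \<open>Approximation by test functions\<close>

lemma lebesgue_translation_measurable: "(\<lambda>x. x + a) \<in> lebesgue \<rightarrow>\<^sub>M lebesgue"
  and lebesgue_distr_translation: "distr lebesgue lebesgue (\<lambda>x::'a::euclidean_space. x + a) = lebesgue"
proof -
  have *: "(\<lambda>x. a + (\<Sum>j\<in>Basis. (1 * (x \<bullet> j)) *\<^sub>R j)) = (\<lambda>x::'a. x + a)"
    by (simp add: euclidean_representation add.commute)
  show "(\<lambda>x. x + a) \<in> lebesgue \<rightarrow>\<^sub>M lebesgue"
    using lebesgue_affine_measurable[of "\<lambda>_. 1" a] unfolding * by simp
  show "distr lebesgue lebesgue (\<lambda>x::'a::euclidean_space. x + a) = lebesgue"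
    using lebesgue_affine_euclidean[of "\<lambda>_. 1" a] unfolding * by (simp add: density_1)
qed

lemma borel_measurable_lebesgue_translation:
  fixes f :: "'a::euclidean_space \<Rightarrow> real"
  assumes "f \<in> borel_measurable lebesgue"
  shows "(\<lambda>x. f (x + a)) \<in> borel_measurable lebesgue"
  using measurable_compose[OF lebesgue_translation_measurable assms] .

lemma integrable_lebesgue_translation:
  fixes f :: "'a::euclidean_space \<Rightarrow> real"
  assumes "integrable lebesgue f"
  shows "integrable lebesgue (\<lambda>x. f (x + a))"
  using integrable_distr[OF lebesgue_translation_measurable, of a f] assms
  by (simp only: lebesgue_distr_translation)

lemma integral_lebesgue_translation:
  fixes f :: "'a::euclidean_space \<Rightarrow> real"
  assumes "f \<in> borel_measurable lebesgue"
  shows "(LINT x|lebesgue. f (x + a)) = (LINT x|lebesgue. f x)"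
  using integral_distr[OF lebesgue_translation_measurable assms, of a]
  by (simp only: lebesgue_distr_translation)

lemma C_compact_lebesgue_measurable [measurable_dest]:
  assumes "\<phi> \<in> C_compact 1 U"
  shows "\<phi> \<in> borel_measurable lebesgue"
  by (rule measurable_completion) (simp add: C_compact_measurable[OF assms])

lemma C_compact_lebesgue_measurable_dir_deriv [measurable_dest]:
  assumes "\<phi> \<in> C_compact 1 U"
  shows "dir_deriv j \<phi> \<in> borel_measurable lebesgue"
  by (rule measurable_completion) (simp add: C_compact_measurable_dir_deriv[OF assms])

lemma integrable_mult_bounded:
  fixes f g :: "'a \<Rightarrow> real"
  assumes "integrable M f" "g \<in> borel_measurable M" "\<And>x. \<bar>g x\<bar> \<le> C"
  shows "integrable M (\<lambda>x. f x * g x)"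
proof (rule Bochner_Integration.integrable_bound)
  show "integrable M (\<lambda>x. C * f x)" using assms by simp
  show "(\<lambda>x. f x * g x) \<in> borel_measurable M" using assms by measurable
  show "AE x in M. norm (f x * g x) \<le> norm (C * f x)"
  proof (rule AE_I2)
    fix x
    have "\<bar>g x\<bar> \<le> \<bar>C\<bar>" using assms(3)[of x] by linarith
    then show "norm (f x * g x) \<le> norm (C * f x)"
      using mult_left_mono[of "\<bar>g x\<bar>" "\<bar>C\<bar>" "\<bar>f x\<bar>"] by (simp add: abs_mult mult.commute)
  qed
qed

text \<open>Convergence almost everywhere together with the uniform bound \<open>1\<close> is what dominated convergence needs
when the test functions replace \<open>s\<close> under an integral.\<close>

lemma C_compact_approximation:
  fixes s :: "'a::euclidean_space \<Rightarrow> real"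
  assumes "s \<in> borel_measurable lebesgue" "\<And>x. \<bar>s x\<bar> \<le> 1"
  obtains \<phi> where "\<And>n. \<phi> n \<in> C_compact 1 UNIV" "\<And>n x. \<bar>\<phi> n x\<bar> \<le> 1"
    "AE x in lebesgue. (\<lambda>n::nat. \<phi> n x) \<longlonglongrightarrow> s x"
proof -
  have "s measurable_on UNIV"
    using assms(1) by (rule lebesgue_measurable_imp_measurable_on) simp
  then obtain N g where N: "negligible N" and g: "\<And>n::nat. continuous_on UNIV (g n)"
    "\<And>x. x \<notin> N \<Longrightarrow> (\<lambda>n. g n x) \<longlonglongrightarrow> s x"
    unfolding measurable_on_def by auto
  define c where "c = (\<lambda>n x. max (-1) (min 1 (g n x)))"
  have c_cont: "continuous_on A (c n)" for A n
    unfolding c_def by (intro continuous_intros continuous_on_subset[OF g(1)]) auto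
  have c_lim: "(\<lambda>n. c n x) \<longlonglongrightarrow> s x" if "x \<notin> N" for x
  proof -
    have "(\<lambda>n. c n x) \<longlonglongrightarrow> max (-1) (min 1 (s x))"
      unfolding c_def by (intro tendsto_intros g that)
    moreover have "max (-1) (min 1 (s x)) = s x" using assms(2)[of x] by linarith
    ultimately show ?thesis by simp
  qed
  have "\<exists>\<theta>\<in>C_compact 1 UNIV. (\<forall>x. 0 \<le> \<theta> x \<and> \<theta> x \<le> 1) \<and> (\<forall>x\<in>cball (0::'a) (real n). \<theta> x = 1)" for n
    by (rule C_compact_cutoff[OF compact_cball subset_UNIV open_UNIV, of 0 "real n"]) blast
  then obtain \<theta> where \<theta>: "\<And>n. \<theta> n \<in> C_compact 1 (UNIV :: 'a set)" "\<And>n x. 0 \<le> \<theta> n x" "\<And>n x. \<theta> n x \<le> 1"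
    "\<And>n x. x \<in> cball 0 (real n) \<Longrightarrow> \<theta> n x = 1"
    by metis
  have "\<exists>K P. compact K \<and> (\<forall>x. x \<notin> K \<longrightarrow> \<theta> n x = 0) \<and> real_polynomial_function P \<and>
      (\<forall>x\<in>K. \<bar>c n x - P x\<bar> < 1 / real (Suc n))" for n
  proof -
    obtain K where K: "compact K" "\<forall>x. x \<notin> K \<longrightarrow> \<theta> n x = 0"
      using \<theta>(1)[of n] by (auto simp: C_compact_def)
    show ?thesis
      by (rule Stone_Weierstrass_real_polynomial_function[OF K(1) c_cont, of "1 / real (Suc n)" n])
         (use K in auto)
  qed
  then obtain K P where K: "\<And>n x. x \<notin> K n \<Longrightarrow> \<theta> n x = 0" and
    P: "\<And>n. real_polynomial_function (P n)" "\<And>n x. x \<in> K n \<Longrightarrow> \<bar>c n x - P n x\<bar> < 1 / real (Suc n)"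
    by metis
  \<comment> \<open>The polynomial is bounded by \<open>1 + 1 / (n + 1)\<close>; this factor brings it back below \<open>1\<close>.\<close>
  define q where "q = (\<lambda>n::nat. real (Suc n) / real (Suc (Suc n)))"
  have q: "0 < q n" "q n * (1 + 1 / real (Suc n)) = 1" for n
    unfolding q_def by (auto simp: divide_simps)
  define \<phi> where "\<phi> = (\<lambda>n x. (q n * P n x) * \<theta> n x)"
  show thesis
  proof (rule that[of \<phi>])
    show "\<phi> n \<in> C_compact 1 UNIV" for n
      unfolding \<phi>_def
      by (intro C_compact_mult_left \<theta> C_diff_1_mult C_diff_1_const C_diff_1_real_polynomial_function P)
    show "\<bar>\<phi> n x\<bar> \<le> 1" for n x
    proof (cases "x \<in> K n")
      case True
      have "\<bar>c n x\<bar> \<le> 1" by (auto simp: c_def)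
      then have "\<bar>P n x\<bar> \<le> 1 + 1 / real (Suc n)" using P(2)[OF True] by linarith
      then have "q n * \<bar>P n x\<bar> \<le> q n * (1 + 1 / real (Suc n))"
        using q(1)[of n] by (intro mult_left_mono) auto
      then have "q n * \<bar>P n x\<bar> \<le> 1"
        unfolding q(2) .
      then show ?thesis
        unfolding \<phi>_def using \<theta>(2,3)[of n x] q(1)[of n]
        by (auto simp: abs_mult intro!: mult_le_one)
    qed (simp add: K \<phi>_def)
    have "(\<lambda>n. \<phi> n x) \<longlonglongrightarrow> s x" if x: "x \<notin> N" for x
    proof -
      have ev: "eventually (\<lambda>n. x \<in> cball 0 (real n)) sequentially"
        using eventually_ge_at_top[of "nat \<lceil>norm x\<rceil>"]
        by eventually_elim simp
      have PC: "(\<lambda>n. P n x - c n x) \<longlonglongrightarrow> 0"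
      proof (rule Lim_null_comparison[where g="\<lambda>n. 1 / real (Suc n)"])
        show "\<forall>\<^sub>F n in sequentially. norm (P n x - c n x) \<le> 1 / real (Suc n)"
          using ev
        proof eventually_elim
          case (elim n)
          then have "x \<in> K n" using K[of x n] \<theta>(4)[of x n] by fastforce
          then show ?case using P(2)[of x n] by simp
        qed
        show "(\<lambda>n. 1 / real (Suc n)) \<longlonglongrightarrow> 0"
          using LIMSEQ_inverse_real_of_nat by (simp add: inverse_eq_divide)
      qed
      have "(\<lambda>n. q n) \<longlonglongrightarrow> 1"
      proof -
        have "(\<lambda>n. 1 - inverse (real (Suc (Suc n)))) \<longlonglongrightarrow> 1 - 0"
          by (intro tendsto_intros LIMSEQ_Suc[OF LIMSEQ_inverse_real_of_nat])
        then show ?thesis by (simp add: q_def field_simps)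
      qed
      then have "(\<lambda>n. q n * ((P n x - c n x) + c n x)) \<longlonglongrightarrow> 1 * (0 + s x)"
        by (intro tendsto_intros PC c_lim x)
      then have "(\<lambda>n. q n * P n x) \<longlonglongrightarrow> s x" by simp
      then show ?thesis
      proof (rule Lim_transform_eventually)
        show "\<forall>\<^sub>F n in sequentially. q n * P n x = \<phi> n x"
          using ev by eventually_elim (simp add: \<phi>_def \<theta>(4))
      qed
    qed
    then show "AE x in lebesgue. (\<lambda>n. \<phi> n x) \<longlonglongrightarrow> s x"
      using N by (intro AE_I'[of N]) (auto simp: negligible_iff_null_sets)
  qed
qed

text \<open>Test functions that approximate the sign of \<open>g\<close> recover the \<open>L\<^sup>1\<close> norm in the limit.\<close>

lemma L1_norm_le_by_duality:
  fixes g :: "'a::euclidean_space \<Rightarrow> real"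
  assumes g: "integrable lebesgue g"
    and le: "\<And>\<phi>. \<phi> \<in> C_compact 1 UNIV \<Longrightarrow> (\<And>x. \<bar>\<phi> x\<bar> \<le> 1) \<Longrightarrow> (LINT x|lebesgue. g x * \<phi> x) \<le> C"
  shows "(LINT x|lebesgue. \<bar>g x\<bar>) \<le> C"
proof -
  have [measurable]: "g \<in> borel_measurable lebesgue" using g by auto
  have s: "(\<lambda>x. sgn (g x)) \<in> borel_measurable lebesgue" by measurable
  obtain \<phi> where \<phi>: "\<And>n. \<phi> n \<in> C_compact 1 UNIV" "\<And>n x. \<bar>\<phi> n x\<bar> \<le> 1"
    "AE x in lebesgue. (\<lambda>n::nat. \<phi> n x) \<longlonglongrightarrow> sgn (g x)"
    by (rule C_compact_approximation[OF s]) (auto simp: sgn_if intro: that)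
  note [measurable] = C_compact_lebesgue_measurable[OF \<phi>(1)]
  have "(\<lambda>n. LINT x|lebesgue. g x * \<phi> n x) \<longlonglongrightarrow> (LINT x|lebesgue. g x * sgn (g x))"
  proof (rule integral_dominated_convergence[where w="\<lambda>x. \<bar>g x\<bar>"])
    show "AE x in lebesgue. (\<lambda>n. g x * \<phi> n x) \<longlonglongrightarrow> g x * sgn (g x)"
      using \<phi>(3) by eventually_elim (intro tendsto_intros)
    show "AE x in lebesgue. norm (g x * \<phi> n x) \<le> \<bar>g x\<bar>" for n
      by (intro AE_I2) (auto simp: abs_mult \<phi>(2) intro: mult_left_le)
  qed (use g in auto)
  then have "(LINT x|lebesgue. g x * sgn (g x)) \<le> C"
    by (rule LIMSEQ_le_const2) (use le \<phi> in auto)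
  then show ?thesis by (simp add: mult.commute[of "g _"] flip: abs_sgn)
qed

lemma loc_integrable_mult_compact_support:
  fixes g :: "'a::euclidean_space \<Rightarrow> real"
  assumes "loc_integrable U g" "compact K" "K \<subseteq> U"
    "\<psi> \<in> borel_measurable lebesgue" "\<And>x. \<bar>\<psi> x\<bar> \<le> C" "\<And>x. x \<notin> K \<Longrightarrow> \<psi> x = 0"
  shows "integrable lebesgue (\<lambda>x. g x * \<psi> x)"
proof -
  have "integrable (lebesgue_on K) g"
    using assms by (auto simp: loc_integrable_def)
  then have "integrable lebesgue (\<lambda>x. indicat_real K x *\<^sub>R g x)"
    by (subst (asm) integrable_restrict_space)
       (use assms(2) in \<open>auto intro: lmeasurable_compact fmeasurableD\<close>)
  then have "integrable lebesgue (\<lambda>x. indicat_real K x *\<^sub>R g x * \<psi> x)"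
    by (rule integrable_mult_bounded) (use assms in auto)
  moreover have "(\<lambda>x. indicat_real K x *\<^sub>R g x * \<psi> x) = (\<lambda>x. g x * \<psi> x)"
    using assms(6) by (intro ext) (auto simp: indicator_def)
  ultimately show ?thesis by simp
qed

text \<open>Integrals of functions supported in \<open>U\<close> are moved to the whole space, where translations are available.\<close>

lemma integral_lebesgue_on_eq:
  fixes f :: "'a::euclidean_space \<Rightarrow> real"
  assumes "U \<in> sets lebesgue" "\<And>x. x \<notin> U \<Longrightarrow> f x = 0"
  shows "(LINT x|lebesgue_on U. f x) = (LINT x|lebesgue. f x)"
    and "integrable (lebesgue_on U) f \<longleftrightarrow> integrable lebesgue f"
proof -
  have *: "(\<lambda>x. indicat_real U x *\<^sub>R f x) = f"
    using assms(2) by (intro ext) (auto simp: indicator_def)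
  show "(LINT x|lebesgue_on U. f x) = (LINT x|lebesgue. f x)"
    using integral_restrict_space[of U lebesgue f] assms(1) unfolding * by simp
  show "integrable (lebesgue_on U) f \<longleftrightarrow> integrable lebesgue f"
    using integrable_restrict_space[of U lebesgue f] assms(1) unfolding * by simp
qed

lemma loc_integrable_times_continuous:
  fixes g :: "'a::euclidean_space \<Rightarrow> real"
  assumes "loc_integrable U g" "compact K" "K \<subseteq> U"
    "continuous_on UNIV \<psi>" "\<And>x. x \<notin> K \<Longrightarrow> \<psi> x = 0"
  shows "integrable lebesgue (\<lambda>x. g x * \<psi> x)"
proof -
  obtain C where "\<And>x. \<bar>\<psi> x\<bar> \<le> C"
    by (rule bounded_range_if_compact_support[OF assms(4,2,5)]) (assumption, rule that)
  moreover have "\<psi> \<in> borel_measurable lebesgue"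
    using borel_measurable_continuous_onI[OF assms(4)] by (intro measurable_completion) simp
  ultimately show ?thesis
    by (intro loc_integrable_mult_compact_support[OF assms(1-3)] assms(5))
qed

lemma loc_integrable_times_test:
  fixes g :: "'a::euclidean_space \<Rightarrow> real"
  assumes "loc_integrable U g" "\<phi> \<in> C_compact 1 U"
  shows "integrable lebesgue (\<lambda>x. g x * \<phi> x)" "integrable lebesgue (\<lambda>x. g x * dir_deriv j \<phi> x)"
proof -
  obtain K where K: "C_diff 1 \<phi>" "compact K" "K \<subseteq> U" "\<And>x. x \<notin> K \<Longrightarrow> \<phi> x = 0"
    "\<And>x j. x \<notin> K \<Longrightarrow> dir_deriv j \<phi> x = 0"
    by (rule C_compactE[OF assms(2)]) (rule that)
  show "integrable lebesgue (\<lambda>x. g x * \<phi> x)"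
    by (rule loc_integrable_times_continuous[OF assms(1) K(2,3) C_diff_1_continuous[OF K(1)] K(4)])
  show "integrable lebesgue (\<lambda>x. g x * dir_deriv j \<phi> x)"
    by (rule loc_integrable_times_continuous[OF assms(1) K(2,3) C_diff_1_continuous_dir_deriv[OF K(1)] K(5)])
qed

lemma integral_test_lebesgue_on:
  fixes g :: "'a::euclidean_space \<Rightarrow> real"
  assumes "open U" "\<phi> \<in> C_compact 1 U"
  shows "(LINT x|lebesgue_on U. g x * \<phi> x) = (LINT x|lebesgue. g x * \<phi> x)"
    and "(LINT x|lebesgue_on U. g x * dir_deriv j \<phi> x) = (LINT x|lebesgue. g x * dir_deriv j \<phi> x)"
    and "(LINT x|lebesgue_on U. dir_deriv (F x) \<phi> x) = (LINT x|lebesgue. dir_deriv (F x) \<phi> x)"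
proof -
  obtain K where K: "K \<subseteq> U" "\<And>x. x \<notin> K \<Longrightarrow> \<phi> x = 0" "\<And>x j. x \<notin> K \<Longrightarrow> dir_deriv j \<phi> x = 0"
    by (rule C_compactE[OF assms(2)]) (rule that)
  have [simp]: "U \<in> sets lebesgue" using assms(1) by simp
  show "(LINT x|lebesgue_on U. g x * \<phi> x) = (LINT x|lebesgue. g x * \<phi> x)"
    using K by (intro integral_lebesgue_on_eq) auto
  show "(LINT x|lebesgue_on U. g x * dir_deriv j \<phi> x) = (LINT x|lebesgue. g x * dir_deriv j \<phi> x)"
    using K by (intro integral_lebesgue_on_eq) auto
  show "(LINT x|lebesgue_on U. dir_deriv (F x) \<phi> x) = (LINT x|lebesgue. dir_deriv (F x) \<phi> x)"
    using K by (intro integral_lebesgue_on_eq) auto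
qed

text \<open>On each compact subset \<open>g\<close> is cut off to an integrable function on the whole space. Its product with a
test function is again \<open>g\<close> times a test function, so its \<open>L\<^sup>1\<close> norm vanishes by duality.\<close>

lemma fundamental_lemma_of_variations:
  fixes g :: "'a::euclidean_space \<Rightarrow> real"
  assumes U: "open U" and g: "loc_integrable U g"
    and zero: "\<And>\<phi>. \<phi> \<in> C_compact 1 U \<Longrightarrow> (LINT x|lebesgue. g x * \<phi> x) = 0"
  shows "AE x in lebesgue_on U. g x = 0"
proof -
  obtain C :: "nat \<Rightarrow> 'a set" where C: "\<And>n. compact (C n)" "\<And>n. C n \<subseteq> U" "\<Union>(range C) = U"
  proof (rule open_Union_compact_subsets[OF U])
    fix C :: "nat \<Rightarrow> 'a set"
    assume "\<And>n. compact (C n)" "\<And>n. C n \<subseteq> U" "\<Union>(range C) = U"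
    then show thesis by (rule that)
  qed
  have "AE x in lebesgue. x \<in> C n \<longrightarrow> g x = 0" for n
  proof -
    obtain \<theta> where \<theta>: "\<theta> \<in> C_compact 1 U" "\<And>x. x \<in> C n \<Longrightarrow> \<theta> x = 1"
      by (rule C_compact_cutoff[OF C(1,2) U]) (rule that)
    have int: "integrable lebesgue (\<lambda>x. g x * \<theta> x)"
      using g \<theta> by (intro loc_integrable_times_test)
    have "(LINT x|lebesgue. \<bar>g x * \<theta> x\<bar>) \<le> 0"
    proof (rule L1_norm_le_by_duality[OF int])
      fix \<phi> :: "'a \<Rightarrow> real" assume "\<phi> \<in> C_compact 1 UNIV"
      then have "(\<lambda>x. \<theta> x * \<phi> x) \<in> C_compact 1 U"
        using \<theta> by (intro C_compact_mult_right C_compact_C_diff)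
      from zero[OF this] show "(LINT x|lebesgue. (g x * \<theta> x) * \<phi> x) \<le> 0"
        by (simp add: mult.assoc)
    qed
    moreover have "(LINT x|lebesgue. \<bar>g x * \<theta> x\<bar>) \<ge> 0" by simp
    ultimately have "(LINT x|lebesgue. \<bar>g x * \<theta> x\<bar>) = 0" by linarith
    then have "AE x in lebesgue. \<bar>g x * \<theta> x\<bar> = 0"
      using int by (subst (asm) integral_nonneg_eq_0_iff_AE) auto
    then show ?thesis by eventually_elim (auto simp: \<theta>(2))
  qed
  then have "AE x in lebesgue. \<forall>n. x \<in> C n \<longrightarrow> g x = 0"
    by (subst AE_all_countable) blast
  then have "AE x in lebesgue. x \<in> U \<longrightarrow> g x = 0"
    by eventually_elim (use C(3) in blast)
  then show ?thesis
    using U by (subst AE_restrict_space_iff) auto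
qed

lemma integrable_indicator_compact:
  fixes K :: "'a::euclidean_space set"
  assumes "compact K"
  shows "integrable lebesgue (indicat_real K)"
  using lmeasurable_compact[OF assms]
  by (intro integrable_real_indicator) (auto simp: fmeasurable_def)

lemma integrable_C_compact:
  fixes \<phi> :: "'a::euclidean_space \<Rightarrow> real"
  assumes "\<phi> \<in> C_compact 1 U"
  shows "integrable lebesgue \<phi>"
proof -
  have "loc_integrable U (\<lambda>x::'a. 1 :: real)"
    unfolding loc_integrable_def
  proof (intro allI impI)
    fix K :: "'a set" assume "compact K \<and> K \<subseteq> U"
    then show "integrable (lebesgue_on K) (\<lambda>x. 1 :: real)"
      using integrable_indicator_compact[of K] lmeasurable_compact[of K]
      by (subst integrable_restrict_space) (auto simp: fmeasurableD)
  qed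
  from loc_integrable_times_test(1)[OF this assms] show ?thesis by simp
qed

text \<open>Truncation of values and support reduces the claim to a bounded function with bounded support, to which
\<open>C_compact_approximation\<close> applies after division by the bound. The extra cutoff \<open>\<theta>\<close> confines all
approximations to one compact set and thus provides the dominating function.\<close>

lemma C_compact_dense_L1:
  fixes h :: "'a::euclidean_space \<Rightarrow> real"
  assumes h: "integrable lebesgue h" and \<epsilon>: "\<epsilon> > 0"
  obtains \<psi> where "\<psi> \<in> C_compact 1 UNIV" "(LINT x|lebesgue. \<bar>h x - \<psi> x\<bar>) < \<epsilon>"
proof -
  have [measurable]: "h \<in> borel_measurable lebesgue" using h by auto
  \<comment> \<open>\<open>h\<close> with its values truncated to \<open>[-m, m]\<close> and its support to the ball of radius \<open>m\<close>\<close>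
  define T where "T = (\<lambda>m x. indicat_real (cball 0 (real m)) x * max (- real m) (min (real m) (h x)))"
  have [measurable]: "T m \<in> borel_measurable lebesgue" for m
    unfolding T_def
    by (intro borel_measurable_times borel_measurable_indicator borel_measurable_max
        borel_measurable_min borel_measurable_const) auto
  have "(\<lambda>m. LINT x|lebesgue. \<bar>h x - T m x\<bar>) \<longlonglongrightarrow> (LINT x|(lebesgue :: 'a measure). 0)"
  proof (rule integral_dominated_convergence[where w="\<lambda>x. \<bar>h x\<bar>"])
    show "AE x in lebesgue. (\<lambda>m. \<bar>h x - T m x\<bar>) \<longlonglongrightarrow> 0"
    proof (rule AE_I2, rule tendsto_eventually)
      fix x
      show "\<forall>\<^sub>F m in sequentially. \<bar>h x - T m x\<bar> = 0"
        using eventually_ge_at_top[of "nat \<lceil>norm x\<rceil> + nat \<lceil>\<bar>h x\<bar>\<rceil>"]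
      proof eventually_elim
        case (elim m)
        then have "norm x \<le> real m" "\<bar>h x\<bar> \<le> real m" by linarith+
        then show ?case by (auto simp: T_def max_def min_def)
      qed
    qed
    show "AE x in lebesgue. norm \<bar>h x - T m x\<bar> \<le> \<bar>h x\<bar>" for m
      by (intro AE_I2) (auto simp: T_def indicator_def max_def min_def)
  qed (use h in auto)
  then have "eventually (\<lambda>m. (LINT x|lebesgue. \<bar>h x - T m x\<bar>) < \<epsilon> / 2) sequentially"
    using \<epsilon> by (intro order_tendstoD) auto
  then have "eventually (\<lambda>m. (LINT x|lebesgue. \<bar>h x - T m x\<bar>) < \<epsilon> / 2 \<and> m \<ge> 1) sequentially"
    using eventually_ge_at_top by (rule eventually_conj)
  then obtain m where m: "(LINT x|lebesgue. \<bar>h x - T m x\<bar>) < \<epsilon> / 2" "m \<ge> 1"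
    unfolding eventually_sequentially by blast
  have T_int: "integrable lebesgue (T m)"
  proof (rule Bochner_Integration.integrable_bound[OF h])
    show "AE x in lebesgue. norm (T m x) \<le> norm (h x)"
      by (rule AE_I2) (auto simp: T_def indicator_def max_def min_def)
  qed measurable
  have "(\<lambda>x. T m x / real m) \<in> borel_measurable lebesgue" by measurable
  then obtain \<phi> where \<phi>: "\<And>n. \<phi> n \<in> C_compact 1 UNIV" "\<And>n x. \<bar>\<phi> n x\<bar> \<le> 1"
    "AE x in lebesgue. (\<lambda>n::nat. \<phi> n x) \<longlonglongrightarrow> T m x / real m"
  proof (rule C_compact_approximation)
    show "\<bar>T m x / real m\<bar> \<le> 1" for x
      using m(2) by (auto simp: T_def indicator_def max_def min_def divide_le_eq)
  qed (rule that)
  note [measurable] = C_compact_lebesgue_measurable[OF \<phi>(1)]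
  obtain \<theta> :: "'a \<Rightarrow> real" where \<theta>: "\<theta> \<in> C_compact 1 UNIV" "\<And>x. 0 \<le> \<theta> x" "\<And>x. \<theta> x \<le> 1"
    "\<And>x. x \<in> cball 0 (real m) \<Longrightarrow> \<theta> x = 1"
    by (rule C_compact_cutoff[OF compact_cball subset_UNIV open_UNIV, of 0 "real m"]) (rule that)
  note [measurable] = C_compact_lebesgue_measurable[OF \<theta>(1)]
  have \<theta>_int: "integrable lebesgue \<theta>"
    by (rule integrable_C_compact[OF \<theta>(1)])
  define \<psi> where "\<psi> = (\<lambda>n x. (real m * \<phi> n x) * \<theta> x)"
  have \<psi>: "\<psi> n \<in> C_compact 1 UNIV" for n
    unfolding \<psi>_def by (intro C_compact_mult_left \<theta> C_diff_1_mult C_diff_1_const C_compact_C_diff[OF \<phi>(1)])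
  note [measurable] = C_compact_lebesgue_measurable[OF \<psi>]
  have \<psi>_bound: "\<bar>\<psi> n x\<bar> \<le> real m * \<theta> x" for n x
    using \<phi>(2)[of n x] \<theta>(2)[of x] unfolding \<psi>_def
    by (auto simp: abs_mult intro!: mult_right_mono mult_left_le)
  have \<psi>_int: "integrable lebesgue (\<psi> n)" for n
    by (rule Bochner_Integration.integrable_bound[of _ "\<lambda>x. real m * \<theta> x"])
       (use \<theta>_int \<psi>_bound \<theta>(2) in auto)
  have T_eq: "real m * (T m x / real m) * \<theta> x = T m x" for x
    using m(2) \<theta>(4)[of x] by (cases "x \<in> cball 0 (real m)") (auto simp: T_def)
  have "(\<lambda>n. LINT x|lebesgue. \<bar>T m x - \<psi> n x\<bar>) \<longlonglongrightarrow> (LINT x|(lebesgue :: 'a measure). 0)"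
  proof (rule integral_dominated_convergence[where w="\<lambda>x. \<bar>T m x\<bar> + real m * \<theta> x"])
    show "AE x in lebesgue. (\<lambda>n. \<bar>T m x - \<psi> n x\<bar>) \<longlonglongrightarrow> 0"
      using \<phi>(3)
    proof eventually_elim
      case (elim x)
      then have "(\<lambda>n. \<bar>T m x - \<psi> n x\<bar>) \<longlonglongrightarrow> \<bar>T m x - real m * (T m x / real m) * \<theta> x\<bar>"
        unfolding \<psi>_def by (intro tendsto_intros)
      then show ?case by (simp only: T_eq diff_self abs_zero)
    qed
    show "AE x in lebesgue. norm \<bar>T m x - \<psi> n x\<bar> \<le> \<bar>T m x\<bar> + real m * \<theta> x" for n
    proof (rule AE_I2)
      fix x show "norm \<bar>T m x - \<psi> n x\<bar> \<le> \<bar>T m x\<bar> + real m * \<theta> x"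
        using \<psi>_bound[of n x] by simp
    qed
  qed (use T_int \<theta>_int in auto)
  then have "eventually (\<lambda>n. (LINT x|lebesgue. \<bar>T m x - \<psi> n x\<bar>) < \<epsilon> / 2) sequentially"
    using \<epsilon> by (intro order_tendstoD) auto
  then obtain n where n: "(LINT x|lebesgue. \<bar>T m x - \<psi> n x\<bar>) < \<epsilon> / 2"
    unfolding eventually_sequentially by blast
  have "(LINT x|lebesgue. \<bar>h x - \<psi> n x\<bar>) \<le> (LINT x|lebesgue. \<bar>h x - T m x\<bar> + \<bar>T m x - \<psi> n x\<bar>)"
    by (intro integral_mono Bochner_Integration.integrable_add integrable_abs Bochner_Integration.integrable_diff h T_int \<psi>_int) auto
  also have "\<dots> = (LINT x|lebesgue. \<bar>h x - T m x\<bar>) + (LINT x|lebesgue. \<bar>T m x - \<psi> n x\<bar>)"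
    by (intro Bochner_Integration.integral_add integrable_abs Bochner_Integration.integrable_diff h T_int \<psi>_int)
  also have "\<dots> < \<epsilon>" using m(1) n by simp
  finally show thesis by (rule that[OF \<psi>])
qed

text \<open>For test functions this is dominated convergence; density and the invariance of the \<open>L\<^sup>1\<close> norm under
translations give the general case.\<close>

lemma L1_continuous_translation:
  fixes h :: "'a::euclidean_space \<Rightarrow> real"
  assumes h: "integrable lebesgue h" and \<epsilon>: "\<epsilon> > 0"
  obtains d where "d > 0" "\<And>a. norm a < d \<Longrightarrow> (LINT x|lebesgue. \<bar>h (x + a) - h x\<bar>) < \<epsilon>"
proof -
  obtain \<psi> where \<psi>: "\<psi> \<in> C_compact 1 UNIV" "(LINT x|lebesgue. \<bar>h x - \<psi> x\<bar>) < \<epsilon> / 3"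
    by (rule C_compact_dense_L1[OF h, of "\<epsilon> / 3"]) (use \<epsilon> in simp, rule that)
  note [measurable] = C_compact_lebesgue_measurable[OF \<psi>(1)]
  have \<psi>_int: "integrable lebesgue \<psi>" using integrable_C_compact[OF \<psi>(1)] .
  obtain K where K: "compact K" "\<And>x. x \<notin> K \<Longrightarrow> \<psi> x = 0"
    by (rule C_compactE[OF \<psi>(1)]) (rule that)
  obtain R where R: "\<And>x. x \<in> K \<Longrightarrow> norm x \<le> R"
    using compact_imp_bounded[OF K(1)] unfolding bounded_iff by blast
  obtain C where C: "C > 0" "\<And>x. \<bar>\<psi> x\<bar> \<le> C"
    by (rule C_compact_bounded[OF \<psi>(1)]) (rule that)
  have \<psi>_trans: "((\<lambda>a. LINT x|lebesgue. \<bar>\<psi> (x + a) - \<psi> x\<bar>) \<longlongrightarrow> 0) (at 0)"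
    unfolding tendsto_at_iff_sequentially
  proof (intro allI impI)
    fix X :: "nat \<Rightarrow> 'a"
    assume X: "X \<longlonglongrightarrow> 0"
    then obtain M where M: "\<And>i. norm (X i) \<le> M"
      using convergent_imp_Bseq[of X] by (auto simp: convergent_def Bseq_def)
    have "(\<lambda>i. LINT x|lebesgue. \<bar>\<psi> (x + X i) - \<psi> x\<bar>) \<longlonglongrightarrow> (LINT x|(lebesgue :: 'a measure). 0)"
    proof (rule integral_dominated_convergence[where w="\<lambda>x. 2 * C * indicat_real (cball 0 (R + M)) x"])
      show "(\<lambda>x. \<bar>\<psi> (x + X i) - \<psi> x\<bar>) \<in> borel_measurable lebesgue" for i
        using borel_measurable_lebesgue_translation[of \<psi> "X i"] by measurable
      show "integrable lebesgue (\<lambda>x::'a. 2 * C * indicat_real (cball 0 (R + M)) x)"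
        by (intro integrable_mult_right integrable_indicator_compact) simp
      show "AE x in lebesgue. (\<lambda>i. \<bar>\<psi> (x + X i) - \<psi> x\<bar>) \<longlonglongrightarrow> 0"
      proof (rule AE_I2)
        fix x
        have "isCont \<psi> (x + 0)"
          using C_diff_1_continuous[OF C_compact_C_diff[OF \<psi>(1)]] by (simp add: continuous_on_eq_continuous_at)
        then have "(\<lambda>i. \<psi> (x + X i)) \<longlonglongrightarrow> \<psi> (x + 0)"
          by (rule isCont_tendsto_compose) (intro tendsto_intros X)
        then have "(\<lambda>i. \<bar>\<psi> (x + X i) - \<psi> x\<bar>) \<longlonglongrightarrow> \<bar>\<psi> (x + 0) - \<psi> x\<bar>"
          by (intro tendsto_intros)
        then show "(\<lambda>i. \<bar>\<psi> (x + X i) - \<psi> x\<bar>) \<longlonglongrightarrow> 0" by simp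
      qed
      show "AE x in lebesgue. norm \<bar>\<psi> (x + X i) - \<psi> x\<bar> \<le> 2 * C * indicat_real (cball 0 (R + M)) x" for i
      proof (rule AE_I2)
        fix x
        show "norm \<bar>\<psi> (x + X i) - \<psi> x\<bar> \<le> 2 * C * indicat_real (cball 0 (R + M)) x"
        proof (cases "x \<in> cball 0 (R + M)")
          case True
          then show ?thesis using C(2)[of x] C(2)[of "x + X i"] by simp
        next
          case False
          have "norm x \<le> norm (x + X i) + norm (X i)"
            using norm_triangle_ineq4[of "x + X i" "X i"] by simp
          then have "x + X i \<notin> K" "x \<notin> K"
            using False R[of "x + X i"] R[of x] M[of i] norm_ge_zero[of "X i"] by fastforce+
          then show ?thesis using K(2) False by simp
        qed
      qed
    qed auto
    then show "((\<lambda>a. LINT x|lebesgue. \<bar>\<psi> (x + a) - \<psi> x\<bar>) \<circ> X) \<longlonglongrightarrow> 0"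
      by (simp add: o_def)
  qed
  then obtain d where d: "d > 0" "\<And>a. a \<noteq> 0 \<Longrightarrow> norm a < d \<Longrightarrow> (LINT x|lebesgue. \<bar>\<psi> (x + a) - \<psi> x\<bar>) < \<epsilon> / 3"
    using tendstoD[OF \<psi>_trans, of "\<epsilon> / 3"] \<epsilon> unfolding eventually_at by auto
  show thesis
  proof (rule that[OF d(1)])
    fix a :: 'a assume a: "norm a < d"
    note ih = integrable_lebesgue_translation[OF h, of a]
    note ip = integrable_lebesgue_translation[OF \<psi>_int, of a]
    note i = integrable_abs Bochner_Integration.integrable_diff Bochner_Integration.integrable_add h \<psi>_int ih ip
    have d': "(LINT x|lebesgue. \<bar>\<psi> (x + a) - \<psi> x\<bar>) < \<epsilon> / 3"
      using d(2)[of a] a \<epsilon> by (cases "a = 0") auto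
    have t: "(LINT x|lebesgue. \<bar>h (x + a) - \<psi> (x + a)\<bar>) = (LINT x|lebesgue. \<bar>h x - \<psi> x\<bar>)"
      using integral_lebesgue_translation[of "\<lambda>x. \<bar>h x - \<psi> x\<bar>" a] h by simp
    have "(LINT x|lebesgue. \<bar>h (x + a) - h x\<bar>) \<le>
        (LINT x|lebesgue. \<bar>h (x + a) - \<psi> (x + a)\<bar> + (\<bar>\<psi> (x + a) - \<psi> x\<bar> + \<bar>h x - \<psi> x\<bar>))"
      by (intro integral_mono i) linarith
    also have "\<dots> = (LINT x|lebesgue. \<bar>h (x + a) - \<psi> (x + a)\<bar>) +
        ((LINT x|lebesgue. \<bar>\<psi> (x + a) - \<psi> x\<bar>) + (LINT x|lebesgue. \<bar>h x - \<psi> x\<bar>))"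
      by (subst Bochner_Integration.integral_add; (intro i)?)+ simp
    also have "\<dots> < \<epsilon>" using t d' \<psi>(2) by linarith
    finally show "(LINT x|lebesgue. \<bar>h (x + a) - h x\<bar>) < \<epsilon>" .
  qed
qed

section \<open>Difference quotients and the chain rule\<close>

lemma C_diff_1_along_line:
  assumes "C_diff 1 \<phi>"
  shows "((\<lambda>t. \<phi> (x + t *\<^sub>R v)) has_real_derivative dir_deriv v \<phi> (x + t *\<^sub>R v)) (at t)"
proof -
  have "((\<lambda>t. x + t *\<^sub>R v) has_derivative (\<lambda>h. h *\<^sub>R v)) (at t)"
    by (auto intro!: derivative_eq_intros)
  from has_derivative_compose[OF this C_diff_1_has_derivative[OF assms]]
  have D: "((\<lambda>t. \<phi> (x + t *\<^sub>R v)) has_derivative (\<lambda>h. dir_deriv (h *\<^sub>R v) \<phi> (x + t *\<^sub>R v))) (at t)" .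
  interpret bounded_linear "\<lambda>j. dir_deriv j \<phi> (x + t *\<^sub>R v)"
    using C_diff_1_has_derivative[OF assms] by (rule has_derivative_bounded_linear)
  have "(\<lambda>h. dir_deriv (h *\<^sub>R v) \<phi> (x + t *\<^sub>R v)) = (*) (dir_deriv v \<phi> (x + t *\<^sub>R v))"
    by (intro ext) (simp add: scale)
  with D show ?thesis unfolding has_field_derivative_def by simp
qed

lemma C_diff_1_line_lipschitz:
  assumes "C_diff 1 \<phi>" "\<And>x. \<bar>dir_deriv v \<phi> x\<bar> \<le> C"
  shows "\<bar>\<phi> (x + s *\<^sub>R v) - \<phi> (x + t *\<^sub>R v)\<bar> \<le> C * \<bar>s - t\<bar>"
proof -
  have "norm (\<phi> (x + s *\<^sub>R v) - \<phi> (x + t *\<^sub>R v)) \<le> C * norm (s - t)"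
    by (rule field_differentiable_bound[of UNIV _ "\<lambda>t. dir_deriv v \<phi> (x + t *\<^sub>R v)"])
       (use assms in \<open>auto intro: has_field_derivative_at_within C_diff_1_along_line\<close>)
  then show ?thesis by simp
qed

text \<open>All of the regularity is put on the test function, so \<open>f\<close> need not be differentiable in any sense.\<close>

lemma integral_translated_test_derivative:
  fixes f :: "'a::euclidean_space \<Rightarrow> real"
  assumes f: "integrable lebesgue f" and \<phi>: "\<phi> \<in> C_compact 1 UNIV"
  shows "((\<lambda>t. LINT x|lebesgue. f x * \<phi> (x + t *\<^sub>R v)) has_real_derivative
           (LINT x|lebesgue. f x * dir_deriv v \<phi> (x + t *\<^sub>R v))) (at t)"
  unfolding DERIV_def tendsto_at_iff_sequentially
proof (intro allI impI)
  fix X :: "nat \<Rightarrow> real"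
  assume X0: "\<forall>i. X i \<in> UNIV - {0}" and X: "X \<longlonglongrightarrow> 0"
  note [measurable] = C_compact_lebesgue_measurable[OF \<phi>] C_compact_lebesgue_measurable_dir_deriv[OF \<phi>]
  note \<phi>' = C_compact_C_diff[OF \<phi>]
  have [measurable]: "f \<in> borel_measurable lebesgue" using f by auto
  have [measurable]: "(\<lambda>x. \<phi> (x + a)) \<in> borel_measurable lebesgue" for a
    by (rule borel_measurable_lebesgue_translation) measurable
  have [measurable]: "(\<lambda>x. dir_deriv v \<phi> (x + a)) \<in> borel_measurable lebesgue" for a
    by (rule borel_measurable_lebesgue_translation) measurable
  obtain C where C: "\<And>x. \<bar>\<phi> x\<bar> \<le> C"
    by (rule C_compact_bounded[OF \<phi>]) (rule that)
  obtain D where D: "D > 0" "\<And>x. \<bar>dir_deriv v \<phi> x\<bar> \<le> D"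
    by (rule C_compact_bounded_dir_deriv[OF \<phi>, of v]) (rule that)
  have int: "integrable lebesgue (\<lambda>x. f x * \<phi> (x + a))" for a
    by (rule integrable_mult_bounded[OF f _ C]) measurable
  have eq: "((LINT x|lebesgue. f x * \<phi> (x + (t + X i) *\<^sub>R v)) - (LINT x|lebesgue. f x * \<phi> (x + t *\<^sub>R v))) / X i
      = (LINT x|lebesgue. f x * ((\<phi> (x + (t + X i) *\<^sub>R v) - \<phi> (x + t *\<^sub>R v)) / X i))" for i
    by (subst Bochner_Integration.integral_diff[OF int int, symmetric])
       (simp add: right_diff_distrib flip: integral_divide_zero)
  have "(\<lambda>i. LINT x|lebesgue. f x * ((\<phi> (x + (t + X i) *\<^sub>R v) - \<phi> (x + t *\<^sub>R v)) / X i))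
      \<longlonglongrightarrow> (LINT x|lebesgue. f x * dir_deriv v \<phi> (x + t *\<^sub>R v))"
  proof (rule integral_dominated_convergence[where w="\<lambda>x. D * \<bar>f x\<bar>"])
    show "AE x in lebesgue. (\<lambda>i. f x * ((\<phi> (x + (t + X i) *\<^sub>R v) - \<phi> (x + t *\<^sub>R v)) / X i))
        \<longlonglongrightarrow> f x * dir_deriv v \<phi> (x + t *\<^sub>R v)"
    proof (rule AE_I2, intro tendsto_intros)
      fix x
      have "((\<lambda>h. (\<phi> (x + (t + h) *\<^sub>R v) - \<phi> (x + t *\<^sub>R v)) / h) \<longlongrightarrow> dir_deriv v \<phi> (x + t *\<^sub>R v)) (at 0)"
        using C_diff_1_along_line[OF \<phi>', of x v t] unfolding DERIV_def .
      then show "(\<lambda>i. (\<phi> (x + (t + X i) *\<^sub>R v) - \<phi> (x + t *\<^sub>R v)) / X i) \<longlonglongrightarrow> dir_deriv v \<phi> (x + t *\<^sub>R v)"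
        using X X0 unfolding tendsto_at_iff_sequentially o_def by auto
    qed
    show "AE x in lebesgue. norm (f x * ((\<phi> (x + (t + X i) *\<^sub>R v) - \<phi> (x + t *\<^sub>R v)) / X i)) \<le> D * \<bar>f x\<bar>" for i
    proof (rule AE_I2)
      fix x
      have "\<bar>\<phi> (x + (t + X i) *\<^sub>R v) - \<phi> (x + t *\<^sub>R v)\<bar> \<le> D * \<bar>X i\<bar>"
        using C_diff_1_line_lipschitz[OF \<phi>' D(2), of x "t + X i" t] by simp
      then have "\<bar>(\<phi> (x + (t + X i) *\<^sub>R v) - \<phi> (x + t *\<^sub>R v)) / X i\<bar> \<le> D"
        using X0 by (simp add: abs_divide divide_le_eq)
      then have "\<bar>f x\<bar> * \<bar>(\<phi> (x + (t + X i) *\<^sub>R v) - \<phi> (x + t *\<^sub>R v)) / X i\<bar> \<le> \<bar>f x\<bar> * D"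
        by (intro mult_left_mono) auto
      then show "norm (f x * ((\<phi> (x + (t + X i) *\<^sub>R v) - \<phi> (x + t *\<^sub>R v)) / X i)) \<le> D * \<bar>f x\<bar>"
        by (simp add: abs_mult mult.commute)
    qed
  qed (use f in auto)
  then show "((\<lambda>h. ((LINT x|lebesgue. f x * \<phi> (x + (t + h) *\<^sub>R v)) - (LINT x|lebesgue. f x * \<phi> (x + t *\<^sub>R v))) / h) \<circ> X)
      \<longlonglongrightarrow> (LINT x|lebesgue. f x * dir_deriv v \<phi> (x + t *\<^sub>R v))"
    unfolding o_def eq .
qed

lemma C_compact_translate:
  assumes "\<phi> \<in> C_compact 1 UNIV"
  shows "(\<lambda>x. \<phi> (x + a)) \<in> C_compact 1 (UNIV :: 'a::euclidean_space set)"
proof -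
  obtain K where K: "C_diff 1 \<phi>" "compact K" "\<And>x. x \<notin> K \<Longrightarrow> \<phi> x = 0"
    by (rule C_compactE[OF assms]) (rule that)
  have 1: "C_diff 1 (\<lambda>x. \<phi> (x + a))"
    using K(1) by (rule C_diff_1_translate)
  have 2: "compact ((\<lambda>x. - a + x) ` K)"
    using K(2) by (rule compact_translation)
  have 3: "\<phi> (x + a) = 0" if "x \<notin> (\<lambda>x. - a + x) ` K" for x
  proof (rule K(3))
    show "x + a \<notin> K" using that by (force simp: image_iff)
  qed
  show ?thesis using C_compactI[OF 1 2 subset_UNIV 3] .
qed

lemma integral_difference_quotient_shift:
  fixes f \<phi> :: "'a::euclidean_space \<Rightarrow> real"
  assumes f: "integrable lebesgue f"
    and \<phi>: "\<phi> \<in> borel_measurable lebesgue" "\<And>x. \<bar>\<phi> x\<bar> \<le> C"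
  shows "(LINT x|lebesgue. (f (x + a) - f x) / \<delta> * \<phi> x)
       = ((LINT x|lebesgue. f x * \<phi> (x - a)) - (LINT x|lebesgue. f x * \<phi> x)) / \<delta>"
proof -
  have i1: "integrable lebesgue (\<lambda>x. f (x + a) * \<phi> x)"
    by (rule integrable_mult_bounded[OF integrable_lebesgue_translation[OF f] \<phi>])
  have i2: "integrable lebesgue (\<lambda>x. f x * \<phi> x)"
    by (rule integrable_mult_bounded[OF f \<phi>])
  have "(\<lambda>x. \<phi> (x - a)) \<in> borel_measurable lebesgue"
    using borel_measurable_lebesgue_translation[OF \<phi>(1), of "- a"] by simp
  then have "(\<lambda>x. f x * \<phi> (x - a)) \<in> borel_measurable lebesgue" using f by auto
  from integral_lebesgue_translation[OF this, of a]
  have s: "(LINT x|lebesgue. f (x + a) * \<phi> x) = (LINT x|lebesgue. f x * \<phi> (x - a))" by simp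
  have "(LINT x|lebesgue. (f (x + a) - f x) / \<delta> * \<phi> x)
      = (LINT x|lebesgue. (f (x + a) * \<phi> x - f x * \<phi> x) / \<delta>)"
    by (rule arg_cong[where f="integral\<^sup>L lebesgue"]) (simp add: left_diff_distrib)
  also have "\<dots> = ((LINT x|lebesgue. f (x + a) * \<phi> x) - (LINT x|lebesgue. f x * \<phi> x)) / \<delta>"
    by (simp add: Bochner_Integration.integral_diff[OF i1 i2])
  finally show ?thesis by (simp add: s)
qed

text \<open>By duality it suffices to bound the integral against test functions \<open>\<phi>\<close> with values in \<open>[-1, 1]\<close>. A
difference quotient of \<open>f\<close> against \<open>\<phi>\<close> is a difference quotient of the smooth function
\<open>F t = \<integral> f x \<phi> (x + t v) dx\<close>, whose derivative is an integral of \<open>h\<close> against a translate of \<open>\<phi>\<close>. The mean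
value theorem therefore bounds the error by the \<open>L\<^sup>1\<close> distance between \<open>h\<close> and a small translate of \<open>h\<close>,
uniformly in \<open>\<phi>\<close>.\<close>

lemma L1_difference_quotient_tendsto_weak_deriv:
  fixes f h :: "'a::euclidean_space \<Rightarrow> real"
  assumes f: "integrable lebesgue f" and h: "integrable lebesgue h"
    and weak: "\<And>\<phi>. \<phi> \<in> C_compact 1 UNIV \<Longrightarrow>
      (LINT x|lebesgue. f x * dir_deriv v \<phi> x) = - (LINT x|lebesgue. h x * \<phi> x)"
  shows "(\<lambda>n. LINT x|lebesgue. \<bar>(f (x + (1 / real (Suc n)) *\<^sub>R v) - f x) / (1 / real (Suc n)) - h x\<bar>)
    \<longlonglongrightarrow> 0"
proof (rule LIMSEQ_I)
  fix \<epsilon> :: real assume "\<epsilon> > 0"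
  then have \<epsilon>: "\<epsilon> / 2 > 0" by simp
  obtain d where d: "d > 0" "\<And>a. norm a < d \<Longrightarrow> (LINT x|lebesgue. \<bar>h (x + a) - h x\<bar>) < \<epsilon> / 2"
    by (rule L1_continuous_translation[OF h \<epsilon>]) (rule that)
  have "(\<lambda>n. (1 / real (Suc n)) * norm v) \<longlonglongrightarrow> 0 * norm v"
    using LIMSEQ_inverse_real_of_nat by (intro tendsto_intros) (simp add: inverse_eq_divide)
  then have "eventually (\<lambda>n. (1 / real (Suc n)) * norm v < d) sequentially"
    using d(1) by (intro order_tendstoD) auto
  then obtain n0 where n0: "\<And>n. n \<ge> n0 \<Longrightarrow> (1 / real (Suc n)) * norm v < d"
    unfolding eventually_sequentially by blast
  have "norm ((LINT x|lebesgue. \<bar>(f (x + (1 / real (Suc n)) *\<^sub>R v) - f x) / (1 / real (Suc n)) - h x\<bar>) - 0) < \<epsilon>"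
    if n: "n \<ge> n0" for n
  proof -
    define \<delta> where "\<delta> = 1 / real (Suc n)"
    have \<delta>: "\<delta> > 0" "\<delta> * norm v < d" using n0[OF n] by (auto simp: \<delta>_def)
    let ?g = "\<lambda>x. (f (x + \<delta> *\<^sub>R v) - f x) / \<delta> - h x"
    have fi: "integrable lebesgue (\<lambda>x. (f (x + \<delta> *\<^sub>R v) - f x) / \<delta>)"
      by (intro integrable_divide Bochner_Integration.integrable_diff integrable_lebesgue_translation f)
    have "(LINT x|lebesgue. \<bar>?g x\<bar>) \<le> \<epsilon> / 2"
    proof (rule L1_norm_le_by_duality)
      show "integrable lebesgue ?g" by (intro Bochner_Integration.integrable_diff fi h)
    next
      fix \<phi> :: "'a \<Rightarrow> real" assume \<phi>: "\<phi> \<in> C_compact 1 UNIV" "\<And>x. \<bar>\<phi> x\<bar> \<le> 1"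
      note m = C_compact_lebesgue_measurable[OF \<phi>(1)]
      define F where "F = (\<lambda>t. LINT x|lebesgue. f x * \<phi> (x + t *\<^sub>R v))"
      have F: "(F has_real_derivative - (LINT x|lebesgue. h x * \<phi> (x + t *\<^sub>R v))) (at t)" for t
      proof -
        have "(LINT x|lebesgue. f x * dir_deriv v \<phi> (x + t *\<^sub>R v)) = - (LINT x|lebesgue. h x * \<phi> (x + t *\<^sub>R v))"
          using weak[OF C_compact_translate[OF \<phi>(1), of "t *\<^sub>R v"]]
          by (simp add: C_diff_1_translate(2)[OF C_compact_C_diff[OF \<phi>(1)]])
        then show ?thesis
          unfolding F_def using integral_translated_test_derivative[OF f \<phi>(1), of v t] by simp
      qed
      have "\<exists>\<xi>. - \<delta> < \<xi> \<and> \<xi> < 0 \<and> F 0 - F (- \<delta>) = (0 - (- \<delta>)) * (- (LINT x|lebesgue. h x * \<phi> (x + \<xi> *\<^sub>R v)))"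
        by (rule MVT2) (use \<delta> F in auto)
      then obtain \<xi> where \<xi>: "- \<delta> < \<xi>" "\<xi> < 0" "F (- \<delta>) - F 0 = \<delta> * (LINT x|lebesgue. h x * \<phi> (x + \<xi> *\<^sub>R v))"
        by (auto simp: algebra_simps)
      have mt: "(\<lambda>x. \<phi> (x + \<xi> *\<^sub>R v)) \<in> borel_measurable lebesgue"
        using m by (rule borel_measurable_lebesgue_translation)
      have i1: "integrable lebesgue (\<lambda>x. h x * \<phi> (x + \<xi> *\<^sub>R v))"
        by (rule integrable_mult_bounded[OF h mt, of 1]) (rule \<phi>)
      have i2: "integrable lebesgue (\<lambda>x. h x * \<phi> x)"
        by (rule integrable_mult_bounded[OF h m \<phi>(2)])
      have i3: "integrable lebesgue (\<lambda>x. h (x + (- \<xi>) *\<^sub>R v) * \<phi> x)"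
        by (rule integrable_mult_bounded[OF integrable_lebesgue_translation[OF h] m \<phi>(2)])
      have "(LINT x|lebesgue. h x * \<phi> (x + \<xi> *\<^sub>R v)) = (LINT x|lebesgue. h (x + (- \<xi>) *\<^sub>R v) * \<phi> x)"
        using integral_lebesgue_translation[OF borel_measurable_integrable[OF i1], of "(- \<xi>) *\<^sub>R v"] by simp
      moreover have "(LINT x|lebesgue. ?g x * \<phi> x)
          = (LINT x|lebesgue. (f (x + \<delta> *\<^sub>R v) - f x) / \<delta> * \<phi> x) - (LINT x|lebesgue. h x * \<phi> x)"
        by (subst Bochner_Integration.integral_diff[OF integrable_mult_bounded[OF fi m \<phi>(2)] i2, symmetric])
           (simp add: left_diff_distrib)
      moreover have "(LINT x|lebesgue. (f (x + \<delta> *\<^sub>R v) - f x) / \<delta> * \<phi> x) = (F (- \<delta>) - F 0) / \<delta>"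
        unfolding F_def using integral_difference_quotient_shift[OF f m \<phi>(2), of "\<delta> *\<^sub>R v" \<delta>] by simp
      ultimately have "(LINT x|lebesgue. ?g x * \<phi> x)
          = (LINT x|lebesgue. h (x + (- \<xi>) *\<^sub>R v) * \<phi> x) - (LINT x|lebesgue. h x * \<phi> x)"
        using \<xi>(3) \<delta>(1) by simp
      also have "\<dots> = (LINT x|lebesgue. (h (x + (- \<xi>) *\<^sub>R v) - h x) * \<phi> x)"
        by (subst Bochner_Integration.integral_diff[OF i3 i2, symmetric]) (simp add: left_diff_distrib)
      also have "\<dots> \<le> (LINT x|lebesgue. \<bar>h (x + (- \<xi>) *\<^sub>R v) - h x\<bar>)"
      proof (rule integral_mono)
        show "integrable lebesgue (\<lambda>x. (h (x + (- \<xi>) *\<^sub>R v) - h x) * \<phi> x)"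
          by (rule integrable_mult_bounded[OF _ m \<phi>(2)])
             (intro Bochner_Integration.integrable_diff integrable_lebesgue_translation h)
        show "integrable lebesgue (\<lambda>x. \<bar>h (x + (- \<xi>) *\<^sub>R v) - h x\<bar>)"
          by (intro integrable_abs Bochner_Integration.integrable_diff integrable_lebesgue_translation h)
        fix x
        have "\<bar>h (x + (- \<xi>) *\<^sub>R v) - h x\<bar> * \<bar>\<phi> x\<bar> \<le> \<bar>h (x + (- \<xi>) *\<^sub>R v) - h x\<bar>"
          using \<phi>(2) by (intro mult_left_le) auto
        then show "(h (x + (- \<xi>) *\<^sub>R v) - h x) * \<phi> x \<le> \<bar>h (x + (- \<xi>) *\<^sub>R v) - h x\<bar>"
          unfolding abs_mult[symmetric] by linarith
      qed
      also have "\<dots> \<le> \<epsilon> / 2"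
      proof (rule less_imp_le, rule d(2))
        have "norm ((- \<xi>) *\<^sub>R v) \<le> \<delta> * norm v"
          using \<xi> mult_right_mono[of "- \<xi>" \<delta> "norm v"] by simp
        then show "norm ((- \<xi>) *\<^sub>R v) < d" using \<delta>(2) by linarith
      qed
      finally show "(LINT x|lebesgue. ?g x * \<phi> x) \<le> \<epsilon> / 2" .
    qed
    moreover have "(LINT x|lebesgue. \<bar>?g x\<bar>) \<ge> 0" by simp
    ultimately show ?thesis unfolding \<delta>_def using \<open>\<epsilon> > 0\<close> by simp
  qed
  then show "\<exists>no. \<forall>n\<ge>no. norm ((LINT x|lebesgue. \<bar>(f (x + (1 / real (Suc n)) *\<^sub>R v) - f x) / (1 / real (Suc n)) - h x\<bar>) - 0) < \<epsilon>"
    by blast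
qed

text \<open>The bound linear in \<open>t - s\<close> serves as a dominating function, the quadratic one makes the error vanish in
the limit.\<close>

lemma renormalization_linearization_error:
  assumes "renormalization B b" "\<And>s. \<bar>b s\<bar> \<le> M" "C-lipschitz_on UNIV b"
  shows "\<bar>B t - B s - b s * (t - s)\<bar> \<le> min (2 * M) (C * \<bar>t - s\<bar>) * \<bar>t - s\<bar>"
proof -
  have B: "(B has_real_derivative b r) (at r)" for r
    using assms(1) by (auto simp: renormalization_def)
  have "\<exists>\<xi>. \<bar>\<xi> - s\<bar> \<le> \<bar>t - s\<bar> \<and> B t - B s = b \<xi> * (t - s)"
  proof (cases s t rule: linorder_cases)
    case less
    obtain \<xi> where "s < \<xi>" "\<xi> < t" "B t - B s = (t - s) * b \<xi>"
      using MVT2[OF less, of B b] B by blast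
    then show ?thesis by (intro exI[of _ \<xi>]) auto
  next
    case greater
    obtain \<xi> where "t < \<xi>" "\<xi> < s" "B s - B t = (s - t) * b \<xi>"
      using MVT2[OF greater, of B b] B by blast
    then show ?thesis by (intro exI[of _ \<xi>]) (auto simp: algebra_simps)
  qed auto
  then obtain \<xi> where \<xi>: "\<bar>\<xi> - s\<bar> \<le> \<bar>t - s\<bar>" "B t - B s = b \<xi> * (t - s)" by blast
  have C: "C \<ge> 0" using assms(3) by (rule lipschitz_on_nonneg)
  have "\<bar>b \<xi> - b s\<bar> \<le> C * \<bar>\<xi> - s\<bar>"
    using lipschitz_onD[OF assms(3), of \<xi> s] by (simp add: dist_real_def)
  also have "\<dots> \<le> C * \<bar>t - s\<bar>" using \<xi>(1) C by (intro mult_left_mono)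
  finally have "\<bar>b \<xi> - b s\<bar> \<le> min (2 * M) (C * \<bar>t - s\<bar>)"
    using assms(2)[of \<xi>] assms(2)[of s] by auto
  then have "\<bar>b \<xi> - b s\<bar> * \<bar>t - s\<bar> \<le> min (2 * M) (C * \<bar>t - s\<bar>) * \<bar>t - s\<bar>"
    by (intro mult_right_mono) auto
  moreover have "B t - B s - b s * (t - s) = (b \<xi> - b s) * (t - s)"
    unfolding \<xi>(2) by (simp add: algebra_simps)
  ultimately show ?thesis by (simp add: abs_mult)
qed

lemma renormalization_measurable:
  assumes "renormalization B b"
  shows "B \<in> borel_measurable borel" "b \<in> borel_measurable borel"
proof -
  have "continuous_on UNIV B"
    using assms unfolding renormalization_def
    by (meson DERIV_isCont continuous_at_imp_continuous_on)
  then show "B \<in> borel_measurable borel" by (rule borel_measurable_continuous_onI)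
  have "continuous_on UNIV b"
    using assms unfolding renormalization_def by (meson lipschitz_on_continuous_on)
  then show "b \<in> borel_measurable borel" by (rule borel_measurable_continuous_onI)
qed

lemma renormalization_abs_le:
  assumes "renormalization B b" "B 0 = 0" "\<And>s. \<bar>b s\<bar> \<le> M"
  shows "\<bar>B s\<bar> \<le> M * \<bar>s\<bar>"
proof -
  have "norm (B s - B 0) \<le> M * norm (s - 0)"
    by (rule field_differentiable_bound[of UNIV _ b])
       (use assms in \<open>auto simp: renormalization_def intro: has_field_derivative_at_within\<close>)
  then show ?thesis using assms(2) by simp
qed

text \<open>The difference quotients \<open>D\<close> of \<open>f\<close> tend to \<open>h\<close> in \<open>L\<^sup>1\<close>, and along a subsequence almost everywhere. Those
of \<open>B (f)\<close>, called \<open>Q\<close>, differ from \<open>b (f) h\<close> by at most \<open>3 M \<bar>D - h\<bar> + E\<close>, where \<open>E\<close> is dominated by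
a multiple of \<open>\<bar>h\<bar>\<close> and tends to zero along the subsequence. So \<open>Q\<close> tends to \<open>b (f) h\<close> in \<open>L\<^sup>1\<close>, while
shifting the difference quotient to the test function shows that the integrals of \<open>Q\<close> against it tend to
minus the integral of \<open>B (f)\<close> against its derivative.

The normalization \<open>B 0 = 0\<close> makes \<open>B (f)\<close> integrable.\<close>

lemma chain_rule_whole_space:
  fixes f h :: "'a::euclidean_space \<Rightarrow> real"
  assumes f: "integrable lebesgue f" and h: "integrable lebesgue h"
    and weak: "\<And>\<phi>. \<phi> \<in> C_compact 1 UNIV \<Longrightarrow>
      (LINT x|lebesgue. f x * dir_deriv v \<phi> x) = - (LINT x|lebesgue. h x * \<phi> x)"
    and B: "renormalization B b" "B 0 = 0"
    and \<phi>: "\<phi> \<in> C_compact 1 UNIV"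
  shows "(LINT x|lebesgue. B (f x) * dir_deriv v \<phi> x) = - (LINT x|lebesgue. b (f x) * h x * \<phi> x)"
proof -
  obtain M where M: "\<And>s. \<bar>b s\<bar> \<le> M"
    using B(1) by (auto simp: renormalization_def bounded_iff)
  obtain C where C: "C-lipschitz_on UNIV b"
    using B(1) by (auto simp: renormalization_def)
  have C0: "C \<ge> 0" using C by (rule lipschitz_on_nonneg)
  have M0: "M \<ge> 0" using M[of 0] by linarith
  note [measurable] = renormalization_measurable[OF B(1)] C_compact_lebesgue_measurable[OF \<phi>]
  have [measurable]: "f \<in> borel_measurable lebesgue" "h \<in> borel_measurable lebesgue"
    using f h by auto
  have Bf: "integrable lebesgue (\<lambda>x. B (f x))"
  proof (rule Bochner_Integration.integrable_bound)
    show "integrable lebesgue (\<lambda>x. M * f x)" using f by simp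
    show "AE x in lebesgue. norm (B (f x)) \<le> norm (M * f x)"
      using renormalization_abs_le[OF B M] M0 by (intro AE_I2) (simp add: abs_mult)
  qed measurable
  obtain K where K: "K > 0" "\<And>x. \<bar>\<phi> x\<bar> \<le> K"
    by (rule C_compact_bounded[OF \<phi>]) (rule that)
  define \<delta> where "\<delta> = (\<lambda>n. 1 / real (Suc n))"
  have \<delta>: "\<delta> n > 0" for n by (simp add: \<delta>_def)
  have \<delta>_lim: "\<delta> \<longlonglongrightarrow> 0"
    unfolding \<delta>_def using LIMSEQ_inverse_real_of_nat by (simp add: inverse_eq_divide)
  define D where "D = (\<lambda>n x. (f (x + \<delta> n *\<^sub>R v) - f x) / \<delta> n)"
  have D_int: "integrable lebesgue (D n)" for n
    unfolding D_def
    by (intro integrable_divide Bochner_Integration.integrable_diff integrable_lebesgue_translation f)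
  then have [measurable]: "D n \<in> borel_measurable lebesgue" for n by auto
  have D_lim: "(\<lambda>n. LINT x|lebesgue. \<bar>D n x - h x\<bar>) \<longlonglongrightarrow> 0"
    unfolding D_def \<delta>_def by (rule L1_difference_quotient_tendsto_weak_deriv[OF f h weak])
  have "\<exists>r::nat\<Rightarrow>nat. strict_mono r \<and> (AE x in lebesgue. (\<lambda>n. D (r n) x - h x) \<longlonglongrightarrow> 0)"
    by (rule tendsto_L1_AE_subseq) (use D_int h D_lim in auto)
  then obtain r :: "nat \<Rightarrow> nat" where r: "strict_mono r"
    "AE x in lebesgue. (\<lambda>n. D (r n) x - h x) \<longlonglongrightarrow> 0" by blast
  define Q where "Q = (\<lambda>n x. (B (f (x + \<delta> n *\<^sub>R v)) - B (f x)) / \<delta> n)"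
  define E where "E = (\<lambda>n x. min (2 * M) (C * \<bar>\<delta> n * D n x\<bar>) * \<bar>h x\<bar>)"
  have Q_int: "integrable lebesgue (Q n)" for n
    unfolding Q_def using integrable_lebesgue_translation[OF Bf]
    by (intro integrable_divide Bochner_Integration.integrable_diff Bf)
  then have [measurable]: "Q n \<in> borel_measurable lebesgue" for n by auto
  have bh_int: "integrable lebesgue (\<lambda>x. b (f x) * h x)"
    using integrable_mult_bounded[OF h, of "\<lambda>x. b (f x)" M] M by (simp add: mult.commute)
  have E_bounds: "0 \<le> E n x" "E n x \<le> 2 * M * \<bar>h x\<bar>" for n x
    unfolding E_def using M0 C0 by (auto intro!: mult_right_mono)
  have E_int: "integrable lebesgue (E n)" for n
  proof (rule Bochner_Integration.integrable_bound)
    show "integrable lebesgue (\<lambda>x. 2 * M * \<bar>h x\<bar>)" using h by simp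
    show "E n \<in> borel_measurable lebesgue" unfolding E_def by measurable
    show "AE x in lebesgue. norm (E n x) \<le> norm (2 * M * \<bar>h x\<bar>)"
    proof (rule AE_I2)
      fix x show "norm (E n x) \<le> norm (2 * M * \<bar>h x\<bar>)" using E_bounds[where n=n and x=x] by simp
    qed
  qed
  then have [measurable]: "E n \<in> borel_measurable lebesgue" for n by auto
  have E_lim: "(\<lambda>n. LINT x|lebesgue. E (r n) x) \<longlonglongrightarrow> (LINT x|(lebesgue :: 'a measure). 0)"
  proof (rule integral_dominated_convergence[where w="\<lambda>x. 2 * M * \<bar>h x\<bar>"])
    show "AE x in lebesgue. (\<lambda>n. E (r n) x) \<longlonglongrightarrow> 0"
      using r(2)
    proof eventually_elim
      case (elim x)
      have "(\<lambda>n. \<delta> (r n)) \<longlonglongrightarrow> 0"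
        using LIMSEQ_subseq_LIMSEQ[OF \<delta>_lim r(1)] by (simp add: o_def)
      then have "(\<lambda>n. min (2 * M) (C * \<bar>\<delta> (r n) * ((D (r n) x - h x) + h x)\<bar>) * \<bar>h x\<bar>)
          \<longlonglongrightarrow> min (2 * M) (C * \<bar>0 * (0 + h x)\<bar>) * \<bar>h x\<bar>"
        by (intro tendsto_intros elim)
      then show ?case using M0 by (simp add: E_def)
    qed
    show "AE x in lebesgue. norm (E (r n) x) \<le> 2 * M * \<bar>h x\<bar>" for n
    proof (rule AE_I2)
      fix x show "norm (E (r n) x) \<le> 2 * M * \<bar>h x\<bar>" using E_bounds[where n="r n" and x=x] by simp
    qed
  qed (use h in auto)
  \<comment> \<open>Replace \<open>Q\<close> by \<open>b (f) D\<close> up to the linearization error, and then \<open>D\<close> by \<open>h\<close>.\<close>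
  have Q_error: "\<bar>Q n x - b (f x) * h x\<bar> \<le> 3 * M * \<bar>D n x - h x\<bar> + E n x" for n x
  proof -
    define \<Delta> where "\<Delta> = f (x + \<delta> n *\<^sub>R v) - f x"
    define m where "m = min (2 * M) (C * \<bar>\<Delta>\<bar>)"
    have m: "0 \<le> m" "m \<le> 2 * M" using M0 C0 by (auto simp: m_def)
    have \<Delta>: "\<Delta> = \<delta> n * D n x" using \<delta>[of n] by (simp add: \<Delta>_def D_def)
    have "\<bar>B (f (x + \<delta> n *\<^sub>R v)) - B (f x) - b (f x) * \<Delta>\<bar> \<le> m * \<bar>\<Delta>\<bar>"
      unfolding \<Delta>_def m_def by (rule renormalization_linearization_error[OF B(1) M C])
    then have "\<bar>B (f (x + \<delta> n *\<^sub>R v)) - B (f x) - b (f x) * \<Delta>\<bar> / \<delta> n \<le> m * \<bar>\<Delta>\<bar> / \<delta> n"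
      using \<delta>[of n] by (intro divide_right_mono) auto
    moreover have "\<bar>B (f (x + \<delta> n *\<^sub>R v)) - B (f x) - b (f x) * \<Delta>\<bar> / \<delta> n = \<bar>Q n x - b (f x) * D n x\<bar>"
    proof -
      have "B (f (x + \<delta> n *\<^sub>R v)) - B (f x) - b (f x) * \<Delta> = \<delta> n * (Q n x - b (f x) * D n x)"
        using \<delta>[of n] unfolding Q_def \<Delta> by (simp add: field_simps)
      then show ?thesis using \<delta>[of n] by (simp add: abs_mult)
    qed
    moreover have "m * \<bar>\<Delta>\<bar> / \<delta> n = m * \<bar>D n x\<bar>"
      using \<delta>[of n] unfolding \<Delta> by (simp add: abs_mult)
    ultimately have 1: "\<bar>Q n x - b (f x) * D n x\<bar> \<le> m * \<bar>D n x\<bar>" by simp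
    have "m * \<bar>D n x\<bar> \<le> m * (\<bar>D n x - h x\<bar> + \<bar>h x\<bar>)"
      using m by (intro mult_left_mono) auto
    moreover have "m * \<bar>D n x - h x\<bar> \<le> 2 * M * \<bar>D n x - h x\<bar>"
      using m by (intro mult_right_mono) auto
    moreover have "m * \<bar>h x\<bar> = E n x" by (simp add: m_def E_def \<Delta>)
    ultimately have 2: "m * \<bar>D n x\<bar> \<le> 2 * M * \<bar>D n x - h x\<bar> + E n x"
      by (simp add: distrib_left)
    have 3: "\<bar>b (f x) * D n x - b (f x) * h x\<bar> \<le> M * \<bar>D n x - h x\<bar>"
      using M[of "f x"] by (simp add: abs_mult mult_right_mono flip: right_diff_distrib)
    show ?thesis using 1 2 3 by linarith
  qed
  have QR_lim: "(\<lambda>n. LINT x|lebesgue. \<bar>Q (r n) x - b (f x) * h x\<bar>) \<longlonglongrightarrow> 0"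
  proof (rule tendsto_sandwich[where f="\<lambda>n. 0"])
    show "\<forall>\<^sub>F n in sequentially. 0 \<le> (LINT x|lebesgue. \<bar>Q (r n) x - b (f x) * h x\<bar>)" by simp
    have "(LINT x|lebesgue. \<bar>Q n x - b (f x) * h x\<bar>)
        \<le> 3 * M * (LINT x|lebesgue. \<bar>D n x - h x\<bar>) + (LINT x|lebesgue. E n x)" for n
    proof -
      have i: "integrable lebesgue (\<lambda>x. 3 * M * \<bar>D n x - h x\<bar>)" using D_int h by simp
      have "(LINT x|lebesgue. \<bar>Q n x - b (f x) * h x\<bar>) \<le> (LINT x|lebesgue. 3 * M * \<bar>D n x - h x\<bar> + E n x)"
        by (intro integral_mono integrable_abs Bochner_Integration.integrable_diff Q_int bh_int
            Bochner_Integration.integrable_add i E_int Q_error)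
      also have "\<dots> = 3 * M * (LINT x|lebesgue. \<bar>D n x - h x\<bar>) + (LINT x|lebesgue. E n x)"
        by (subst Bochner_Integration.integral_add[OF i E_int]) simp
      finally show ?thesis .
    qed
    then show "\<forall>\<^sub>F n in sequentially. (LINT x|lebesgue. \<bar>Q (r n) x - b (f x) * h x\<bar>)
        \<le> 3 * M * (LINT x|lebesgue. \<bar>D (r n) x - h x\<bar>) + (LINT x|lebesgue. E (r n) x)" by simp
    have "(\<lambda>n. 3 * M * (LINT x|lebesgue. \<bar>D (r n) x - h x\<bar>) + (LINT x|lebesgue. E (r n) x))
        \<longlonglongrightarrow> 3 * M * 0 + (LINT x|(lebesgue :: 'a measure). 0)"
      using LIMSEQ_subseq_LIMSEQ[OF D_lim r(1)] by (intro tendsto_intros E_lim) (simp add: o_def)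
    then show "(\<lambda>n. 3 * M * (LINT x|lebesgue. \<bar>D (r n) x - h x\<bar>) + (LINT x|lebesgue. E (r n) x)) \<longlonglongrightarrow> 0"
      by simp
  qed simp
  have Q\<phi>: "integrable lebesgue (\<lambda>x. Q n x * \<phi> x)" for n
    by (rule integrable_mult_bounded[OF Q_int _ K(2)]) measurable
  have bh\<phi>: "integrable lebesgue (\<lambda>x. b (f x) * h x * \<phi> x)"
    by (rule integrable_mult_bounded[OF bh_int _ K(2)]) measurable
  have lim1: "(\<lambda>n. LINT x|lebesgue. Q (r n) x * \<phi> x) \<longlonglongrightarrow> (LINT x|lebesgue. b (f x) * h x * \<phi> x)"
  proof (rule LIM_zero_cancel, rule Lim_null_comparison)
    show "(\<lambda>n. K * (LINT x|lebesgue. \<bar>Q (r n) x - b (f x) * h x\<bar>)) \<longlonglongrightarrow> 0"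
      using tendsto_mult_left[OF QR_lim, of K] by simp
    have "norm ((LINT x|lebesgue. Q n x * \<phi> x) - (LINT x|lebesgue. b (f x) * h x * \<phi> x))
        \<le> K * (LINT x|lebesgue. \<bar>Q n x - b (f x) * h x\<bar>)" for n
    proof -
      have i: "integrable lebesgue (\<lambda>x. Q n x - b (f x) * h x)"
        by (intro Bochner_Integration.integrable_diff Q_int bh_int)
      have "norm ((LINT x|lebesgue. Q n x * \<phi> x) - (LINT x|lebesgue. b (f x) * h x * \<phi> x))
          = norm (LINT x|lebesgue. (Q n x - b (f x) * h x) * \<phi> x)"
        by (subst Bochner_Integration.integral_diff[OF Q\<phi> bh\<phi>, symmetric]) (simp add: left_diff_distrib)
      also have "\<dots> \<le> (LINT x|lebesgue. K * \<bar>Q n x - b (f x) * h x\<bar>)"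
      proof (rule Bochner_Integration.integral_norm_bound_integral)
        show "integrable lebesgue (\<lambda>x. (Q n x - b (f x) * h x) * \<phi> x)"
          by (rule integrable_mult_bounded[OF i _ K(2)]) measurable
        show "integrable lebesgue (\<lambda>x. K * \<bar>Q n x - b (f x) * h x\<bar>)" using i by simp
        show "norm ((Q n x - b (f x) * h x) * \<phi> x) \<le> K * \<bar>Q n x - b (f x) * h x\<bar>" for x
          using mult_left_mono[OF K(2), of "\<bar>Q n x - b (f x) * h x\<bar>" x] by (simp add: abs_mult mult.commute)
      qed
      finally show ?thesis by simp
    qed
    then show "\<forall>\<^sub>F n in sequentially.
        norm ((LINT x|lebesgue. Q (r n) x * \<phi> x) - (LINT x|lebesgue. b (f x) * h x * \<phi> x))
        \<le> K * (LINT x|lebesgue. \<bar>Q (r n) x - b (f x) * h x\<bar>)" by simp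
  qed
  have "(\<lambda>n. LINT x|lebesgue. Q n x * \<phi> x) \<longlonglongrightarrow> - (LINT x|lebesgue. B (f x) * dir_deriv v \<phi> x)"
  proof -
    let ?F = "\<lambda>t. LINT x|lebesgue. B (f x) * \<phi> (x + t *\<^sub>R v)"
    have "((\<lambda>t. (?F (0 + t) - ?F 0) / t) \<longlongrightarrow> (LINT x|lebesgue. B (f x) * dir_deriv v \<phi> x)) (at 0)"
      using integral_translated_test_derivative[OF Bf \<phi>, of v 0] unfolding DERIV_def by simp
    moreover have "(\<lambda>n. - \<delta> n) \<longlonglongrightarrow> 0" using tendsto_minus[OF \<delta>_lim] by simp
    ultimately have "(\<lambda>n. (?F (0 + - \<delta> n) - ?F 0) / (- \<delta> n)) \<longlonglongrightarrow> (LINT x|lebesgue. B (f x) * dir_deriv v \<phi> x)"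
    proof -
      assume *: "((\<lambda>t. (?F (0 + t) - ?F 0) / t) \<longlongrightarrow> (LINT x|lebesgue. B (f x) * dir_deriv v \<phi> x)) (at 0)"
        and lim: "(\<lambda>n. - \<delta> n) \<longlonglongrightarrow> 0"
      have "\<forall>\<^sub>F n in sequentially. - \<delta> n \<noteq> 0"
        using \<delta> by (intro always_eventually allI) (simp add: less_imp_neq[symmetric])
      then have "filterlim (\<lambda>n. - \<delta> n) (at 0) sequentially"
        using lim by (simp add: filterlim_at)
      from filterlim_compose[OF * this] show ?thesis .
    qed
    then have "(\<lambda>n. - ((?F (0 + - \<delta> n) - ?F 0) / (- \<delta> n))) \<longlonglongrightarrow> - (LINT x|lebesgue. B (f x) * dir_deriv v \<phi> x)"
      by (rule tendsto_minus)
    moreover have "(LINT x|lebesgue. Q n x * \<phi> x) = - ((?F (0 + - \<delta> n) - ?F 0) / (- \<delta> n))" for n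
      unfolding Q_def
      using integral_difference_quotient_shift[OF Bf C_compact_lebesgue_measurable[OF \<phi>] K(2), of "\<delta> n *\<^sub>R v" "\<delta> n"]
      by simp
    ultimately show ?thesis by simp
  qed
  from LIMSEQ_subseq_LIMSEQ[OF this r(1)]
  have lim2: "(\<lambda>n. LINT x|lebesgue. Q (r n) x * \<phi> x) \<longlonglongrightarrow> - (LINT x|lebesgue. B (f x) * dir_deriv v \<phi> x)"
    by (simp add: o_def)
  show ?thesis using LIMSEQ_unique[OF lim1 lim2] by simp
qed

lemma dir_deriv_eq_0_at_max:
  assumes "C_diff 1 \<theta>" "\<And>y. \<theta> y \<le> \<theta> x"
  shows "dir_deriv v \<theta> x = 0"
proof -
  have "(\<lambda>j. dir_deriv j \<theta> x) = (\<lambda>j. 0)"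
    by (rule differential_zero_maxmin[OF _ open_UNIV C_diff_1_has_derivative[OF assms(1)]])
       (use assms(2) in auto)
  then show ?thesis by meson
qed

lemma has_weak_derivD:
  assumes "open U" "has_weak_deriv U v f h" "\<phi> \<in> C_compact 1 U"
  shows "(LINT x|lebesgue. f x * dir_deriv v \<phi> x) = - (LINT x|lebesgue. h x * \<phi> x)"
  using assms(2,3) integral_test_lebesgue_on[OF assms(1,3)] unfolding has_weak_deriv_def by auto

text \<open>Here \<open>\<psi>\<close> may be any C^1 function on the whole space, since \<open>\<theta> \<psi>\<close> is a test function on \<open>U\<close>. With
\<open>\<psi>\<close> supported anywhere this says that \<open>f \<theta>\<close>, extended by zero, has a weak derivative on the whole space.\<close>

lemma weak_product_rule_integral:
  fixes f h :: "'a::euclidean_space \<Rightarrow> real"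
  assumes U: "open U" and fh: "has_weak_deriv U v f h"
    and \<theta>: "\<theta> \<in> C_compact 1 U" and \<psi>: "C_diff 1 \<psi>"
  shows "(LINT x|lebesgue. (f x * \<theta> x) * dir_deriv v \<psi> x)
      = - (LINT x|lebesgue. (h x * \<theta> x + f x * dir_deriv v \<theta> x) * \<psi> x)"
proof -
  have f: "loc_integrable U f" and h: "loc_integrable U h"
    using fh by (auto simp: has_weak_deriv_def)
  obtain K where K: "C_diff 1 \<theta>" "compact K" "K \<subseteq> U" "\<And>x. x \<notin> K \<Longrightarrow> \<theta> x = 0"
    "\<And>x j. x \<notin> K \<Longrightarrow> dir_deriv j \<theta> x = 0"
    by (rule C_compactE[OF \<theta>]) (rule that)
  note cont = C_diff_1_continuous C_diff_1_continuous_dir_deriv K(1) \<psi> continuous_on_mult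
  have i1: "integrable lebesgue (\<lambda>x. f x * (\<theta> x * dir_deriv v \<psi> x))"
    by (rule loc_integrable_times_continuous[OF f K(2,3)]) (intro cont, simp add: K)
  have i2: "integrable lebesgue (\<lambda>x. f x * (dir_deriv v \<theta> x * \<psi> x))"
    by (rule loc_integrable_times_continuous[OF f K(2,3)]) (intro cont, simp add: K)
  have i3: "integrable lebesgue (\<lambda>x. h x * (\<theta> x * \<psi> x))"
    by (rule loc_integrable_times_continuous[OF h K(2,3)]) (intro cont, simp add: K)
  have "(LINT x|lebesgue. f x * (\<theta> x * dir_deriv v \<psi> x)) + (LINT x|lebesgue. f x * (dir_deriv v \<theta> x * \<psi> x))
      = (LINT x|lebesgue. f x * dir_deriv v (\<lambda>x. \<theta> x * \<psi> x) x)"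
    by (subst Bochner_Integration.integral_add[OF i1 i2, symmetric])
       (simp add: C_diff_1_mult(2)[OF K(1) \<psi>] distrib_left)
  also have "\<dots> = - (LINT x|lebesgue. h x * (\<theta> x * \<psi> x))"
    by (rule has_weak_derivD[OF U fh C_compact_mult_right[OF \<theta> \<psi>]])
  finally show ?thesis
    using Bochner_Integration.integral_add[OF i3 i2] by (simp add: distrib_right mult.assoc)
qed

text \<open>The test function \<open>\<phi>\<close> only sees \<open>f\<close> on its support, where the cutoff \<open>\<theta>\<close> equals \<open>1\<close> and, being maximal
there, has zero derivative. So \<open>f\<close> and \<open>h\<close> may be replaced by \<open>f \<theta>\<close> and its weak derivative, which are
integrable on the whole space.\<close>

lemma has_weak_deriv_chain:
  fixes f h :: "'a::euclidean_space \<Rightarrow> real"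
  assumes U: "open U" and fh: "has_weak_deriv U v f h"
    and B: "renormalization B b" "B 0 = 0"
  shows "has_weak_deriv U v (\<lambda>x. B (f x)) (\<lambda>x. b (f x) * h x)"
proof -
  have f: "loc_integrable U f" and h: "loc_integrable U h"
    using fh by (auto simp: has_weak_deriv_def)
  obtain M where M: "\<And>s. \<bar>b s\<bar> \<le> M"
    using B(1) by (auto simp: renormalization_def bounded_iff)
  have M0: "M \<ge> 0" using M[of 0] by linarith
  note [measurable] = renormalization_measurable[OF B(1)]
  have "loc_integrable U (\<lambda>x. B (f x))"
    unfolding loc_integrable_def
  proof (intro allI impI)
    fix K assume K: "compact K \<and> K \<subseteq> U"
    then have i: "integrable (lebesgue_on K) f" using f by (auto simp: loc_integrable_def)
    then have [measurable]: "f \<in> borel_measurable (lebesgue_on K)" by auto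
    show "integrable (lebesgue_on K) (\<lambda>x. B (f x))"
    proof (rule Bochner_Integration.integrable_bound)
      show "integrable (lebesgue_on K) (\<lambda>x. M * f x)" using i by simp
      show "AE x in lebesgue_on K. norm (B (f x)) \<le> norm (M * f x)"
        using renormalization_abs_le[OF B M] M0 by (intro AE_I2) (simp add: abs_mult)
    qed measurable
  qed
  moreover have "loc_integrable U (\<lambda>x. b (f x) * h x)"
    unfolding loc_integrable_def
  proof (intro allI impI)
    fix K assume K: "compact K \<and> K \<subseteq> U"
    then have i: "integrable (lebesgue_on K) f" "integrable (lebesgue_on K) h"
      using f h by (auto simp: loc_integrable_def)
    then have [measurable]: "f \<in> borel_measurable (lebesgue_on K)" by auto
    have "integrable (lebesgue_on K) (\<lambda>x. h x * b (f x))"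
      by (rule integrable_mult_bounded[OF i(2) _ M]) measurable
    then show "integrable (lebesgue_on K) (\<lambda>x. b (f x) * h x)" by (simp add: mult.commute)
  qed
  moreover have "(LINT x|lebesgue_on U. B (f x) * dir_deriv v \<phi> x)
      = - (LINT x|lebesgue_on U. b (f x) * h x * \<phi> x)" if \<phi>: "\<phi> \<in> C_compact 1 U" for \<phi>
  proof -
    obtain K where K: "compact K" "K \<subseteq> U" "\<And>x. x \<notin> K \<Longrightarrow> \<phi> x = 0" "\<And>x j. x \<notin> K \<Longrightarrow> dir_deriv j \<phi> x = 0"
      by (rule C_compactE[OF \<phi>]) (rule that)
    obtain \<theta> where \<theta>: "\<theta> \<in> C_compact 1 U" "\<And>x. \<theta> x \<le> 1" "\<And>x. x \<in> K \<Longrightarrow> \<theta> x = 1"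
      by (rule C_compact_cutoff[OF K(1,2) U]) (rule that)
    note \<theta>' = C_compact_C_diff[OF \<theta>(1)]
    have \<theta>0: "dir_deriv v \<theta> x = 0" if "x \<in> K" for x
      using dir_deriv_eq_0_at_max[OF \<theta>'] \<theta>(2) \<theta>(3)[OF that] by simp
    \<comment> \<open>The cutoff makes the function and its weak derivative integrable on the whole space.\<close>
    have f\<theta>: "integrable lebesgue (\<lambda>x. f x * \<theta> x)" "integrable lebesgue (\<lambda>x. f x * dir_deriv v \<theta> x)"
      using loc_integrable_times_test[OF f \<theta>(1)] .
    have h\<theta>: "integrable lebesgue (\<lambda>x. h x * \<theta> x)"
      using loc_integrable_times_test[OF h \<theta>(1)] by blast
    have "(LINT x|lebesgue. (f x * \<theta> x) * dir_deriv v \<psi> x)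
        = - (LINT x|lebesgue. (h x * \<theta> x + f x * dir_deriv v \<theta> x) * \<psi> x)"
      if "\<psi> \<in> C_compact 1 UNIV" for \<psi>
      using weak_product_rule_integral[OF U fh \<theta>(1) C_compact_C_diff[OF that]] .
    then have "(LINT x|lebesgue. B (f x * \<theta> x) * dir_deriv v \<phi> x)
        = - (LINT x|lebesgue. b (f x * \<theta> x) * (h x * \<theta> x + f x * dir_deriv v \<theta> x) * \<phi> x)"
      using C_compact_mono[OF subset_UNIV, of 1 U] \<phi>
      by (intro chain_rule_whole_space[OF f\<theta>(1) Bochner_Integration.integrable_add[OF h\<theta> f\<theta>(2)] _ B]) auto
    moreover have "(\<lambda>x. B (f x * \<theta> x) * dir_deriv v \<phi> x) = (\<lambda>x. B (f x) * dir_deriv v \<phi> x)"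
    proof
      fix x show "B (f x * \<theta> x) * dir_deriv v \<phi> x = B (f x) * dir_deriv v \<phi> x"
        using K(4)[of x v] \<theta>(3)[of x] by (cases "x \<in> K") auto
    qed
    moreover have "(\<lambda>x. b (f x * \<theta> x) * (h x * \<theta> x + f x * dir_deriv v \<theta> x) * \<phi> x) = (\<lambda>x. b (f x) * h x * \<phi> x)"
    proof
      fix x show "b (f x * \<theta> x) * (h x * \<theta> x + f x * dir_deriv v \<theta> x) * \<phi> x = b (f x) * h x * \<phi> x"
        using K(3)[of x] \<theta>(3)[of x] \<theta>0[of x] by (cases "x \<in> K") auto
    qed
    ultimately show ?thesis
      using integral_test_lebesgue_on[OF U \<phi>] by simp
  qed
  ultimately show ?thesis unfolding has_weak_deriv_def by blast
qed

section \<open>Uniqueness of weak derivatives and products with test functions\<close>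

text \<open>Measurability on all compact subsets suffices because an open set is a countable union of them.\<close>

lemma loc_integrable_measurable:
  fixes f :: "'a::euclidean_space \<Rightarrow> 'b::euclidean_space"
  assumes U: "open U" and f: "loc_integrable U f"
  shows "f \<in> borel_measurable (lebesgue_on U)"
proof -
  obtain C :: "nat \<Rightarrow> 'a set" where C: "\<And>n. compact (C n)" "\<And>n. C n \<subseteq> U" "\<Union>(range C) = U"
  proof (rule open_Union_compact_subsets[OF U])
    fix C :: "nat \<Rightarrow> 'a set"
    assume "\<And>n. compact (C n)" "\<And>n. C n \<subseteq> U" "\<Union>(range C) = U"
    then show thesis by (rule that)
  qed
  show ?thesis
  proof (rule measurable_piecewise_restrict)
    show "countable (range C)" by simp
    show "space (lebesgue_on U) \<subseteq> \<Union>(range C)" using C(3) by simp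
    fix K assume "K \<in> range C"
    then have K: "compact K" "K \<subseteq> U" using C by auto
    have KU: "U \<inter> K = K" using K(2) by blast
    show "K \<inter> space (lebesgue_on U) \<in> sets (lebesgue_on U)"
      using K U by (auto simp: sets_restrict_space image_iff Int_commute intro!: bexI[of _ K] fmeasurableD lmeasurable_compact)
    have "f \<in> borel_measurable (lebesgue_on K)"
      using f K by (auto simp: loc_integrable_def)
    moreover have "restrict_space (lebesgue_on U) K = lebesgue_on K"
      using restrict_restrict_space[of U lebesgue K] U fmeasurableD[OF lmeasurable_compact[OF K(1)]] KU by simp
    ultimately show "f \<in> borel_measurable (restrict_space (lebesgue_on U) K)"
      by simp
  qed
qed

lemma integrable_imp_loc_integrable:
  fixes f :: "'a::euclidean_space \<Rightarrow> real"
  assumes U: "U \<in> sets lebesgue" and f: "integrable (lebesgue_on U) f"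
  shows "loc_integrable U f"
  unfolding loc_integrable_def
proof (intro allI impI)
  fix K assume K: "compact K \<and> K \<subseteq> U"
  then have KU: "U \<inter> K = K" by blast
  have Ks: "K \<in> sets lebesgue" using K by (auto intro: fmeasurableD lmeasurable_compact)
  have "K \<in> sets (lebesgue_on U)"
    using K Ks U by (auto simp: sets_restrict_space image_iff intro!: bexI[of _ K])
  then have "integrable (lebesgue_on U) (\<lambda>x. indicat_real K x *\<^sub>R f x)"
    using f by (rule integrable_mult_indicator)
  then have "integrable (restrict_space (lebesgue_on U) K) f"
    by (subst integrable_restrict_space) (use \<open>K \<in> sets (lebesgue_on U)\<close> in auto)
  then show "integrable (lebesgue_on K) f"
    using U Ks by (simp add: restrict_restrict_space KU)
qed

lemma loc_integrable_diff:
  fixes f :: "'a::euclidean_space \<Rightarrow> real"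
  assumes "loc_integrable U f" "loc_integrable U g"
  shows "loc_integrable U (\<lambda>x. f x - g x)"
  using assms by (auto simp: loc_integrable_def)

lemma loc_integrable_sum:
  fixes f :: "'i \<Rightarrow> 'a::euclidean_space \<Rightarrow> 'b::euclidean_space"
  assumes "\<And>i. i \<in> I \<Longrightarrow> loc_integrable U (f i)"
  shows "loc_integrable U (\<lambda>x. \<Sum>i\<in>I. f i x)"
  using assms by (auto simp: loc_integrable_def intro!: Bochner_Integration.integrable_sum)

lemma loc_integrable_inner:
  fixes F :: "'a::euclidean_space \<Rightarrow> 'b::euclidean_space"
  assumes "loc_integrable U F"
  shows "loc_integrable U (\<lambda>x. F x \<bullet> j)"
  using assms by (auto simp: loc_integrable_def)

lemma loc_integrable_componentwise:
  fixes F :: "'a::euclidean_space \<Rightarrow> 'b::euclidean_space"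
  assumes "\<And>j. j \<in> Basis \<Longrightarrow> loc_integrable U (\<lambda>x. F x \<bullet> j)"
  shows "loc_integrable U F"
proof -
  have "loc_integrable U (\<lambda>x. \<Sum>j\<in>Basis. (F x \<bullet> j) *\<^sub>R j)"
    using assms by (intro loc_integrable_sum) (auto simp: loc_integrable_def)
  then show ?thesis by (simp add: euclidean_representation)
qed

lemma AE_eq_if_equal_against_tests:
  fixes h h' :: "'a::euclidean_space \<Rightarrow> real"
  assumes U: "open U" and h: "loc_integrable U h" "loc_integrable U h'"
    and eq: "\<And>\<phi>. \<phi> \<in> C_compact 1 U \<Longrightarrow>
      (LINT x|lebesgue_on U. h x * \<phi> x) = (LINT x|lebesgue_on U. h' x * \<phi> x)"
  shows "AE x in lebesgue_on U. h x = h' x"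
proof -
  have "AE x in lebesgue_on U. h x - h' x = 0"
  proof (rule fundamental_lemma_of_variations[OF U loc_integrable_diff[OF h]])
    fix \<phi> assume \<phi>: "\<phi> \<in> C_compact 1 U"
    have "(LINT x|lebesgue. (h x - h' x) * \<phi> x) = (LINT x|lebesgue. h x * \<phi> x) - (LINT x|lebesgue. h' x * \<phi> x)"
      by (subst Bochner_Integration.integral_diff[symmetric])
         (use loc_integrable_times_test(1)[OF h(1) \<phi>] loc_integrable_times_test(1)[OF h(2) \<phi>] in
          \<open>auto simp: left_diff_distrib\<close>)
    then show "(LINT x|lebesgue. (h x - h' x) * \<phi> x) = 0"
      using eq[OF \<phi>] integral_test_lebesgue_on[OF U \<phi>] by simp
  qed
  then show ?thesis by eventually_elim simp
qed

lemma has_weak_deriv_weak_deriv: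
  "has_weak_deriv U j f h \<Longrightarrow> has_weak_deriv U j f (weak_deriv U j f)"
  unfolding weak_deriv_def by (rule someI[of "has_weak_deriv U j f"])

text \<open>Hence the representative chosen by \<open>weak_deriv\<close> can be exchanged for any known weak derivative.\<close>

lemma weak_deriv_AE_eq:
  assumes U: "open U" and h: "has_weak_deriv U j f h"
  shows "AE x in lebesgue_on U. weak_deriv U j f x = h x"
proof -
  have w: "has_weak_deriv U j f (weak_deriv U j f)"
    unfolding weak_deriv_def by (rule someI[of "has_weak_deriv U j f", OF h])
  show ?thesis
    by (rule AE_eq_if_equal_against_tests[OF U]) (use w h in \<open>auto simp: has_weak_deriv_def\<close>)
qed

lemma weakly_differentiable_has_weak_deriv:
  assumes "weakly_differentiable U f" "j \<in> Basis"
  shows "has_weak_deriv U j f (weak_deriv U j f)"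
  using bspec[OF assms(1)[unfolded weakly_differentiable_def] assms(2)]
  by (elim exE) (rule has_weak_deriv_weak_deriv)

lemma weak_div_AE_eq:
  assumes U: "open U" and h: "has_weak_div U F h"
  shows "AE x in lebesgue_on U. weak_div U F x = h x"
proof -
  have w: "has_weak_div U F (weak_div U F)"
    unfolding weak_div_def by (rule someI[of "has_weak_div U F", OF h])
  show ?thesis
    by (rule AE_eq_if_equal_against_tests[OF U]) (use w h in \<open>auto simp: has_weak_div_def\<close>)
qed

lemma has_weak_div_weak_div:
  "has_weak_div U F h \<Longrightarrow> has_weak_div U F (weak_div U F)"
  unfolding weak_div_def by (rule someI[of "has_weak_div U F"])

lemma integral_dir_deriv_field:
  fixes F :: "'a::euclidean_space \<Rightarrow> 'a"
  assumes "\<And>j. j \<in> Basis \<Longrightarrow> loc_integrable U (\<lambda>x. F x \<bullet> j)" "\<phi> \<in> C_compact 1 U"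
  shows "integrable lebesgue (\<lambda>x. dir_deriv (F x) \<phi> x)"
    and "(LINT x|lebesgue. dir_deriv (F x) \<phi> x) = (\<Sum>j\<in>Basis. (LINT x|lebesgue. (F x \<bullet> j) * dir_deriv j \<phi> x))"
proof -
  have i: "integrable lebesgue (\<lambda>x. (F x \<bullet> j) * dir_deriv j \<phi> x)" if "j \<in> Basis" for j
    using loc_integrable_times_test(2)[OF assms(1)[OF that] assms(2)] .
  have e: "(\<lambda>x. dir_deriv (F x) \<phi> x) = (\<lambda>x. \<Sum>j\<in>Basis. (F x \<bullet> j) * dir_deriv j \<phi> x)"
    using dir_deriv_basis_expansion[OF C_compact_C_diff[OF assms(2)]] by blast
  show "integrable lebesgue (\<lambda>x. dir_deriv (F x) \<phi> x)"
    unfolding e using i by (rule Bochner_Integration.integrable_sum)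
  show "(LINT x|lebesgue. dir_deriv (F x) \<phi> x) = (\<Sum>j\<in>Basis. (LINT x|lebesgue. (F x \<bullet> j) * dir_deriv j \<phi> x))"
    unfolding e using i by (rule Bochner_Integration.integral_sum)
qed

lemma has_weak_div_componentwise:
  fixes F :: "'a::euclidean_space \<Rightarrow> 'a"
  assumes U: "open U" and h: "\<And>j. j \<in> Basis \<Longrightarrow> has_weak_deriv U j (\<lambda>x. F x \<bullet> j) (h j)"
  shows "has_weak_div U F (\<lambda>x. \<Sum>j\<in>Basis. h j x)"
proof -
  have lF: "loc_integrable U (\<lambda>x. F x \<bullet> j)" and lh: "loc_integrable U (h j)" if "j \<in> Basis" for j
    using h[OF that] by (auto simp: has_weak_deriv_def)
  have "(LINT x|lebesgue_on U. dir_deriv (F x) \<phi> x) = - (LINT x|lebesgue_on U. (\<Sum>j\<in>Basis. h j x) * \<phi> x)"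
    if \<phi>: "\<phi> \<in> C_compact 1 U" for \<phi>
  proof -
    have "(LINT x|lebesgue. dir_deriv (F x) \<phi> x) = (\<Sum>j\<in>Basis. - (LINT x|lebesgue. h j x * \<phi> x))"
      using integral_dir_deriv_field(2)[OF lF \<phi>] has_weak_derivD[OF U h \<phi>] by simp
    also have "\<dots> = - (LINT x|lebesgue. (\<Sum>j\<in>Basis. h j x * \<phi> x))"
      using loc_integrable_times_test(1)[OF lh \<phi>]
      by (subst Bochner_Integration.integral_sum) (auto simp: sum_negf)
    finally have "(LINT x|lebesgue. dir_deriv (F x) \<phi> x) = - (LINT x|lebesgue. (\<Sum>j\<in>Basis. h j x) * \<phi> x)"
      unfolding sum_distrib_right .
    then show ?thesis
      using integral_test_lebesgue_on(1)[OF U \<phi>, of "\<lambda>x. \<Sum>j\<in>Basis. h j x"]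
        integral_test_lebesgue_on(3)[OF U \<phi>, of F] by (simp only:)
  qed
  then show ?thesis
    unfolding has_weak_div_def
    by (intro conjI ballI loc_integrable_componentwise[OF lF] loc_integrable_sum[OF lh])
qed

lemma has_weak_deriv_mult_test:
  fixes f h :: "'a::euclidean_space \<Rightarrow> real"
  assumes U: "open U" and fh: "has_weak_deriv U v f h" and \<theta>: "\<theta> \<in> C_compact 1 U"
  shows "has_weak_deriv U v (\<lambda>x. f x * \<theta> x) (\<lambda>x. h x * \<theta> x + f x * dir_deriv v \<theta> x)"
proof -
  have l: "loc_integrable U f" "loc_integrable U h"
    using fh by (auto simp: has_weak_deriv_def)
  have Us: "U \<in> sets lebesgue" using U by simp
  obtain K where K: "K \<subseteq> U" "\<And>x. x \<notin> K \<Longrightarrow> \<theta> x = 0" "\<And>x j. x \<notin> K \<Longrightarrow> dir_deriv j \<theta> x = 0"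
    by (rule C_compactE[OF \<theta>]) (rule that)
  have supp: "\<theta> x = 0 \<and> dir_deriv j \<theta> x = 0" if "x \<notin> U" for x j
    using K that by blast
  have "loc_integrable U (\<lambda>x. f x * \<theta> x)"
    using loc_integrable_times_test(1)[OF l(1) \<theta>] integral_lebesgue_on_eq(2)[OF Us, of "\<lambda>x. f x * \<theta> x"] supp
    by (intro integrable_imp_loc_integrable[OF Us]) auto
  moreover have "loc_integrable U (\<lambda>x. h x * \<theta> x + f x * dir_deriv v \<theta> x)"
    using loc_integrable_times_test(1)[OF l(2) \<theta>] loc_integrable_times_test(2)[OF l(1) \<theta>, of v]
      integral_lebesgue_on_eq(2)[OF Us, of "\<lambda>x. h x * \<theta> x + f x * dir_deriv v \<theta> x"] supp
    by (intro integrable_imp_loc_integrable[OF Us]) auto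
  moreover have "(LINT x|lebesgue_on U. f x * \<theta> x * dir_deriv v \<psi> x)
      = - (LINT x|lebesgue_on U. (h x * \<theta> x + f x * dir_deriv v \<theta> x) * \<psi> x)" if "\<psi> \<in> C_compact 1 U" for \<psi>
    using weak_product_rule_integral[OF U fh \<theta> C_compact_C_diff[OF that]]
    by (subst (1 2) integral_lebesgue_on_eq(1)[OF Us]) (auto simp: supp)
  ultimately show ?thesis unfolding has_weak_deriv_def by blast
qed

section \<open>Sobolev functions with zero traces\<close>

lemma powr_add_le:
  fixes a b :: real
  assumes "0 \<le> a" "0 \<le> b" "0 \<le> s"
  shows "(a + b) powr s \<le> 2 powr s * (a powr s + b powr s)"
proof -
  have "(a + b) powr s \<le> (2 * max a b) powr s"
    using assms by (intro powr_mono2) auto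
  also have "\<dots> = 2 powr s * max a b powr s"
    using assms by (intro powr_mult)
  also have "\<dots> \<le> 2 powr s * (a powr s + b powr s)"
    by (intro mult_left_mono) (auto simp: max_def)
  finally show ?thesis .
qed

text \<open>This elementary estimate is all that is needed of the vector space structure of \<open>L\<^sup>s\<close>. The combination has
the form produced by the product rule, with bounded factors \<open>\<theta>\<close> and \<open>\<theta>'\<close>.\<close>

lemma combination_powr_le:
  fixes w w' :: real
  assumes "\<bar>\<theta>\<bar> \<le> C" "\<bar>\<theta>'\<bar> \<le> C'" "0 \<le> s"
  shows "\<bar>w * \<theta> + w' * \<theta>'\<bar> powr s \<le> 2 powr s * (C powr s * \<bar>w\<bar> powr s + C' powr s * \<bar>w'\<bar> powr s)"
proof -
  have C: "0 \<le> C" "0 \<le> C'" using assms by linarith+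
  have "\<bar>w * \<theta> + w' * \<theta>'\<bar> \<le> C * \<bar>w\<bar> + C' * \<bar>w'\<bar>"
    using mult_right_mono[OF assms(1), of "\<bar>w\<bar>"] mult_right_mono[OF assms(2), of "\<bar>w'\<bar>"]
      abs_triangle_ineq[of "w * \<theta>" "w' * \<theta>'"]
    by (simp add: abs_mult mult.commute)
  then have "\<bar>w * \<theta> + w' * \<theta>'\<bar> powr s \<le> (C * \<bar>w\<bar> + C' * \<bar>w'\<bar>) powr s"
    using assms by (intro powr_mono2) auto
  also have "\<dots> \<le> 2 powr s * ((C * \<bar>w\<bar>) powr s + (C' * \<bar>w'\<bar>) powr s)"
    using C assms by (intro powr_add_le) auto
  finally show ?thesis using C by (simp add: powr_mult)
qed

lemma Lp_space_combination:
  fixes w w' :: "'a::euclidean_space \<Rightarrow> real"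
  assumes "0 \<le> s" and w: "w \<in> Lp_space U s" "w' \<in> Lp_space U s"
    and \<theta>: "\<theta> \<in> borel_measurable (lebesgue_on U)" "\<And>x. \<bar>\<theta> x\<bar> \<le> C"
    and \<theta>': "\<theta>' \<in> borel_measurable (lebesgue_on U)" "\<And>x. \<bar>\<theta>' x\<bar> \<le> C'"
  shows "(\<lambda>x. w x * \<theta> x + w' x * \<theta>' x) \<in> Lp_space U s"
    and "(LINT x|lebesgue_on U. \<bar>w x * \<theta> x + w' x * \<theta>' x\<bar> powr s)
      \<le> 2 powr s * (C powr s * (LINT x|lebesgue_on U. \<bar>w x\<bar> powr s)
                   + C' powr s * (LINT x|lebesgue_on U. \<bar>w' x\<bar> powr s))"
proof -
  have [measurable]: "w \<in> borel_measurable (lebesgue_on U)" "w' \<in> borel_measurable (lebesgue_on U)"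
    using w by (auto simp: Lp_space_def)
  note [measurable] = \<theta>(1) \<theta>'(1)
  have i: "integrable (lebesgue_on U) (\<lambda>x. \<bar>w x\<bar> powr s)" "integrable (lebesgue_on U) (\<lambda>x. \<bar>w' x\<bar> powr s)"
    using w by (auto simp: Lp_space_def)
  let ?b = "\<lambda>x. 2 powr s * (C powr s * \<bar>w x\<bar> powr s + C' powr s * \<bar>w' x\<bar> powr s)"
  have ib: "integrable (lebesgue_on U) ?b" using i by simp
  have le: "\<bar>w x * \<theta> x + w' x * \<theta>' x\<bar> powr s \<le> ?b x" for x
    by (rule combination_powr_le[OF \<theta>(2) \<theta>'(2) assms(1)])
  have ii: "integrable (lebesgue_on U) (\<lambda>x. \<bar>w x * \<theta> x + w' x * \<theta>' x\<bar> powr s)"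
  proof (rule Bochner_Integration.integrable_bound[OF ib])
    show "AE x in lebesgue_on U. norm (\<bar>w x * \<theta> x + w' x * \<theta>' x\<bar> powr s) \<le> norm (?b x)"
      using le by (intro AE_I2) (simp add: order_trans[OF _ abs_ge_self])
  qed measurable
  show "(\<lambda>x. w x * \<theta> x + w' x * \<theta>' x) \<in> Lp_space U s"
    unfolding Lp_space_def using ii by simp
  have "(LINT x|lebesgue_on U. \<bar>w x * \<theta> x + w' x * \<theta>' x\<bar> powr s) \<le> (LINT x|lebesgue_on U. ?b x)"
    by (rule integral_mono[OF ii ib le])
  then show "(LINT x|lebesgue_on U. \<bar>w x * \<theta> x + w' x * \<theta>' x\<bar> powr s)
      \<le> 2 powr s * (C powr s * (LINT x|lebesgue_on U. \<bar>w x\<bar> powr s)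
                   + C' powr s * (LINT x|lebesgue_on U. \<bar>w' x\<bar> powr s))"
    using i by simp
qed

lemma Lp_null_sequence_combination:
  fixes w w' :: "nat \<Rightarrow> 'a::euclidean_space \<Rightarrow> real"
  assumes "0 \<le> s" and w: "\<And>n. w n \<in> Lp_space U s" "\<And>n. w' n \<in> Lp_space U s"
    and \<theta>: "\<theta> \<in> borel_measurable (lebesgue_on U)" "\<And>x. \<bar>\<theta> x\<bar> \<le> C"
    and \<theta>': "\<theta>' \<in> borel_measurable (lebesgue_on U)" "\<And>x. \<bar>\<theta>' x\<bar> \<le> C'"
    and lim: "(\<lambda>n. LINT x|lebesgue_on U. \<bar>w n x\<bar> powr s) \<longlonglongrightarrow> 0"
      "(\<lambda>n. LINT x|lebesgue_on U. \<bar>w' n x\<bar> powr s) \<longlonglongrightarrow> 0"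
  shows "(\<lambda>n. LINT x|lebesgue_on U. \<bar>w n x * \<theta> x + w' n x * \<theta>' x\<bar> powr s) \<longlonglongrightarrow> 0"
proof (rule tendsto_sandwich[where f="\<lambda>n. 0"])
  show "\<forall>\<^sub>F n in sequentially. 0 \<le> (LINT x|lebesgue_on U. \<bar>w n x * \<theta> x + w' n x * \<theta>' x\<bar> powr s)"
    by simp
  show "\<forall>\<^sub>F n in sequentially. (LINT x|lebesgue_on U. \<bar>w n x * \<theta> x + w' n x * \<theta>' x\<bar> powr s)
      \<le> 2 powr s * (C powr s * (LINT x|lebesgue_on U. \<bar>w n x\<bar> powr s)
                   + C' powr s * (LINT x|lebesgue_on U. \<bar>w' n x\<bar> powr s))"
    using Lp_space_combination(2)[OF assms(1) w \<theta> \<theta>'] by simp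
  show "(\<lambda>n. 2 powr s * (C powr s * (LINT x|lebesgue_on U. \<bar>w n x\<bar> powr s)
                   + C' powr s * (LINT x|lebesgue_on U. \<bar>w' n x\<bar> powr s))) \<longlonglongrightarrow> 0"
    by (rule tendsto_eq_intros lim refl | simp)+
qed simp

lemma Lp_space_bounded_compact_support:
  fixes f :: "'a::euclidean_space \<Rightarrow> real"
  assumes U: "U \<in> sets lebesgue" and K: "compact K" "\<And>x. x \<notin> K \<Longrightarrow> f x = 0"
    and f: "f \<in> borel_measurable lebesgue" "\<And>x. \<bar>f x\<bar> \<le> C" and "0 \<le> s"
  shows "f \<in> Lp_space U s"
proof -
  have [measurable]: "f \<in> borel_measurable (lebesgue_on U)"
    using f(1) by (rule measurable_restrict_space1)
  have "K \<in> sets lebesgue" using K(1) by (auto intro: fmeasurableD lmeasurable_compact)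
  then have [measurable]: "indicat_real K \<in> borel_measurable (lebesgue_on U)"
    by (intro measurable_restrict_space1) simp
  have C0: "0 \<le> C" using f(2)[of undefined] by linarith
  have "integrable lebesgue (\<lambda>x. indicat_real U x *\<^sub>R (C powr s * indicat_real K x))"
    using integrable_indicator_compact[OF K(1)] U by (intro integrable_mult_indicator) auto
  then have i: "integrable (lebesgue_on U) (\<lambda>x. C powr s * indicat_real K x)"
    using U by (subst integrable_restrict_space) auto
  have "integrable (lebesgue_on U) (\<lambda>x. \<bar>f x\<bar> powr s)"
  proof (rule Bochner_Integration.integrable_bound[OF i])
    show "AE x in lebesgue_on U. norm (\<bar>f x\<bar> powr s) \<le> norm (C powr s * indicat_real K x)"
    proof (rule AE_I2)
      fix x show "norm (\<bar>f x\<bar> powr s) \<le> norm (C powr s * indicat_real K x)"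
        using K(2)[of x] powr_mono2[OF \<open>0 \<le> s\<close> _ f(2)[of x]] by (cases "x \<in> K") auto
    qed
  qed measurable
  then show ?thesis by (simp add: Lp_space_def)
qed

lemma Lp_space_test:
  fixes \<phi> :: "'a::euclidean_space \<Rightarrow> real"
  assumes "open U" "\<phi> \<in> C_compact 1 U" "0 \<le> s"
  shows "\<phi> \<in> Lp_space U s" "dir_deriv j \<phi> \<in> Lp_space U s"
proof -
  have U: "U \<in> sets lebesgue" using assms(1) by simp
  obtain K where K: "compact K" "\<And>x. x \<notin> K \<Longrightarrow> \<phi> x = 0" "\<And>x j. x \<notin> K \<Longrightarrow> dir_deriv j \<phi> x = 0"
    by (rule C_compactE[OF assms(2)]) (rule that)
  obtain C where "\<And>x. \<bar>\<phi> x\<bar> \<le> C" by (rule C_compact_bounded[OF assms(2)]) (rule that)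
  then show "\<phi> \<in> Lp_space U s"
    using Lp_space_bounded_compact_support[OF U K(1,2) C_compact_lebesgue_measurable[OF assms(2)] _ assms(3)]
    by blast
  obtain C where "\<And>x. \<bar>dir_deriv j \<phi> x\<bar> \<le> C" by (rule C_compact_bounded_dir_deriv[OF assms(2), of j]) (rule that)
  then show "dir_deriv j \<phi> \<in> Lp_space U s"
    using Lp_space_bounded_compact_support[OF U K(1,3) C_compact_lebesgue_measurable_dir_deriv[OF assms(2)] _ assms(3)]
    by blast
qed

lemma Lp_space_diff:
  fixes f g :: "'a::euclidean_space \<Rightarrow> real"
  assumes "0 \<le> s" "f \<in> Lp_space U s" "g \<in> Lp_space U s"
  shows "(\<lambda>x. f x - g x) \<in> Lp_space U s"
  using Lp_space_combination(1)[OF assms, of "\<lambda>x. 1" 1 "\<lambda>x. - 1" 1] by simp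

lemma sobolev_1_iff:
  "sobolev 1 U s f \<longleftrightarrow>
    f \<in> Lp_space U s \<and> weakly_differentiable U f \<and> (\<forall>j\<in>Basis. weak_deriv U j f \<in> Lp_space U s)"
  unfolding One_nat_def by simp

lemma sobolev_conv_1_iff:
  "sobolev_conv 1 U s \<phi> f \<longleftrightarrow>
    (\<lambda>n. LINT x|lebesgue_on U. \<bar>\<phi> n x - f x\<bar> powr s) \<longlonglongrightarrow> 0 \<and>
    (\<forall>j\<in>Basis. (\<lambda>n. LINT x|lebesgue_on U. \<bar>dir_deriv j (\<phi> n) x - weak_deriv U j f x\<bar> powr s) \<longlonglongrightarrow> 0)"
  unfolding One_nat_def by simp

text \<open>If test functions \<open>\<phi> n\<close> approximate \<open>f\<close>, then the \<open>\<phi> n \<theta>\<close> approximate \<open>f \<theta>\<close>; so membership in the closure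
of the test functions is inherited without any mollification.\<close>

lemma sobolev0_mult_test:
  fixes f :: "'a::euclidean_space \<Rightarrow> real"
  assumes U: "open U" and s: "0 \<le> s" and f: "sobolev0 1 U s f" and \<theta>: "\<theta> \<in> C_compact 1 U"
  shows "sobolev0 1 U s (\<lambda>x. f x * \<theta> x)"
proof -
  have fL: "f \<in> Lp_space U s" and fd: "weakly_differentiable U f"
    and dL: "\<And>j. j \<in> Basis \<Longrightarrow> weak_deriv U j f \<in> Lp_space U s"
    using f by (auto simp: sobolev0_def sobolev_1_iff)
  obtain \<phi> where \<phi>: "\<And>n. \<phi> n \<in> C_compact 1 U"
    "(\<lambda>n. LINT x|lebesgue_on U. \<bar>\<phi> n x - f x\<bar> powr s) \<longlonglongrightarrow> 0"
    "\<And>j. j \<in> Basis \<Longrightarrow> (\<lambda>n. LINT x|lebesgue_on U. \<bar>dir_deriv j (\<phi> n) x - weak_deriv U j f x\<bar> powr s) \<longlonglongrightarrow> 0"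
    using f by (auto simp: sobolev0_def sobolev_conv_1_iff)
  obtain C where C: "\<And>x. \<bar>\<theta> x\<bar> \<le> C" by (rule C_compact_bounded[OF \<theta>]) (rule that)
  have "\<exists>D. \<forall>x. \<bar>dir_deriv j \<theta> x\<bar> \<le> D" for j
    by (rule C_compact_bounded_dir_deriv[OF \<theta>, of j]) blast
  then obtain D where D: "\<And>j x. \<bar>dir_deriv j \<theta> x\<bar> \<le> D j" by metis
  have \<theta>m [measurable]: "\<theta> \<in> borel_measurable (lebesgue_on U)" "dir_deriv j \<theta> \<in> borel_measurable (lebesgue_on U)" for j
    using C_compact_lebesgue_measurable[OF \<theta>] C_compact_lebesgue_measurable_dir_deriv[OF \<theta>]
    by (auto intro: measurable_restrict_space1)
  have zero: "(\<lambda>x. 0 :: real) \<in> borel_measurable (lebesgue_on U)" "\<And>x::'a. \<bar>0::real\<bar> \<le> 0" by auto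
  have prod: "has_weak_deriv U j (\<lambda>x. f x * \<theta> x) (\<lambda>x. weak_deriv U j f x * \<theta> x + f x * dir_deriv j \<theta> x)"
    if "j \<in> Basis" for j
    by (rule has_weak_deriv_mult_test[OF U weakly_differentiable_has_weak_deriv[OF fd that] \<theta>])
  have dm [measurable]: "weak_deriv U j (\<lambda>x. f x * \<theta> x) \<in> borel_measurable (lebesgue_on U)" if "j \<in> Basis" for j
    using has_weak_deriv_weak_deriv[OF prod[OF that]]
    by (intro loc_integrable_measurable[OF U]) (simp add: has_weak_deriv_def)
  have comb: "(\<lambda>x. weak_deriv U j f x * \<theta> x + f x * dir_deriv j \<theta> x) \<in> Lp_space U s" if "j \<in> Basis" for j
    by (rule Lp_space_combination(1)[OF s dL[OF that] fL \<theta>m(1) C \<theta>m(2) D])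
  have AE: "AE x in lebesgue_on U. weak_deriv U j (\<lambda>x. f x * \<theta> x) x = weak_deriv U j f x * \<theta> x + f x * dir_deriv j \<theta> x"
    if "j \<in> Basis" for j
    by (rule weak_deriv_AE_eq[OF U prod[OF that]])
  have "sobolev 1 U s (\<lambda>x. f x * \<theta> x)"
    unfolding sobolev_1_iff
  proof (intro conjI ballI)
    show "(\<lambda>x. f x * \<theta> x) \<in> Lp_space U s"
      using Lp_space_combination(1)[OF s fL fL \<theta>m(1) C zero] by simp
    show "weakly_differentiable U (\<lambda>x. f x * \<theta> x)"
      using prod by (auto simp: weakly_differentiable_def)
    fix j :: 'a assume j: "j \<in> Basis"
    have "integrable (lebesgue_on U) (\<lambda>x. \<bar>weak_deriv U j (\<lambda>x. f x * \<theta> x) x\<bar> powr s)"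
    proof (rule integrable_cong_AE_imp)
      show "integrable (lebesgue_on U) (\<lambda>x. \<bar>weak_deriv U j f x * \<theta> x + f x * dir_deriv j \<theta> x\<bar> powr s)"
        using comb[OF j] by (simp add: Lp_space_def)
      show "(\<lambda>x. \<bar>weak_deriv U j (\<lambda>x. f x * \<theta> x) x\<bar> powr s) \<in> borel_measurable (lebesgue_on U)"
        using dm[OF j] by measurable
    qed (use AE[OF j] in \<open>eventually_elim, simp\<close>)
    then show "weak_deriv U j (\<lambda>x. f x * \<theta> x) \<in> Lp_space U s"
      using dm[OF j] by (simp add: Lp_space_def)
  qed
  moreover have "(\<lambda>x. \<phi> n x * \<theta> x) \<in> C_compact 1 U" for n
    by (rule C_compact_mult_right[OF \<phi>(1) C_compact_C_diff[OF \<theta>]])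
  moreover have "sobolev_conv 1 U s (\<lambda>n x. \<phi> n x * \<theta> x) (\<lambda>x. f x * \<theta> x)"
    unfolding sobolev_conv_1_iff
  proof (intro conjI ballI)
    have w: "(\<lambda>x. \<phi> n x - f x) \<in> Lp_space U s" for n
      using Lp_space_test(1)[OF U \<phi>(1) s] fL by (intro Lp_space_diff[OF s])
    have "(\<lambda>n. LINT x|lebesgue_on U. \<bar>(\<phi> n x - f x) * \<theta> x + (\<phi> n x - f x) * 0\<bar> powr s) \<longlonglongrightarrow> 0"
      by (rule Lp_null_sequence_combination[OF s w w \<theta>m(1) C zero \<phi>(2) \<phi>(2)])
    then show "(\<lambda>n. LINT x|lebesgue_on U. \<bar>\<phi> n x * \<theta> x - f x * \<theta> x\<bar> powr s) \<longlonglongrightarrow> 0"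
      by (simp add: left_diff_distrib)
    fix j :: 'a assume j: "j \<in> Basis"
    have w': "(\<lambda>x. dir_deriv j (\<phi> n) x - weak_deriv U j f x) \<in> Lp_space U s" for n
      using Lp_space_test(2)[OF U \<phi>(1) s] dL[OF j] by (intro Lp_space_diff[OF s])
    have "(\<lambda>n. LINT x|lebesgue_on U. \<bar>(dir_deriv j (\<phi> n) x - weak_deriv U j f x) * \<theta> x
        + (\<phi> n x - f x) * dir_deriv j \<theta> x\<bar> powr s) \<longlonglongrightarrow> 0"
      by (rule Lp_null_sequence_combination[OF s w' w \<theta>m(1) C \<theta>m(2) D \<phi>(3)[OF j] \<phi>(2)])
    moreover have "(LINT x|lebesgue_on U. \<bar>(dir_deriv j (\<phi> n) x - weak_deriv U j f x) * \<theta> x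
        + (\<phi> n x - f x) * dir_deriv j \<theta> x\<bar> powr s)
      = (LINT x|lebesgue_on U. \<bar>dir_deriv j (\<lambda>x. \<phi> n x * \<theta> x) x - weak_deriv U j (\<lambda>x. f x * \<theta> x) x\<bar> powr s)" for n
    proof (rule integral_cong_AE)
      have [measurable]: "f \<in> borel_measurable (lebesgue_on U)" "weak_deriv U j f \<in> borel_measurable (lebesgue_on U)"
        using fL dL[OF j] by (auto simp: Lp_space_def)
      have [measurable]: "\<phi> n \<in> borel_measurable (lebesgue_on U)" "dir_deriv j (\<phi> n) \<in> borel_measurable (lebesgue_on U)"
        using C_compact_lebesgue_measurable[OF \<phi>(1)] C_compact_lebesgue_measurable_dir_deriv[OF \<phi>(1)]
        by (auto intro: measurable_restrict_space1)
      have dd: "dir_deriv j (\<lambda>x. \<phi> n x * \<theta> x) x = \<phi> n x * dir_deriv j \<theta> x + dir_deriv j (\<phi> n) x * \<theta> x" for x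
        by (rule C_diff_1_mult(2)[OF C_compact_C_diff[OF \<phi>(1)] C_compact_C_diff[OF \<theta>]])
      show "(\<lambda>x. \<bar>(dir_deriv j (\<phi> n) x - weak_deriv U j f x) * \<theta> x + (\<phi> n x - f x) * dir_deriv j \<theta> x\<bar> powr s)
          \<in> borel_measurable (lebesgue_on U)" by measurable
      show "(\<lambda>x. \<bar>dir_deriv j (\<lambda>x. \<phi> n x * \<theta> x) x - weak_deriv U j (\<lambda>x. f x * \<theta> x) x\<bar> powr s)
          \<in> borel_measurable (lebesgue_on U)"
        using dm[OF j] unfolding dd by simp
      show "AE x in lebesgue_on U.
          \<bar>(dir_deriv j (\<phi> n) x - weak_deriv U j f x) * \<theta> x + (\<phi> n x - f x) * dir_deriv j \<theta> x\<bar> powr s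
          = \<bar>dir_deriv j (\<lambda>x. \<phi> n x * \<theta> x) x - weak_deriv U j (\<lambda>x. f x * \<theta> x) x\<bar> powr s"
        using AE[OF j]
      proof eventually_elim
        case (elim x)
        show ?case unfolding elim dd by (simp add: algebra_simps)
      qed
    qed
    ultimately show "(\<lambda>n. LINT x|lebesgue_on U. \<bar>dir_deriv j (\<lambda>x. \<phi> n x * \<theta> x) x
        - weak_deriv U j (\<lambda>x. f x * \<theta> x) x\<bar> powr s) \<longlonglongrightarrow> 0" by simp
  qed
  ultimately show ?thesis
    unfolding sobolev0_def by (intro conjI exI[of _ "\<lambda>n x. \<phi> n x * \<theta> x"] allI)
qed

section \<open>The renormalized flux\<close>

lemma sobolev0_field_mult_test:
  fixes v :: "'a::euclidean_space \<Rightarrow> 'a"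
  assumes U: "open U" and v: "sobolev0_field U v" and \<theta>: "\<theta> \<in> C_compact 1 U"
  shows "sobolev0_field U (\<lambda>x. \<theta> x *\<^sub>R v x)"
  unfolding sobolev0_field_def
proof (intro allI impI ballI)
  fix s :: real and i :: 'a assume s: "1 \<le> s \<and> s < 2" and i: "i \<in> Basis"
  then have "sobolev0 1 U s (\<lambda>x. v x \<bullet> i)"
    using v by (auto simp: sobolev0_field_def)
  from sobolev0_mult_test[OF U _ this \<theta>] s
  show "sobolev0 1 U s (\<lambda>x. \<theta> x *\<^sub>R v x \<bullet> i)" by (simp add: mult.commute)
qed

lemma sobolev0_field_weak_deriv:
  assumes "sobolev0_field U v" "i \<in> Basis" "j \<in> Basis"
  shows "has_weak_deriv U j (\<lambda>x. v x \<bullet> i) (weak_deriv U j (\<lambda>x. v x \<bullet> i))"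
    and "weak_deriv U j (\<lambda>x. v x \<bullet> i) \<in> Lp_space U 1"
proof -
  have *: "sobolev 1 U 1 (\<lambda>x. v x \<bullet> i)"
    using assms by (auto simp: sobolev0_field_def sobolev0_def)
  then show "has_weak_deriv U j (\<lambda>x. v x \<bullet> i) (weak_deriv U j (\<lambda>x. v x \<bullet> i))"
    by (intro weakly_differentiable_has_weak_deriv assms(3)) (simp add: sobolev_1_iff)
  show "weak_deriv U j (\<lambda>x. v x \<bullet> i) \<in> Lp_space U 1"
    using * assms(3) by (simp add: sobolev_1_iff)
qed

text \<open>Integrability up to the boundary comes from the exponent \<open>s = 1\<close> in the definition of \<open>sobolev0_field\<close>.\<close>

lemma sobolev0_field_weak_div:
  assumes U: "open U" and v: "sobolev0_field U v"
  shows "has_weak_div U v (\<lambda>x. \<Sum>j\<in>Basis. weak_deriv U j (\<lambda>x. v x \<bullet> j) x)"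
    and "has_weak_div U v (weak_div U v)"
    and "integrable (lebesgue_on U) (weak_div U v)"
proof -
  show h: "has_weak_div U v (\<lambda>x. \<Sum>j\<in>Basis. weak_deriv U j (\<lambda>x. v x \<bullet> j) x)"
    by (rule has_weak_div_componentwise[OF U]) (rule sobolev0_field_weak_deriv(1)[OF v])
  then show w: "has_weak_div U v (weak_div U v)"
    by (rule has_weak_div_weak_div)
  have i: "integrable (lebesgue_on U) (weak_deriv U j (\<lambda>x. v x \<bullet> j))" if "j \<in> Basis" for j
  proof -
    have *: "weak_deriv U j (\<lambda>x. v x \<bullet> j) \<in> borel_measurable (lebesgue_on U)"
      "integrable (lebesgue_on U) (\<lambda>x. \<bar>weak_deriv U j (\<lambda>x. v x \<bullet> j) x\<bar>)"
      using sobolev0_field_weak_deriv(2)[OF v that that] by (auto simp: Lp_space_def)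
    then show ?thesis using integrable_abs_cancel by blast
  qed
  show "integrable (lebesgue_on U) (weak_div U v)"
  proof (rule integrable_cong_AE_imp)
    show "integrable (lebesgue_on U) (\<lambda>x. \<Sum>j\<in>Basis. weak_deriv U j (\<lambda>x. v x \<bullet> j) x)"
      by (rule Bochner_Integration.integrable_sum[OF i])
    show "weak_div U v \<in> borel_measurable (lebesgue_on U)"
      using w by (intro loc_integrable_measurable[OF U]) (simp add: has_weak_div_def)
    show "AE x in lebesgue_on U. (\<Sum>j\<in>Basis. weak_deriv U j (\<lambda>x. v x \<bullet> j) x) = weak_div U v x"
      using weak_div_AE_eq[OF U h] by eventually_elim simp
  qed
qed

lemma weak_div_mult_test:
  fixes v :: "'a::euclidean_space \<Rightarrow> 'a"
  assumes U: "open U" and v: "sobolev0_field U v" and \<theta>: "\<theta> \<in> C_compact 1 U"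
  shows "has_weak_div U (\<lambda>x. \<theta> x *\<^sub>R v x) (weak_div U (\<lambda>x. \<theta> x *\<^sub>R v x))"
    and "AE x in lebesgue_on U. weak_div U (\<lambda>x. \<theta> x *\<^sub>R v x) x = \<theta> x * weak_div U v x + dir_deriv (v x) \<theta> x"
proof -
  have "has_weak_deriv U j (\<lambda>x. (\<theta> x *\<^sub>R v x) \<bullet> j)
      (\<lambda>x. weak_deriv U j (\<lambda>x. v x \<bullet> j) x * \<theta> x + (v x \<bullet> j) * dir_deriv j \<theta> x)" if "j \<in> Basis" for j
    using has_weak_deriv_mult_test[OF U sobolev0_field_weak_deriv(1)[OF v that that] \<theta>]
    by (simp add: mult.commute)
  then have h: "has_weak_div U (\<lambda>x. \<theta> x *\<^sub>R v x)
      (\<lambda>x. \<Sum>j\<in>Basis. weak_deriv U j (\<lambda>x. v x \<bullet> j) x * \<theta> x + (v x \<bullet> j) * dir_deriv j \<theta> x)"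
    by (rule has_weak_div_componentwise[OF U])
  then show "has_weak_div U (\<lambda>x. \<theta> x *\<^sub>R v x) (weak_div U (\<lambda>x. \<theta> x *\<^sub>R v x))"
    by (rule has_weak_div_weak_div)
  show "AE x in lebesgue_on U. weak_div U (\<lambda>x. \<theta> x *\<^sub>R v x) x = \<theta> x * weak_div U v x + dir_deriv (v x) \<theta> x"
    using weak_div_AE_eq[OF U h] weak_div_AE_eq[OF U sobolev0_field_weak_div(1)[OF U v]]
    by eventually_elim
       (simp add: sum.distrib sum_distrib_left mult.commute
         dir_deriv_basis_expansion[OF C_compact_C_diff[OF \<theta>], of "v _"])
qed

lemma weak_grad_inner_measurable:
  assumes "open U" "weakly_differentiable U f" "v \<in> borel_measurable (lebesgue_on U)"
  shows "(\<lambda>x. weak_grad U f x \<bullet> v x) \<in> borel_measurable (lebesgue_on U)"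
proof -
  have "weak_deriv U j f \<in> borel_measurable (lebesgue_on U)" if "j \<in> Basis" for j
    using weakly_differentiable_has_weak_deriv[OF assms(2) that]
    by (intro loc_integrable_measurable[OF assms(1)]) (simp add: has_weak_deriv_def)
  then have "weak_grad U f \<in> borel_measurable (lebesgue_on U)"
    unfolding weak_grad_def[abs_def] by (intro borel_measurable_sum borel_measurable_scaleR) auto
  then show ?thesis using assms(3) by measurable
qed

lemma sobolev0_field_measurable:
  assumes "open U" "sobolev0_field U v"
  shows "v \<in> borel_measurable (lebesgue_on U)"
  using sobolev0_field_weak_div(2)[OF assms]
  by (intro loc_integrable_measurable[OF assms(1)]) (simp add: has_weak_div_def)

text \<open>Green's formula for \<open>\<rho>\<close> against \<open>\<phi> v\<close> expresses \<open>\<integral> \<rho> v \<bullet> \<nabla> \<phi>\<close> through exactly the two integrable quantities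
on the right. This bypasses a product rule for the components of \<open>\<rho> v\<close>, for which the single terms of
\<open>\<nabla> \<rho> \<bullet> v\<close> would have to be locally integrable.\<close>

lemma weak_div_density_flux:
  fixes v :: "'a::euclidean_space \<Rightarrow> 'a" and \<rho> :: "'a \<Rightarrow> real"
  assumes U: "open U" and v: "sobolev0_field U v"
    and \<rho>: "weakly_differentiable U \<rho>" "integration_by_parts U \<rho>"
    and flux: "has_weak_div U (\<lambda>x. \<rho> x *\<^sub>R v x) h"
    and int: "integrable (lebesgue_on U) (\<lambda>x. weak_grad U \<rho> x \<bullet> v x)"
      "integrable (lebesgue_on U) (\<lambda>x. \<rho> x * weak_div U v x)"
  shows "AE x in lebesgue_on U.
    weak_div U (\<lambda>y. \<rho> y *\<^sub>R v y) x = weak_grad U \<rho> x \<bullet> v x + \<rho> x * weak_div U v x"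
proof (rule weak_div_AE_eq[OF U])
  have Us: "U \<in> sets lebesgue" using U by simp
  have lf: "loc_integrable U (\<lambda>x. \<rho> x *\<^sub>R v x)" using flux by (simp add: has_weak_div_def)
  obtain j0 :: 'a where "j0 \<in> Basis" using nonempty_Basis by blast
  then have \<rho>m [measurable]: "\<rho> \<in> borel_measurable (lebesgue_on U)"
    using weakly_differentiable_has_weak_deriv[OF \<rho>(1)]
    by (intro loc_integrable_measurable[OF U]) (simp add: has_weak_deriv_def)
  show "has_weak_div U (\<lambda>x. \<rho> x *\<^sub>R v x) (\<lambda>x. weak_grad U \<rho> x \<bullet> v x + \<rho> x * weak_div U v x)"
    unfolding has_weak_div_def
  proof (intro conjI ballI)
    show "loc_integrable U (\<lambda>x. \<rho> x *\<^sub>R v x)" by (rule lf)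
    show "loc_integrable U (\<lambda>x. weak_grad U \<rho> x \<bullet> v x + \<rho> x * weak_div U v x)"
      by (intro integrable_imp_loc_integrable[OF Us] Bochner_Integration.integrable_add int)
    fix \<phi> assume \<phi>: "\<phi> \<in> C_compact 1 U"
    let ?F = "\<lambda>x. \<phi> x *\<^sub>R v x"
    have \<phi>m: "\<phi> \<in> borel_measurable (lebesgue_on U)"
      using C_compact_lebesgue_measurable[OF \<phi>] by (rule measurable_restrict_space1)
    obtain C where C: "\<And>x. \<bar>\<phi> x\<bar> \<le> C" by (rule C_compact_bounded[OF \<phi>]) (rule that)
    obtain K where K: "C_diff 1 \<phi>" "K \<subseteq> U" "\<And>x j. x \<notin> K \<Longrightarrow> dir_deriv j \<phi> x = 0"
      by (rule C_compactE[OF \<phi>]) (rule that)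
    have i1: "integrable (lebesgue_on U) (\<lambda>x. (\<rho> x * weak_div U v x) * \<phi> x)"
      by (rule integrable_mult_bounded[OF int(2) \<phi>m C])
    have i2: "integrable (lebesgue_on U) (\<lambda>x. (weak_grad U \<rho> x \<bullet> v x) * \<phi> x)"
      by (rule integrable_mult_bounded[OF int(1) \<phi>m C])
    have "integrable lebesgue (\<lambda>x. dir_deriv (\<rho> x *\<^sub>R v x) \<phi> x)"
      by (rule integral_dir_deriv_field(1)[OF loc_integrable_inner[OF lf] \<phi>])
    then have i3: "integrable (lebesgue_on U) (\<lambda>x. dir_deriv (\<rho> x *\<^sub>R v x) \<phi> x)"
      using K(2,3) by (subst integral_lebesgue_on_eq(2)[OF Us]) auto
    have scale: "dir_deriv (c *\<^sub>R w) \<phi> x = c * dir_deriv w \<phi> x" for c w x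
      using dir_deriv_basis_expansion[OF K(1), of "c *\<^sub>R w" x] dir_deriv_basis_expansion[OF K(1), of w x]
      by (simp add: sum_distrib_left mult.assoc)
    have AE: "AE x in lebesgue_on U. (\<rho> x * weak_div U v x) * \<phi> x + dir_deriv (\<rho> x *\<^sub>R v x) \<phi> x
        = \<rho> x * weak_div U ?F x"
      using weak_div_mult_test(2)[OF U v \<phi>] by eventually_elim (simp add: scale algebra_simps)
    have m: "(\<lambda>x. \<rho> x * weak_div U ?F x) \<in> borel_measurable (lebesgue_on U)"
    proof -
      have "weak_div U ?F \<in> borel_measurable (lebesgue_on U)"
        using weak_div_mult_test(1)[OF U v \<phi>]
        by (intro loc_integrable_measurable[OF U]) (simp add: has_weak_div_def)
      then show ?thesis by measurable
    qed
    have i12: "integrable (lebesgue_on U) (\<lambda>x. (\<rho> x * weak_div U v x) * \<phi> x + dir_deriv (\<rho> x *\<^sub>R v x) \<phi> x)"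
      by (rule Bochner_Integration.integrable_add[OF i1 i3])
    have i4: "integrable (lebesgue_on U) (\<lambda>x. \<rho> x * weak_div U ?F x)"
      by (rule integrable_cong_AE_imp[OF i12 m AE])
    have "integrable (lebesgue_on U) (\<lambda>x. weak_grad U \<rho> x \<bullet> ?F x)"
      using i2 by (simp add: mult.commute)
    with \<rho>(2) i4 sobolev0_field_mult_test[OF U v \<phi>]
    have "(LINT x|lebesgue_on U. \<rho> x * weak_div U ?F x) = - (LINT x|lebesgue_on U. weak_grad U \<rho> x \<bullet> ?F x)"
      unfolding integration_by_parts_def by blast
    moreover have "(LINT x|lebesgue_on U. \<rho> x * weak_div U ?F x)
        = (LINT x|lebesgue_on U. (\<rho> x * weak_div U v x) * \<phi> x) + (LINT x|lebesgue_on U. dir_deriv (\<rho> x *\<^sub>R v x) \<phi> x)"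
      unfolding Bochner_Integration.integral_add[OF i1 i3, symmetric]
      by (rule integral_cong_AE[OF m borel_measurable_integrable[OF i12]])
         (use AE in \<open>eventually_elim, simp\<close>)
    moreover have "(LINT x|lebesgue_on U. (weak_grad U \<rho> x \<bullet> v x + \<rho> x * weak_div U v x) * \<phi> x)
        = (LINT x|lebesgue_on U. (weak_grad U \<rho> x \<bullet> v x) * \<phi> x) + (LINT x|lebesgue_on U. (\<rho> x * weak_div U v x) * \<phi> x)"
      by (simp add: distrib_right Bochner_Integration.integral_add[OF i2 i1])
    ultimately show "(LINT x|lebesgue_on U. dir_deriv (\<rho> x *\<^sub>R v x) \<phi> x)
        = - (LINT x|lebesgue_on U. (weak_grad U \<rho> x \<bullet> v x + \<rho> x * weak_div U v x) * \<phi> x)"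
      by (simp add: mult.commute)
  qed
qed

lemma weak_grad_chain:
  assumes U: "open U" and \<rho>: "weakly_differentiable U \<rho>" and B: "renormalization B b" "B 0 = 0"
  shows "weakly_differentiable U (\<lambda>x. B (\<rho> x))"
    and "AE x in lebesgue_on U. weak_grad U (\<lambda>x. B (\<rho> x)) x = b (\<rho> x) *\<^sub>R weak_grad U \<rho> x"
proof -
  have h: "has_weak_deriv U j (\<lambda>x. B (\<rho> x)) (\<lambda>x. b (\<rho> x) * weak_deriv U j \<rho> x)" if "j \<in> Basis" for j
    by (rule has_weak_deriv_chain[OF U weakly_differentiable_has_weak_deriv[OF \<rho> that] B])
  then show "weakly_differentiable U (\<lambda>x. B (\<rho> x))"
    unfolding weakly_differentiable_def by blast
  have "AE x in lebesgue_on U. \<forall>j\<in>Basis. weak_deriv U j (\<lambda>x. B (\<rho> x)) x = b (\<rho> x) * weak_deriv U j \<rho> x"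
    using weak_deriv_AE_eq[OF U h] by (intro AE_finite_allI) auto
  then show "AE x in lebesgue_on U. weak_grad U (\<lambda>x. B (\<rho> x)) x = b (\<rho> x) *\<^sub>R weak_grad U \<rho> x"
    by eventually_elim (simp add: weak_grad_def scaleR_sum_right)
qed

text \<open>Expand \<open>div (\<rho> v)\<close> by the product rule, recognize \<open>b (\<rho>) \<nabla> \<rho>\<close> as the gradient of \<open>B (\<rho>)\<close>, and integrate by
parts against \<open>v\<close> itself.\<close>

lemma renormalized_flux_integral:
  fixes v :: "'a::euclidean_space \<Rightarrow> 'a" and \<rho> :: "'a \<Rightarrow> real"
  assumes U: "open U" and v: "sobolev0_field U v"
    and \<rho>: "weakly_differentiable U \<rho>" "integration_by_parts U \<rho>"
    and flux: "has_weak_div U (\<lambda>x. \<rho> x *\<^sub>R v x) h"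
    and int: "integrable (lebesgue_on U) (\<lambda>x. weak_grad U \<rho> x \<bullet> v x)"
      "integrable (lebesgue_on U) (\<lambda>x. \<rho> x * weak_div U v x)"
    and B: "renormalization B b" "B 0 = 0" and parts: "integration_by_parts U (\<lambda>x. B (\<rho> x))"
  shows "integrable (lebesgue_on U) (\<lambda>x. (\<rho> x * b (\<rho> x) - B (\<rho> x)) * weak_div U v x)"
    and "(LINT x|lebesgue_on U. weak_div U (\<lambda>y. \<rho> y *\<^sub>R v y) x * b (\<rho> x))
      = (LINT x|lebesgue_on U. (\<rho> x * b (\<rho> x) - B (\<rho> x)) * weak_div U v x)"
proof -
  obtain M where M: "\<And>s. \<bar>b s\<bar> \<le> M"
    using B(1) by (auto simp: renormalization_def bounded_iff)
  have M0: "M \<ge> 0" using M[of 0] by linarith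
  note [measurable] = renormalization_measurable[OF B(1)]
  obtain j0 :: 'a where "j0 \<in> Basis" using nonempty_Basis by blast
  then have \<rho>m [measurable]: "\<rho> \<in> borel_measurable (lebesgue_on U)"
    using weakly_differentiable_has_weak_deriv[OF \<rho>(1)]
    by (intro loc_integrable_measurable[OF U]) (simp add: has_weak_deriv_def)
  have [measurable]: "weak_div U v \<in> borel_measurable (lebesgue_on U)"
    using sobolev0_field_weak_div(3)[OF U v] by auto
  have bm: "(\<lambda>x. b (\<rho> x)) \<in> borel_measurable (lebesgue_on U)" by measurable
  have i1: "integrable (lebesgue_on U) (\<lambda>x. (weak_grad U \<rho> x \<bullet> v x) * b (\<rho> x))"
    by (rule integrable_mult_bounded[OF int(1) bm M])
  have i2: "integrable (lebesgue_on U) (\<lambda>x. (\<rho> x * weak_div U v x) * b (\<rho> x))"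
    by (rule integrable_mult_bounded[OF int(2) bm M])
  have i3: "integrable (lebesgue_on U) (\<lambda>x. B (\<rho> x) * weak_div U v x)"
  proof (rule Bochner_Integration.integrable_bound)
    show "integrable (lebesgue_on U) (\<lambda>x. M * (\<rho> x * weak_div U v x))" using int(2) by simp
    show "AE x in lebesgue_on U. norm (B (\<rho> x) * weak_div U v x) \<le> norm (M * (\<rho> x * weak_div U v x))"
    proof (rule AE_I2)
      fix x
      show "norm (B (\<rho> x) * weak_div U v x) \<le> norm (M * (\<rho> x * weak_div U v x))"
        using mult_right_mono[OF renormalization_abs_le[OF B M, of "\<rho> x"], of "\<bar>weak_div U v x\<bar>"] M0
        by (simp add: abs_mult mult.assoc)
    qed
  qed measurable
  have "integrable (lebesgue_on U) (\<lambda>x. (\<rho> x * weak_div U v x) * b (\<rho> x) - B (\<rho> x) * weak_div U v x)"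
    by (rule Bochner_Integration.integrable_diff[OF i2 i3])
  moreover have e: "(\<lambda>x. (\<rho> x * b (\<rho> x) - B (\<rho> x)) * weak_div U v x)
      = (\<lambda>x. (\<rho> x * weak_div U v x) * b (\<rho> x) - B (\<rho> x) * weak_div U v x)"
    by (simp add: algebra_simps)
  ultimately show "integrable (lebesgue_on U) (\<lambda>x. (\<rho> x * b (\<rho> x) - B (\<rho> x)) * weak_div U v x)"
    by simp
  note chain = weak_grad_chain[OF U \<rho>(1) B]
  have m: "(\<lambda>x. weak_grad U (\<lambda>x. B (\<rho> x)) x \<bullet> v x) \<in> borel_measurable (lebesgue_on U)"
    by (rule weak_grad_inner_measurable[OF U chain(1) sobolev0_field_measurable[OF U v]])
  have AE: "AE x in lebesgue_on U. (weak_grad U \<rho> x \<bullet> v x) * b (\<rho> x) = weak_grad U (\<lambda>x. B (\<rho> x)) x \<bullet> v x"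
    using chain(2) by eventually_elim simp
  have i4: "integrable (lebesgue_on U) (\<lambda>x. weak_grad U (\<lambda>x. B (\<rho> x)) x \<bullet> v x)"
    by (rule integrable_cong_AE_imp[OF i1 m AE])
  have p: "(LINT x|lebesgue_on U. B (\<rho> x) * weak_div U v x)
      = - (LINT x|lebesgue_on U. weak_grad U (\<lambda>x. B (\<rho> x)) x \<bullet> v x)"
    using parts v i3 i4 unfolding integration_by_parts_def by blast
  have q: "(LINT x|lebesgue_on U. weak_grad U (\<lambda>x. B (\<rho> x)) x \<bullet> v x)
      = (LINT x|lebesgue_on U. (weak_grad U \<rho> x \<bullet> v x) * b (\<rho> x))"
    by (rule integral_cong_AE[OF m borel_measurable_integrable[OF i1]])
       (use AE in \<open>eventually_elim, simp\<close>)
  have "(LINT x|lebesgue_on U. weak_div U (\<lambda>y. \<rho> y *\<^sub>R v y) x * b (\<rho> x))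
      = (LINT x|lebesgue_on U. (weak_grad U \<rho> x \<bullet> v x) * b (\<rho> x) + (\<rho> x * weak_div U v x) * b (\<rho> x))"
  proof (rule integral_cong_AE)
    have [measurable]: "weak_div U (\<lambda>y. \<rho> y *\<^sub>R v y) \<in> borel_measurable (lebesgue_on U)"
      using has_weak_div_weak_div[OF flux]
      by (intro loc_integrable_measurable[OF U]) (simp add: has_weak_div_def)
    show "(\<lambda>x. weak_div U (\<lambda>y. \<rho> y *\<^sub>R v y) x * b (\<rho> x)) \<in> borel_measurable (lebesgue_on U)" by measurable
    show "(\<lambda>x. (weak_grad U \<rho> x \<bullet> v x) * b (\<rho> x) + (\<rho> x * weak_div U v x) * b (\<rho> x)) \<in> borel_measurable (lebesgue_on U)"
      using i1 i2 by auto
    show "AE x in lebesgue_on U. weak_div U (\<lambda>y. \<rho> y *\<^sub>R v y) x * b (\<rho> x)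
        = (weak_grad U \<rho> x \<bullet> v x) * b (\<rho> x) + (\<rho> x * weak_div U v x) * b (\<rho> x)"
      using weak_div_density_flux[OF U v \<rho> flux int] by eventually_elim (simp add: distrib_right)
  qed
  also have "\<dots> = (LINT x|lebesgue_on U. (\<rho> x * weak_div U v x) * b (\<rho> x)) - (LINT x|lebesgue_on U. B (\<rho> x) * weak_div U v x)"
    unfolding Bochner_Integration.integral_add[OF i1 i2] p q by simp
  also have "\<dots> = (LINT x|lebesgue_on U. (\<rho> x * b (\<rho> x) - B (\<rho> x)) * weak_div U v x)"
    unfolding e by (rule Bochner_Integration.integral_diff[OF i2 i3, symmetric])
  finally show "(LINT x|lebesgue_on U. weak_div U (\<lambda>y. \<rho> y *\<^sub>R v y) x * b (\<rho> x))
      = (LINT x|lebesgue_on U. (\<rho> x * b (\<rho> x) - B (\<rho> x)) * weak_div U v x)" .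
qed

section \<open>Geometry of the moving domain\<close>

lemma domain_of_eq:
  assumes "H > 0" "\<And>r. r \<in> cbox 0 L \<Longrightarrow> e r > - H"
  shows "domain_of L H e = {(r, y). r \<in> cbox 0 L \<and> 0 \<le> y \<and> y \<le> H + e r}"
proof (intro set_eqI iffI)
  fix x assume "x \<in> domain_of L H e"
  then obtain q where q: "q \<in> ref_domain L H" "x = ale_map H e q"
    unfolding domain_of_def by blast
  obtain r y where "q = (r, y)" by (cases q)
  with q have x: "x = (r, y * ((H + e r) / H))" and r: "r \<in> cbox 0 L" "0 \<le> y" "y \<le> H"
    by (simp_all add: ref_domain_def ale_map_def)
  have p: "H + e r > 0" using assms(2)[OF r(1)] by simp
  have "y * ((H + e r) / H) \<le> H * ((H + e r) / H)"
    using p assms(1) r by (intro mult_right_mono) auto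
  then show "x \<in> {(r, y). r \<in> cbox 0 L \<and> 0 \<le> y \<and> y \<le> H + e r}"
    using x r p assms(1) by auto
next
  fix x assume "x \<in> {(r, y). r \<in> cbox 0 L \<and> 0 \<le> y \<and> y \<le> H + e r}"
  then obtain r y where x: "x = (r, y)" and r: "r \<in> cbox 0 L" "0 \<le> y" "y \<le> H + e r" by auto
  have p: "H + e r > 0" using assms(2)[OF r(1)] by simp
  have "x = ale_map H e (r, y * H / (H + e r))" using x p assms(1) by (simp add: ale_map_def)
  moreover have "(r, y * H / (H + e r)) \<in> ref_domain L H"
    using r p assms(1) by (auto simp: ref_domain_def divide_le_eq mult.commute intro: mult_left_mono)
  ultimately show "x \<in> domain_of L H e" by (auto simp: domain_of_def)
qed

lemma back_map_eq:
  assumes "H > 0" "\<And>r. r \<in> cbox 0 L \<Longrightarrow> e r > - H" "(r, y) \<in> domain_of L H e"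
  shows "back_map L H e e' (r, y) = (r, y * ((H + e' r) / (H + e r)))"
proof -
  have r: "r \<in> cbox 0 L" "0 \<le> y" "y \<le> H + e r"
    using assms(3) domain_of_eq[of H L e, OF assms(1,2)] by auto
  have p: "H + e r > 0" using assms(2)[OF r(1)] by simp
  have inj: "inj_on (ale_map H e) (ref_domain L H)"
  proof (rule inj_onI)
    fix x x' assume x: "x \<in> ref_domain L H" "x' \<in> ref_domain L H" and eq: "ale_map H e x = ale_map H e x'"
    obtain s z z' where s: "x = (s, z)" "x' = (s, z')" and z: "z * ((H + e s) / H) = z' * ((H + e s) / H)"
      using eq by (cases x; cases x') (auto simp: ale_map_def)
    have "H + e s \<noteq> 0" using assms(2)[of s] x s by (auto simp: ref_domain_def)
    then show "x = x'" using z s assms(1) by simp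
  qed
  have "(r, y * H / (H + e r)) \<in> ref_domain L H"
    using r p assms(1) by (auto simp: ref_domain_def divide_le_eq mult.commute intro: mult_left_mono)
  moreover have "ale_map H e (r, y * H / (H + e r)) = (r, y)"
    using p assms(1) by (simp add: ale_map_def)
  ultimately have "inv_into (ref_domain L H) (ale_map H e) (r, y) = (r, y * H / (H + e r))"
    by (rule inv_into_f_eq[OF inj])
  then show ?thesis
    using assms(1) p by (simp add: back_map_def) (simp add: ale_map_def)
qed

lemma compact_domain_of:
  assumes "continuous_on (cbox 0 L) e"
  shows "compact (domain_of L H e)"
  unfolding domain_of_def
proof (rule compact_continuous_image)
  show "compact (ref_domain L H)"
    unfolding ref_domain_def by (intro compact_Times compact_cbox compact_Icc)
  have "continuous_on (ref_domain L H) (\<lambda>x. (fst x, snd x * ((H + e (fst x)) * (1 / H))))"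
    by (intro continuous_intros continuous_on_compose2[OF assms]) (auto simp: ref_domain_def)
  then show "continuous_on (ref_domain L H) (ale_map H e)"
    by (simp add: ale_map_def case_prod_unfold)
qed

text \<open>Tonelli's theorem, in the form in which it is used for the moving domain: null sets are recognized from
their vertical fibres.\<close>

lemma negligible_iff_AE_fibres:
  fixes A :: "('a::euclidean_space \<times> 'b::euclidean_space) set"
  assumes A: "A \<in> sets borel"
  shows "negligible A \<longleftrightarrow> (AE r in lborel. negligible (Pair r -` A))"
proof -
  have A': "A \<in> sets (lborel \<Otimes>\<^sub>M lborel)" using A by (subst lborel_prod) simp
  have sec: "Pair r -` A \<in> sets borel" for r
    using sets_Pair1[OF A'] by simp
  have neg: "negligible S \<longleftrightarrow> emeasure lborel S = 0" if "S \<in> sets borel" for S :: "'c::euclidean_space set"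
    using that by (auto simp: negligible_iff_null_sets null_sets_completion_iff null_sets_def)
  have "emeasure lborel A = (\<integral>\<^sup>+ r. emeasure lborel (Pair r -` A) \<partial>lborel)"
    using lborel.emeasure_pair_measure_alt[OF A'] by (simp add: lborel_prod)
  moreover have "(\<lambda>r. emeasure lborel (Pair r -` A)) \<in> borel_measurable lborel"
    using lborel.measurable_emeasure_Pair[OF A'] .
  ultimately show ?thesis
    by (simp add: neg A sec nn_integral_0_iff_AE)
qed

text \<open>Over an interior point of the cross-section, at most the bottom and the top point of the fibre fail to be
interior to the domain.\<close>

lemma negligible_domain_of_boundary:
  fixes L :: "real ^ 'n::finite"
  assumes "H > 0" "\<And>r. r \<in> cbox 0 L \<Longrightarrow> e r > - H" "continuous_on (cbox 0 L) e"
  shows "negligible (domain_of L H e - interior (domain_of L H e))"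
proof -
  let ?D = "domain_of L H e"
  note D = domain_of_eq[of H L e, OF assms(1,2)]
  \<comment> \<open>the part of the domain over the open cross-section, without bottom and top\<close>
  define O' where "O' = {x. fst x \<in> box 0 L \<and> 0 < snd x \<and> snd x < H + e (fst x)}"
  have "open O'"
  proof -
    let ?S = "box 0 L \<times> {0<..}"
    have "continuous_on ?S (\<lambda>x. H + e (fst x) - snd x)"
      by (intro continuous_intros continuous_on_compose2[OF assms(3)]) (use box_subset_cbox in auto)
    then have "open (?S \<inter> (\<lambda>x. H + e (fst x) - snd x) -` {0<..})"
      by (intro continuous_open_preimage open_Times) auto
    moreover have "?S \<inter> (\<lambda>x. H + e (fst x) - snd x) -` {0<..} = O'"
      by (auto simp: O'_def)
    ultimately show ?thesis by simp
  qed
  moreover have "O' \<subseteq> ?D"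
    using box_subset_cbox[of 0 L] by (auto simp: O'_def D)
  ultimately have O': "O' \<subseteq> interior ?D" by (rule interior_maximal[rotated])
  have "?D - interior ?D \<in> sets borel"
    using compact_domain_of[OF assms(3), of H] by (auto dest: compact_imp_closed)
  moreover have "AE r in lborel. negligible (Pair r -` (?D - interior ?D))"
  proof -
    have "negligible (cbox 0 L - box 0 L)" by (rule negligible_frontier_interval)
    then have "cbox 0 L - box 0 L \<in> null_sets lborel"
      by (simp add: negligible_iff_null_sets null_sets_completion_iff)
    then have "AE r in lborel. r \<notin> cbox 0 L - box 0 L" by (rule AE_not_in)
    then show ?thesis
    proof eventually_elim
      case (elim r)
      have "Pair r -` (?D - interior ?D) \<subseteq> {0, H + e r}"
      proof
        fix y assume "y \<in> Pair r -` (?D - interior ?D)"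
        then have "(r, y) \<in> ?D" "(r, y) \<notin> O'" using O' by auto
        then show "y \<in> {0, H + e r}" using elim by (auto simp: D O'_def)
      qed
      then show ?case by (rule negligible_subset[rotated]) simp
    qed
  qed
  ultimately show ?thesis by (subst negligible_iff_AE_fibres)
qed

text \<open>The exceptional set of \<open>P\<close> is enclosed in a Borel null set \<open>N\<close>. Almost every fibre of \<open>N\<close> is null, and a
fibre of the preimage \<open>A\<close> is a rescaled fibre of \<open>N\<close>.\<close>

lemma AE_compose_back_map:
  fixes L :: "real ^ 'n::finite"
  assumes H: "H > 0" and e: "\<And>r. r \<in> cbox 0 L \<Longrightarrow> e r > - H" "continuous_on (cbox 0 L) e"
    and e': "\<And>r. r \<in> cbox 0 L \<Longrightarrow> e' r > - H" "continuous_on (cbox 0 L) e'"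
    and P: "AE x in lebesgue_on (domain_of L H e'). P x"
  shows "AE x in lebesgue_on (domain_of L H e). P (back_map L H e e' x)"
proof -
  note D = domain_of_eq[of H L e, OF H e(1)] and D' = domain_of_eq[of H L e', OF H e'(1)]
  have Ds: "domain_of L H e \<in> sets lebesgue" "domain_of L H e' \<in> sets lebesgue"
    using compact_domain_of[OF e(2), of H] compact_domain_of[OF e'(2), of H]
    by (auto intro: fmeasurableD lmeasurable_compact)
  have "AE x in lebesgue. x \<in> domain_of L H e' \<longrightarrow> P x"
    using P Ds by (subst (asm) AE_restrict_space_iff) auto
  then have "AE x in lborel. x \<in> domain_of L H e' \<longrightarrow> P x"
    by (simp add: AE_completion_iff)
  then obtain N where N: "N \<in> null_sets lborel" "{x. \<not> (x \<in> domain_of L H e' \<longrightarrow> P x)} \<subseteq> N"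
    by (auto elim!: AE_E simp: null_sets_def)
  \<comment> \<open>stretching factor of the fibre over \<open>r\<close>\<close>
  define F where "F = (\<lambda>r. (H + e' r) / (H + e r))"
  have F: "F r > 0" if "r \<in> cbox 0 L" for r
    using e(1)[OF that] e'(1)[OF that] by (auto simp: F_def)
  define X where "X = (\<lambda>x. (fst x, snd x * F (fst x)))"
  define A where "A = X -` N \<inter> domain_of L H e"
  have X_cont: "continuous_on (domain_of L H e) X"
    unfolding X_def F_def
    by (intro continuous_intros continuous_on_compose2[OF e(2)] continuous_on_compose2[OF e'(2)])
       (use e(1) in \<open>force simp: D\<close>)+
  have A_borel: "A \<in> sets borel"
  proof -
    have Db: "domain_of L H e \<in> sets borel"
      using compact_domain_of[OF e(2), of H] by (auto dest: compact_imp_closed)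
    have "X \<in> borel_measurable (restrict_space borel (domain_of L H e))"
      using X_cont by (rule borel_measurable_continuous_on_restrict)
    moreover have "N \<in> sets borel" using N by auto
    ultimately have "A \<in> sets (restrict_space borel (domain_of L H e))"
      unfolding A_def by (auto dest: measurable_sets simp: space_restrict_space)
    then show ?thesis using Db by (simp add: sets_restrict_space_iff)
  qed
  have "negligible N"
    using null_sets_completionI[OF N(1)] by (simp add: negligible_iff_null_sets)
  then have "AE r in lborel. negligible (Pair r -` N)"
    using N by (subst (asm) negligible_iff_AE_fibres) auto
  then have "AE r in lborel. negligible (Pair r -` A)"
  proof eventually_elim
    case (elim r)
    show ?case
    proof (cases "r \<in> cbox 0 L")
      case True
      have "negligible ((\<lambda>y. (1 / F r) *\<^sub>R y) ` (Pair r -` N))"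
        using elim
        by (rule negligible_differentiable_image_negligible[OF order_refl])
           (rule bounded_linear_imp_differentiable_on[OF bounded_linear_scaleR_right])
      moreover have "Pair r -` A \<subseteq> (\<lambda>y. (1 / F r) *\<^sub>R y) ` (Pair r -` N)"
      proof
        fix y assume "y \<in> Pair r -` A"
        then have "y * F r \<in> Pair r -` N" by (simp add: A_def X_def)
        moreover have "y = (1 / F r) *\<^sub>R (y * F r)" using F[OF True] by simp
        ultimately show "y \<in> (\<lambda>y. (1 / F r) *\<^sub>R y) ` (Pair r -` N)" by (rule rev_image_eqI)
      qed
      ultimately show ?thesis by (rule negligible_subset)
    next
      case False
      then have "Pair r -` A = {}" by (auto simp: A_def D)
      then show ?thesis by simp
    qed
  qed
  then have "negligible A" using A_borel by (subst negligible_iff_AE_fibres)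
  moreover have "{x. \<not> (x \<in> domain_of L H e \<longrightarrow> P (back_map L H e e' x))} \<subseteq> A"
  proof
    fix x assume x: "x \<in> {x. \<not> (x \<in> domain_of L H e \<longrightarrow> P (back_map L H e e' x))}"
    obtain r y where ry: "x = (r, y)" by (cases x)
    have X: "back_map L H e e' x = X x"
      using back_map_eq[OF H e(1), where r=r and y=y and e'=e'] x ry by (simp add: X_def F_def)
    have r: "r \<in> cbox 0 L" "0 \<le> y" "y \<le> H + e r" using x ry by (auto simp: D)
    have p: "H + e r > 0" "H + e' r > 0" using e(1)[OF r(1)] e'(1)[OF r(1)] by auto
    have "y * F r \<le> (H + e r) * F r" using r F[OF r(1)] by (intro mult_right_mono) auto
    also have "\<dots> = H + e' r" using p by (simp add: F_def)
    finally have "X x \<in> domain_of L H e'"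
      using r F[OF r(1)] by (auto simp: D' X_def ry)
    then have "X x \<in> N" using N(2) x X by auto
    then show "x \<in> A" using x by (auto simp: A_def)
  qed
  ultimately have "AE x in lebesgue. x \<in> domain_of L H e \<longrightarrow> P (back_map L H e e' x)"
    by (intro AE_I'[of A]) (auto simp: negligible_iff_null_sets)
  then show ?thesis using Ds by (subst AE_restrict_space_iff) auto
qed

section \<open>Ramps that detect negative values\<close>

text \<open>Differences of positive parts make the ramp Lipschitz at sight and give it a primitive made of squares of
positive parts.\<close>

definition neg_ramp :: "real \<Rightarrow> real \<Rightarrow> real"
  where "neg_ramp \<epsilon> s = (max 0 (- s) - max 0 (- s - \<epsilon>)) / \<epsilon>"

definition neg_ramp_primitive :: "real \<Rightarrow> real \<Rightarrow> real"
  where "neg_ramp_primitive \<epsilon> s = ((max 0 (- s - \<epsilon>))\<^sup>2 - (max 0 (- s))\<^sup>2) / (2 * \<epsilon>)"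

lemma neg_ramp_eq:
  assumes "\<epsilon> > 0"
  shows "neg_ramp \<epsilon> s = (if s \<ge> 0 then 0 else if s \<ge> - \<epsilon> then - s / \<epsilon> else 1)"
  using assms by (auto simp: neg_ramp_def field_simps max_def)

lemma neg_ramp_bounds:
  assumes "\<epsilon> > 0"
  shows "0 \<le> neg_ramp \<epsilon> s" "neg_ramp \<epsilon> s \<le> 1"
  using assms by (auto simp: neg_ramp_eq divide_le_eq le_divide_eq divide_le_0_iff)

text \<open>Narrower ramps are larger: this allows one to pass to the limit \<open>\<epsilon> \<rightarrow> 0\<close> by comparison with one fixed ramp.\<close>

lemma neg_ramp_antimono:
  assumes "0 < \<epsilon>" "\<epsilon> \<le> \<delta>"
  shows "neg_ramp \<delta> s \<le> neg_ramp \<epsilon> s"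
proof (cases "s \<ge> 0 \<or> s < - \<epsilon>")
  case True
  then show ?thesis using assms neg_ramp_bounds(2)[of \<delta> s] by (auto simp: neg_ramp_eq)
next
  case False
  then have "- s / \<delta> \<le> - s / \<epsilon>" using assms by (intro divide_left_mono) auto
  then show ?thesis using False assms by (auto simp: neg_ramp_eq)
qed

lemma renormalization_neg_ramp:
  assumes "\<epsilon> > 0"
  shows "renormalization (neg_ramp_primitive \<epsilon>) (neg_ramp \<epsilon>)"
  unfolding renormalization_def
proof (intro conjI allI)
  fix s :: real
  have "((\<lambda>s. (max 0 (- s - c))\<^sup>2) has_real_derivative - (2 * max 0 (- s - c))) (at s)" for c
  proof -
    have "((\<lambda>s. - s - c) has_real_derivative - 1) (at s)"
      by (auto intro!: derivative_eq_intros)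
    from DERIV_chain2[OF DERIV_positive_part_squared this] show ?thesis by simp
  qed
  from DERIV_cdivide[OF DERIV_diff[OF this[of \<epsilon>] this[of 0]], of "2 * \<epsilon>"]
  have "(neg_ramp_primitive \<epsilon> has_real_derivative
      (- (2 * max 0 (- s - \<epsilon>)) - - (2 * max 0 (- s - 0))) / (2 * \<epsilon>)) (at s)"
    unfolding neg_ramp_primitive_def[abs_def] by simp
  moreover have "(- (2 * max 0 (- s - \<epsilon>)) - - (2 * max 0 (- s - 0))) / (2 * \<epsilon>) = neg_ramp \<epsilon> s"
    using assms by (simp add: neg_ramp_def field_simps)
  ultimately show "(neg_ramp_primitive \<epsilon> has_real_derivative neg_ramp \<epsilon> s) (at s)"
    by simp
next
  show "bounded (range (neg_ramp \<epsilon>))"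
    unfolding bounded_iff using neg_ramp_bounds[OF assms] by (intro exI[of _ 1]) auto
  have "(2 / \<epsilon>)-lipschitz_on UNIV (neg_ramp \<epsilon>)"
  proof (rule lipschitz_onI)
    fix s t :: real
    have max_lipschitz: "\<bar>max 0 c - max 0 d\<bar> \<le> \<bar>c - d\<bar>" for c d :: real
      by (simp add: max_def)
    have split: "\<bar>(c - d) - (c' - d')\<bar> \<le> \<bar>c - c'\<bar> + \<bar>d - d'\<bar>" for c d c' d' :: real
      by linarith
    have "\<bar>(max 0 (- s) - max 0 (- s - \<epsilon>)) - (max 0 (- t) - max 0 (- t - \<epsilon>))\<bar>
        \<le> \<bar>- s - - t\<bar> + \<bar>(- s - \<epsilon>) - (- t - \<epsilon>)\<bar>"
      by (rule order_trans[OF split]) (intro add_mono max_lipschitz)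
    also have "\<dots> = 2 * \<bar>s - t\<bar>" by simp
    finally have "\<bar>(max 0 (- s) - max 0 (- s - \<epsilon>)) - (max 0 (- t) - max 0 (- t - \<epsilon>))\<bar> / \<epsilon>
        \<le> 2 * \<bar>s - t\<bar> / \<epsilon>"
      using assms by (intro divide_right_mono) auto
    then show "dist (neg_ramp \<epsilon> s) (neg_ramp \<epsilon> t) \<le> 2 / \<epsilon> * dist s t"
      using assms unfolding dist_real_def neg_ramp_def diff_divide_distrib[symmetric] abs_divide by simp
  qed (use assms in simp)
  then show "\<exists>C. C-lipschitz_on UNIV (neg_ramp \<epsilon>)" by blast
qed

text \<open>The defect is constant below \<open>- \<epsilon>\<close>, since there both \<open>s b s\<close> and \<open>B s\<close> have slope \<open>1\<close>; it is this boundedness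
by \<open>\<epsilon> / 2\<close>, uniform in \<open>s\<close>, that lets the flux term disappear in the limit.\<close>

lemma neg_ramp_defect:
  assumes "\<epsilon> > 0"
  shows "\<bar>s * neg_ramp \<epsilon> s - neg_ramp_primitive \<epsilon> s\<bar> \<le> \<epsilon> / 2"
proof -
  consider "s \<ge> 0" | "- \<epsilon> \<le> s" "s < 0" | "s < - \<epsilon>" by linarith
  then show ?thesis
  proof cases
    case 1
    then show ?thesis using assms by (simp add: neg_ramp_def neg_ramp_primitive_def)
  next
    case 2
    then have "s * neg_ramp \<epsilon> s - neg_ramp_primitive \<epsilon> s = - (s\<^sup>2 / (2 * \<epsilon>))"
      using assms by (simp add: neg_ramp_def neg_ramp_primitive_def field_simps power2_eq_square)
    moreover have "s\<^sup>2 \<le> \<epsilon>\<^sup>2" using 2 assms by (intro power2_le_iff_abs_le[THEN iffD2]) auto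
    ultimately show ?thesis
      using assms by (simp add: divide_le_eq power2_eq_square)
  next
    case 3
    then have "s * neg_ramp \<epsilon> s - neg_ramp_primitive \<epsilon> s = - (\<epsilon> / 2)"
      using assms by (simp add: neg_ramp_def neg_ramp_primitive_def field_simps power2_eq_square)
    then show ?thesis using assms by simp
  qed
qed

section \<open>One time step\<close>

text \<open>The scheme integrates over the closed domain, while weak derivatives live on its interior.\<close>

lemma integral_interior_eq:
  fixes f :: "'a::euclidean_space \<Rightarrow> real"
  assumes "D \<in> sets lebesgue" "negligible (D - interior D)" "integrable (lebesgue_on D) f"
  shows "(LINT x|lebesgue_on D. f x) = (LINT x|lebesgue_on (interior D). f x)"
proof -
  have U: "interior D \<in> sets lebesgue" by simp
  have fm: "f \<in> borel_measurable (lebesgue_on D)" using assms(3) by auto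
  have fU: "f \<in> borel_measurable (lebesgue_on (interior D))"
    using measurable_restrict_mono[OF fm interior_subset] .
  have "(LINT x|lebesgue. indicat_real D x *\<^sub>R f x) = (LINT x|lebesgue. indicat_real (interior D) x *\<^sub>R f x)"
  proof (rule integral_cong_AE)
    show "(\<lambda>x. indicat_real D x *\<^sub>R f x) \<in> borel_measurable lebesgue"
      using fm assms(1) by (subst (asm) borel_measurable_restrict_space_iff) auto
    show "(\<lambda>x. indicat_real (interior D) x *\<^sub>R f x) \<in> borel_measurable lebesgue"
      using fU by (subst (asm) borel_measurable_restrict_space_iff) auto
    have "AE x in lebesgue. x \<notin> D - interior D"
      using assms(2) by (intro AE_not_in) (simp add: negligible_iff_null_sets)
    then show "AE x in lebesgue. indicat_real D x *\<^sub>R f x = indicat_real (interior D) x *\<^sub>R f x"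
      by eventually_elim (use interior_subset[of D] in \<open>auto simp: indicator_def\<close>)
  qed
  then show ?thesis
    using integral_restrict_space[of D lebesgue f] integral_restrict_space[of "interior D" lebesgue f] assms(1)
    by simp
qed

text \<open>The limit \<open>\<epsilon> \<rightarrow> 0\<close> is taken in the inequality
\<open>- \<epsilon> \<tau> / 2 \<integral> \<bar>div v\<bar> \<le> \<tau> \<integral> D\<^sub>t \<rho> b\<^sub>\<epsilon> (\<rho>) \<le> \<integral> \<rho> b\<^sub>1 (\<rho>) \<le> 0\<close>,
where \<open>b\<^sub>\<epsilon>\<close> is the ramp of width \<open>\<epsilon>\<close>.\<close>

lemma density_nonneg_step:
  fixes L :: "real ^ 'n::finite"
  assumes \<tau>: "\<tau> > 0" and H: "H > 0"
    and e: "\<And>r. r \<in> cbox 0 L \<Longrightarrow> e r > - H" "continuous_on (cbox 0 L) e"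
    and e': "\<And>r. r \<in> cbox 0 L \<Longrightarrow> e' r > - H" "continuous_on (cbox 0 L) e'"
    and \<rho>m: "\<rho> \<in> borel_measurable (lebesgue_on (domain_of L H e))"
    and eqn: "continuity_eq \<tau> L H Q e e' \<rho> \<rho>' v"
    and v: "sobolev0_field (interior (domain_of L H e)) v"
    and reg: "regular_state (interior (domain_of L H e)) \<rho> u v"
    and adm: "admissible_density (interior (domain_of L H e)) Q \<rho>"
    and \<rho>': "AE x in lebesgue_on (domain_of L H e'). \<rho>' x \<ge> 0"
  shows "AE x in lebesgue_on (domain_of L H e). \<rho> x \<ge> 0"
proof -
  define D where "D = domain_of L H e"
  define U where "U = interior D"
  note [measurable] = \<rho>m[folded D_def]
  have U: "open U" by (simp add: U_def)
  have Ds: "D \<in> sets lebesgue"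
    using compact_domain_of[OF e(2), of H] by (auto simp: D_def intro: fmeasurableD lmeasurable_compact)
  have null: "negligible (D - interior D)"
    unfolding D_def by (rule negligible_domain_of_boundary[OF H e])
  have v': "sobolev0_field U v" using v by (simp add: U_def D_def)
  obtain h where reg': "weakly_differentiable U \<rho>" "has_weak_div U (\<lambda>x. \<rho> x *\<^sub>R v x) h"
    "integrable (lebesgue_on U) (\<lambda>x. weak_grad U \<rho> x \<bullet> v x)"
    "integrable (lebesgue_on U) (\<lambda>x. \<rho> x * weak_div U v x)"
    using reg unfolding regular_state_def U_def D_def by blast
  have adm': "(\<lambda>x. b (\<rho> x)) \<in> Q" "integration_by_parts U (\<lambda>x. B (\<rho> x))" if "renormalization B b" for B b
    using adm that unfolding admissible_density_def U_def D_def by blast+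
  \<comment> \<open>The identity is itself a renormalization, which yields Green's formula for the density.\<close>
  have "renormalization (\<lambda>s. s) (\<lambda>s. 1)"
    unfolding renormalization_def by (auto intro!: exI[of _ 0] lipschitz_onI)
  then have parts_id: "integration_by_parts U \<rho>" using adm'(2) by fastforce
  define dv where "dv = (LINT x|lebesgue_on U. \<bar>weak_div U v x\<bar>)"
  have dv_int: "integrable (lebesgue_on U) (weak_div U v)"
    by (rule sobolev0_field_weak_div(3)[OF U v'])
  have pull_back: "AE x in lebesgue_on D. \<rho>' (back_map L H e e' x) \<ge> 0"
    unfolding D_def by (rule AE_compose_back_map[OF H e e' \<rho>'])
  let ?d = "ale_diff \<tau> L H e e' \<rho> \<rho>'"
  have below: "AE x in lebesgue_on D. \<tau> * (?d x * neg_ramp \<epsilon> (\<rho> x)) \<le> \<rho> x * neg_ramp \<epsilon> (\<rho> x)"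
    if \<epsilon>: "\<epsilon> > 0" for \<epsilon>
    using pull_back AE_space
  proof eventually_elim
    case (elim x)
    then have xD: "x \<in> domain_of L H e" by (simp add: D_def)
    obtain r y where x: "x = (r, y)" by (cases x)
    have r: "r \<in> cbox 0 L" using xD x domain_of_eq[of H L e, OF H e(1)] by auto
    have "back_factor H e e' x \<ge> 0"
      using e(1)[OF r] e'(1)[OF r] by (simp add: back_factor_def x)
    then have "\<rho> x - back_factor H e e' x * \<rho>' (back_map L H e e' x) \<le> \<rho> x"
      using elim(1) by simp
    then show ?case
      using mult_right_mono[OF _ neg_ramp_bounds(1)[OF \<epsilon>, of "\<rho> x"]] \<tau>
      by (simp add: ale_diff_def)
  qed
  have balance: "integrable (lebesgue_on D) (\<lambda>x. ?d x * neg_ramp \<epsilon> (\<rho> x))"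
    "(LINT x|lebesgue_on D. ?d x * neg_ramp \<epsilon> (\<rho> x)) \<ge> - (\<epsilon> / 2 * dv)" if \<epsilon>: "\<epsilon> > 0" for \<epsilon>
  proof -
    note B = renormalization_neg_ramp[OF \<epsilon>]
    have B0: "neg_ramp_primitive \<epsilon> 0 = 0" using \<epsilon> by (simp add: neg_ramp_primitive_def)
    obtain I1 I2 where I: "has_bochner_integral (lebesgue_on D) (\<lambda>x. ?d x * neg_ramp \<epsilon> (\<rho> x)) I1"
      "has_bochner_integral (lebesgue_on D) (\<lambda>x. weak_div U (\<lambda>y. \<rho> y *\<^sub>R v y) x * neg_ramp \<epsilon> (\<rho> x)) I2"
      "I1 + I2 = 0"
      using bspec[OF eqn[unfolded continuity_eq_def Let_def] adm'(1)[OF B]]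
      unfolding D_def U_def by blast
    show "integrable (lebesgue_on D) (\<lambda>x. ?d x * neg_ramp \<epsilon> (\<rho> x))"
      using I(1) by (rule has_bochner_integral_iff[THEN iffD1, THEN conjunct1])
    note flux = renormalized_flux_integral[OF U v' reg'(1) parts_id reg'(2-4) B B0 adm'(2)[OF B]]
    have "I2 = (LINT x|lebesgue_on D. weak_div U (\<lambda>y. \<rho> y *\<^sub>R v y) x * neg_ramp \<epsilon> (\<rho> x))"
      using I(2) by (simp add: has_bochner_integral_iff)
    also have "\<dots> = (LINT x|lebesgue_on U. weak_div U (\<lambda>y. \<rho> y *\<^sub>R v y) x * neg_ramp \<epsilon> (\<rho> x))"
      unfolding U_def
      by (rule integral_interior_eq[OF Ds null]) (use I(2) in \<open>simp add: has_bochner_integral_iff U_def\<close>)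
    also have "\<dots> = (LINT x|lebesgue_on U. (\<rho> x * neg_ramp \<epsilon> (\<rho> x) - neg_ramp_primitive \<epsilon> (\<rho> x)) * weak_div U v x)"
      by (rule flux(2))
    also have "\<dots> \<le> (LINT x|lebesgue_on U. \<epsilon> / 2 * \<bar>weak_div U v x\<bar>)"
    proof (rule integral_mono[OF flux(1)])
      show "integrable (lebesgue_on U) (\<lambda>x. \<epsilon> / 2 * \<bar>weak_div U v x\<bar>)" using dv_int by simp
      fix x
      have "\<bar>(\<rho> x * neg_ramp \<epsilon> (\<rho> x) - neg_ramp_primitive \<epsilon> (\<rho> x)) * weak_div U v x\<bar> \<le> \<epsilon> / 2 * \<bar>weak_div U v x\<bar>"
        unfolding abs_mult by (intro mult_right_mono neg_ramp_defect[OF \<epsilon>]) simp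
      then show "(\<rho> x * neg_ramp \<epsilon> (\<rho> x) - neg_ramp_primitive \<epsilon> (\<rho> x)) * weak_div U v x \<le> \<epsilon> / 2 * \<bar>weak_div U v x\<bar>"
        by linarith
    qed
    also have "\<dots> = \<epsilon> / 2 * dv" by (simp add: dv_def)
    finally show "(LINT x|lebesgue_on D. ?d x * neg_ramp \<epsilon> (\<rho> x)) \<ge> - (\<epsilon> / 2 * dv)"
      using I(1,3) by (simp add: has_bochner_integral_iff)
  qed
  have sign: "\<rho> x * neg_ramp 1 (\<rho> x) \<le> 0" for x
    using neg_ramp_bounds(1)[of 1 "\<rho> x"] by (auto simp: neg_ramp_eq mult_le_0_iff)
  \<comment> \<open>The width \<open>1\<close> of the fixed ramp is arbitrary. Its integrability follows from that of the tested time
      derivative, because \<open>\<tau> D\<^sub>t \<rho> b (\<rho>) \<le> \<rho> b (\<rho>) \<le> 0\<close>.\<close>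
  have m1: "(\<lambda>x. \<rho> x * neg_ramp 1 (\<rho> x)) \<in> borel_measurable (lebesgue_on D)"
    using renormalization_measurable(2)[OF renormalization_neg_ramp[of 1]] by measurable
  have i1: "integrable (lebesgue_on D) (\<lambda>x. \<rho> x * neg_ramp 1 (\<rho> x))"
  proof (rule Bochner_Integration.integrable_bound[OF _ m1])
    show "integrable (lebesgue_on D) (\<lambda>x. \<tau> * (?d x * neg_ramp 1 (\<rho> x)))"
      using balance(1)[of 1] by simp
    show "AE x in lebesgue_on D. norm (\<rho> x * neg_ramp 1 (\<rho> x)) \<le> norm (\<tau> * (?d x * neg_ramp 1 (\<rho> x)))"
      using below[of 1, simplified]
    proof eventually_elim
      case (elim x)
      then show ?case using sign[of x] by (simp only: real_norm_def)
    qed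
  qed
  have lower: "(LINT x|lebesgue_on D. \<rho> x * neg_ramp 1 (\<rho> x)) \<ge> - (\<epsilon> * (\<tau> / 2 * dv))"
    if \<epsilon>: "0 < \<epsilon>" "\<epsilon> \<le> 1" for \<epsilon>
  proof -
    have "\<tau> * (LINT x|lebesgue_on D. ?d x * neg_ramp \<epsilon> (\<rho> x)) = (LINT x|lebesgue_on D. \<tau> * (?d x * neg_ramp \<epsilon> (\<rho> x)))"
      by simp
    also have "\<dots> \<le> (LINT x|lebesgue_on D. \<rho> x * neg_ramp 1 (\<rho> x))"
    proof (rule integral_mono_AE[OF _ i1])
      show "integrable (lebesgue_on D) (\<lambda>x. \<tau> * (?d x * neg_ramp \<epsilon> (\<rho> x)))"
        using balance(1)[OF \<epsilon>(1)] by simp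
      show "AE x in lebesgue_on D. \<tau> * (?d x * neg_ramp \<epsilon> (\<rho> x)) \<le> \<rho> x * neg_ramp 1 (\<rho> x)"
        using below[OF \<epsilon>(1)]
      proof eventually_elim
        case (elim x)
        have "\<rho> x * neg_ramp \<epsilon> (\<rho> x) \<le> \<rho> x * neg_ramp 1 (\<rho> x)"
        proof (cases "\<rho> x \<ge> 0")
          case True
          then show ?thesis using \<epsilon> by (simp add: neg_ramp_eq)
        next
          case False
          then show ?thesis using neg_ramp_antimono[OF \<epsilon>, of "\<rho> x"] by (intro mult_left_mono_neg) auto
        qed
        with elim show ?case by linarith
      qed
    qed
    finally have "\<tau> * (LINT x|lebesgue_on D. ?d x * neg_ramp \<epsilon> (\<rho> x)) \<le> (LINT x|lebesgue_on D. \<rho> x * neg_ramp 1 (\<rho> x))" .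
    moreover have "\<tau> * - (\<epsilon> / 2 * dv) \<le> \<tau> * (LINT x|lebesgue_on D. ?d x * neg_ramp \<epsilon> (\<rho> x))"
      using balance(2)[OF \<epsilon>(1)] \<tau> by (intro mult_left_mono) auto
    moreover have "\<tau> * - (\<epsilon> / 2 * dv) = - (\<epsilon> * (\<tau> / 2 * dv))" by simp
    ultimately show ?thesis by linarith
  qed
  have "(LINT x|lebesgue_on D. \<rho> x * neg_ramp 1 (\<rho> x)) \<ge> 0"
  proof -
    have "((\<lambda>\<epsilon>. - (\<epsilon> * (\<tau> / 2 * dv))) \<longlongrightarrow> - (0 * (\<tau> / 2 * dv))) (at_right 0)"
      by (intro tendsto_intros)
    moreover have "eventually (\<lambda>\<epsilon>::real. - (\<epsilon> * (\<tau> / 2 * dv)) \<le> (LINT x|lebesgue_on D. \<rho> x * neg_ramp 1 (\<rho> x))) (at_right 0)"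
      using eventually_at_right_less[of "0::real"] eventually_at_right_real[of 0 "1::real", simplified]
      by eventually_elim (use lower in auto)
    ultimately show ?thesis
      by (intro tendsto_upperbound[where F="at_right (0::real)"]) auto
  qed
  moreover have "(LINT x|lebesgue_on D. - (\<rho> x * neg_ramp 1 (\<rho> x))) \<ge> 0"
    using sign by (intro integral_nonneg_AE AE_I2) simp
  ultimately have "(LINT x|lebesgue_on D. - (\<rho> x * neg_ramp 1 (\<rho> x))) = 0" by simp
  then have "AE x in lebesgue_on D. - (\<rho> x * neg_ramp 1 (\<rho> x)) = 0"
    using i1 sign by (subst (asm) integral_nonneg_eq_0_iff_AE) auto
  then have "AE x in lebesgue_on D. \<rho> x \<ge> 0"
    by eventually_elim (auto simp: neg_ramp_eq split: if_splits)
  then show ?thesis unfolding D_def .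
qed

section \<open>Non-negativity at every time level\<close>

theorem lemma3p3:
  fixes L :: "real ^ 'n::finite"
    and H T \<tau> a \<gamma> \<mu> lam \<alpha> \<beta> :: real
    and N :: nat
    and p :: "real \<Rightarrow> real"
    and f :: "real \<Rightarrow> 'n point \<Rightarrow> 'n point"
    and g :: "real \<Rightarrow> real ^ 'n \<Rightarrow> real"
    and W :: "(real ^ 'n \<Rightarrow> real) set"
    and Q :: "'n point set \<Rightarrow> ('n point \<Rightarrow> real) set"
    and V :: "'n point set \<Rightarrow> ('n point \<Rightarrow> 'n point) set"
    and \<eta> z :: "nat \<Rightarrow> real ^ 'n \<Rightarrow> real"
    and \<Omega> :: "nat \<Rightarrow> 'n point set"
    and \<rho> :: "nat \<Rightarrow> 'n point \<Rightarrow> real"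
    and u w v :: "nat \<Rightarrow> 'n point \<Rightarrow> 'n point"
    and \<rho>\<^sub>0 :: "'n point \<Rightarrow> real"
    and u\<^sub>0 :: "'n point \<Rightarrow> 'n point"
  assumes dimension: "CARD('n) + 1 \<in> {2, 3}"
    and geometry: "\<And>i. L $ i > 0" "H > 0"
    and time_grid: "T > 0" "N > 0" "\<tau> = T / real N"
    and constants: "a > 0" "\<gamma> > 1" "\<mu> > 0" "\<mu> + lam \<ge> 0" "\<alpha> > 0" "\<beta> \<ge> 0"
    and pressure: "\<And>s. s \<ge> 0 \<Longrightarrow> p s = a * s powr \<gamma>"
    and Omega_def: "\<Omega> = (\<lambda>k. domain_of L H (\<eta> k))"
    and z_def: "z = structure_velocity \<tau> \<eta>"
    and w_def: "w = (\<lambda>k. wall_velocity H (\<eta> k) (z k))"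
    and v_def: "v = (\<lambda>k x. u k x - w k x)"
    and space_W: "linear_function_space W"
      "\<And>\<psi>. \<psi> \<in> W \<Longrightarrow> continuous_on (cbox 0 L) \<psi> \<and> sobolev0 2 (interior (cbox 0 L)) 2 \<psi>"
    and space_Q: "\<And>k. k \<in> {1..N} \<Longrightarrow> linear_function_space (Q (\<Omega> k))"
      "\<And>k. k \<in> {1..N} \<Longrightarrow> Q (\<Omega> k) \<subseteq> Lp_space (\<Omega> k) \<gamma>"
    and space_V: "\<And>k. k \<in> {1..N} \<Longrightarrow> linear_function_space (V (\<Omega> k))"
      "\<And>k \<Psi>. k \<in> {1..N} \<Longrightarrow> \<Psi> \<in> V (\<Omega> k) \<Longrightarrow> sobolev_field (interior (\<Omega> k)) \<Psi>"
    and initial: "\<rho> 0 = \<rho>\<^sub>0" "u 0 = u\<^sub>0" "\<And>r. r \<in> cbox 0 L \<Longrightarrow> \<eta> 0 r = 0"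
    and in_spaces: "\<And>k. k \<in> {1..N} \<Longrightarrow> \<eta> k \<in> W \<and> \<rho> k \<in> Q (\<Omega> k) \<and> u k \<in> V (\<Omega> k)"
    and no_contact: "\<And>k r. k \<in> {1..N} \<Longrightarrow> r \<in> cbox 0 L \<Longrightarrow> \<eta> k r > - H"
    and boundary: "\<And>k. k \<in> {1..N} \<Longrightarrow> eq_on_boundary (interior (\<Omega> k)) (u k) (w k)"
    and data_integrable:
      "\<And>k. k \<in> {1..N} \<Longrightarrow> AE x in lebesgue_on (\<Omega> k).
         integrable (lebesgue_on {real k * \<tau>..<real (k + 1) * \<tau>}) (\<lambda>t. f t x)"
      "\<And>k. k \<in> {1..N} \<Longrightarrow> AE r in lebesgue_on (cbox 0 L).
         integrable (lebesgue_on {real k * \<tau>..<real (k + 1) * \<tau>}) (\<lambda>t. g t r)"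
    and S1: "\<And>k. k \<in> {1..N} \<Longrightarrow>
      continuity_eq \<tau> L H (Q (\<Omega> k)) (\<eta> k) (\<eta> (k - 1)) (\<rho> k) (\<rho> (k - 1)) (v k)"
    and S2: "\<And>k. k \<in> {1..N} \<Longrightarrow>
      momentum_eq \<tau> L H \<mu> lam \<alpha> \<beta> p W (V (\<Omega> k)) (\<eta> k) (\<eta> (k - 1)) (z k) (z (k - 1))
        (\<rho> k) (\<rho> (k - 1)) (u k) (u (k - 1)) (v k) (time_avg \<tau> k f) (time_avg \<tau> k g)"
    and regularity: "\<And>k. k \<in> {1..N} \<Longrightarrow> regular_state (interior (\<Omega> k)) (\<rho> k) (u k) (v k)"
    and admissibility: "\<And>k. k \<in> {1..N} \<Longrightarrow>
      admissible_density (interior (\<Omega> k)) (Q (\<Omega> k)) (\<rho> k)"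
    and nonneg: "AE x in lebesgue_on (\<Omega> 0). \<rho>\<^sub>0 x \<ge> 0"
  shows "\<forall>k\<in>{1..N}. AE x in lebesgue_on (\<Omega> k). \<rho> k x \<ge> 0"
proof -
  have \<tau>: "\<tau> > 0" using time_grid by simp
  \<comment> \<open>The initial displacement is only known to vanish on the cross-section; it need not lie in \<open>W\<close>.\<close>
  have cont: "continuous_on (cbox 0 L) (\<eta> k)" if "k \<le> N" for k
  proof (cases "k = 0")
    case True
    show ?thesis unfolding True
      by (subst continuous_on_cong[OF refl initial(3)]) (simp_all add: continuous_on_const)
  next
    case False
    with that have "k \<in> {1..N}" by simp
    with in_spaces have "\<eta> k \<in> W" by blast
    then show ?thesis using space_W(2) by blast
  qed
  have above: "\<eta> k r > - H" if "k \<le> N" "r \<in> cbox 0 L" for k r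
    using that initial(3) no_contact geometry(2) by (cases "k = 0") auto
  have "AE x in lebesgue_on (\<Omega> k). \<rho> k x \<ge> 0" if "k \<le> N" for k
    using that
  proof (induction k)
    case 0
    then show ?case using nonneg initial(1) by simp
  next
    case (Suc k)
    then have k: "Suc k \<in> {1..N}" "k \<le> N" by auto
    have Om: "domain_of L H (\<eta> j) = \<Omega> j" for j by (simp add: Omega_def)
    have "\<rho> (Suc k) \<in> borel_measurable (lebesgue_on (\<Omega> (Suc k)))"
      using in_spaces[OF k(1)] space_Q(2)[OF k(1)] by (auto simp: Lp_space_def)
    \<comment> \<open>\<open>v = u - w\<close>, so the kinematic boundary condition says that \<open>v\<close> has zero boundary values.\<close>
    moreover have "sobolev0_field (interior (\<Omega> (Suc k))) (v (Suc k))"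
      using boundary[OF k(1)] by (simp add: eq_on_boundary_def v_def)
    ultimately show ?case
      using S1[OF k(1)] regularity[OF k(1)] admissibility[OF k(1)] Suc.IH[OF k(2)] k
      by (intro density_nonneg_step[OF \<tau> geometry(2) above cont above cont, of "Suc k" k, unfolded Om]) auto
  qed
  then show ?thesis by simp
qed

end
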